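(* Let $\mathcal{U}\in H^1_\rho(y^\alpha,\mathbb{R}^d\times\mathbb{R}^+)$ solve $$A(\mathcal{U},\mathcal{V})=d_\beta\,(f,\mathrm{tr}_0\mathcal{V})_{L^2(\mathbb{R}^d)}\qquad\text{for all }\mathcal{V}\in H^1_\rho(y^\alpha,\mathbb{R}^d\times\mathbb{R}^+),$$ and, for $\mathcal{Y}>0$, let $\mathcal{U}^{\mathcal{Y}}\in H^1_\rho(y^\alpha,\mathbb{R}^d\times(0,\mathcal{Y}))$ solve $$A^{\mathcal{Y}}(\mathcal{U}^{\mathcal{Y}},\mathcal{V})=d_\beta\,(f,\mathrm{tr}_0\mathcal{V})_{L^2(\mathbb{R}^d)}\qquad\text{for all }\mathcal{V}\in H^1_\rho(y^\alpha,\mathbb{R}^d\times(0,\mathcal{Y})).$$ Then for any fixed $\widetilde{\mathcal{Y}}>0$ (with $\mathcal{Y}>\widetilde{\mathcal{Y}}$) it holds that $\mathcal{U}^{\mathcal{Y}}\to\mathcal{U}$ in $H^1_\rho(y^\alpha,\mathbb{R}^d\times(0,\widetilde{\mathcal{Y}}))$ as $\mathcal{Y}\to\infty$. If $s>0$, then additionally $\mathrm{tr}_0\,\mathcal{U}^{\mathcal{Y}}\to\mathrm{tr}_0\,\mathcal{U}$ in $L^2(\mathbb{R}^d)$ as $\mathcal{Y}\to\infty$.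
   Context: Fixed data: $d\in\{2,3\}$, $\beta\in(0,1)$, $\alpha:=1-2\beta\in(-1,1)$, $d_\beta:=2^{1-2\beta}\Gamma(1-\beta)/\Gamma(\beta)$, $s\ge0$, and $s>0$ if $d=2$. $\Omega\subseteq\mathbb{R}^d$ is a bounded Lipschitz domain. $\mathfrak{A}:\mathbb{R}^d\to\mathbb{R}^{d\times d}$ is smooth, pointwise symmetric, uniformly positive definite ($\mathfrak{A}(x)\eta\cdot\eta\ge\mathfrak{A}_0|\eta|^2$ for all $x,\eta\in\mathbb{R}^d$, with some $\mathfrak{A}_0>0$), and $\mathfrak{A}\equiv I$ on $\mathbb{R}^d\setminus\overline\Omega$. $f\in L^2(\mathbb{R}^d)$ with $\operatorname{supp}f\subseteq\Omega$. Put $\mathfrak{A}_x:=\begin{pmatrix}\mathfrak{A}&0\\0&1\end{pmatrix}\in\mathbb{R}^{(d+1)\times(d+1)}$. Spaces: $\rho(x,y):=(1+|x|^2+|y|^2)^{1/2}$. For $D\subset\mathbb{R}^d\times\mathbb{R}^+$, $H^1_\rho(y^\alpha,D)$ is the space of functions $\mathcal{U}$ with finite norm $\|\mathcal{U}\|^2_{H^1_\rho(y^\alpha,D)}:=\int\int_D y^\alpha(|\nabla\mathcal{U}|^2+\rho^{-2}|\mathcal{U}|^2)\,dx\,dy$, where $\nabla=(\nabla_x,\partial_y)$. $\mathrm{tr}_0\mathcal{U}$ denotes the trace at $y=0$. If $s>0$, trial and test functions in the variational problems are understood to have trace in $L^2(\mathbb{R}^d)$. Bilinear forms: for $\mathcal{Y}\in(0,\infty)$,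 $A^{\mathcal{Y}}(\mathcal{U},\mathcal{V}):=\int_0^{\mathcal{Y}}y^\alpha\int_{\mathbb{R}^d}\mathfrak{A}_x\nabla\mathcal{U}\cdot\nabla\mathcal{V}\,dx\,dy+s\,d_\beta\int_{\mathbb{R}^d}\mathrm{tr}_0\mathcal{U}\,\mathrm{tr}_0\mathcal{V}\,dx$, and $A$ is the same expression with $\mathcal{Y}=\infty$. Both variational problems have unique solutions. *)

theory Defs
  imports "HOL-Analysis.Analysis"
begin

section \<open>Smooth functions and bounded Lipschitz domains\<close>

primrec C_times :: "nat \<Rightarrow> ('a::real_normed_vector \<Rightarrow> 'b::real_normed_vector) \<Rightarrow> bool" where
  "C_times 0 f \<longleftrightarrow> continuous_on UNIV f"
| "C_times (Suc k) f \<longleftrightarrow>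
     f differentiable_on UNIV \<and> (\<forall>v. C_times k (\<lambda>x. frechet_derivative f (at x) v))"

definition smooth :: "('a::real_normed_vector \<Rightarrow> 'b::real_normed_vector) \<Rightarrow> bool" where
  "smooth f \<longleftrightarrow> (\<forall>k. C_times k f)"

text \<open>
  Near each boundary point, in coordinates with vertical direction \<open>\<nu>\<close>, the set lies strictly below
  the graph of a Lipschitz function \<open>\<gamma>\<close> on the hyperplane orthogonal to \<open>\<nu>\<close>.  As the identity holds
  on a full ball, the boundary inside that ball is the graph of \<open>\<gamma>\<close>.
\<close>

definition bounded_lipschitz_domain :: "'a::euclidean_space set \<Rightarrow> bool" where
  "bounded_lipschitz_domain S \<longleftrightarrow>
     open S \<and> connected S \<and> S \<noteq> {} \<and> bounded S \<and>
     (\<forall>p \<in> frontier S. \<exists>r \<nu> \<gamma> L.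
        0 < r \<and> norm \<nu> = 1 \<and> L-lipschitz_on {x. x \<bullet> \<nu> = 0} \<gamma> \<and>
        S \<inter> ball p r = {x \<in> ball p r. x \<bullet> \<nu> < (\<gamma> (x - (x \<bullet> \<nu>) *\<^sub>R \<nu>) :: real)})"


section \<open>Square-integrable functions\<close>

definition L2 :: "('a::euclidean_space \<Rightarrow> real) set" where
  "L2 = {f. f \<in> borel_measurable lebesgue \<and> integrable lebesgue (\<lambda>x. (f x)\<^sup>2)}"

definition L2_inner :: "('a::euclidean_space \<Rightarrow> real) \<Rightarrow> ('a \<Rightarrow> real) \<Rightarrow> real" where
  "L2_inner f g = (LINT x|lebesgue. f x * g x)"

definition L2_norm :: "('a::euclidean_space \<Rightarrow> real) \<Rightarrow> real" where
  "L2_norm f = sqrt (LINT x|lebesgue. (f x)\<^sup>2)"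

definition L2_tendsto ::
  "('i \<Rightarrow> 'a::euclidean_space \<Rightarrow> real) \<Rightarrow> ('a \<Rightarrow> real) \<Rightarrow> 'i filter \<Rightarrow> bool" where
  "L2_tendsto f g F \<longleftrightarrow>
     (\<forall>\<^sub>F i in F. f i \<in> L2) \<and> g \<in> L2 \<and> ((\<lambda>i. L2_norm (\<lambda>x. f i x - g x)) \<longlongrightarrow> 0) F"

text \<open>The support of an almost-everywhere equivalence class.\<close>

definition ess_support :: "('a::euclidean_space \<Rightarrow> real) \<Rightarrow> 'a set" where
  "ess_support f = {x. \<forall>\<epsilon>>0. \<not> (AE y in lebesgue. y \<in> ball x \<epsilon> \<longrightarrow> f y = 0)}"


section \<open>Weak gradients\<close>

definition has_weak_gradient_on ::
  "('a::euclidean_space \<Rightarrow> real) \<Rightarrow> ('a \<Rightarrow> 'a) \<Rightarrow> 'a set \<Rightarrow> bool" where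
  "has_weak_gradient_on U G D \<longleftrightarrow>
     (\<forall>K. compact K \<and> K \<subseteq> D \<longrightarrow> set_integrable lebesgue K U \<and> set_integrable lebesgue K G) \<and>
     (\<forall>\<phi> :: 'a \<Rightarrow> real. smooth \<phi> \<and> compact (closure {z. \<phi> z \<noteq> 0}) \<and> closure {z. \<phi> z \<noteq> 0} \<subseteq> D \<longrightarrow>
        (\<forall>v. (LINT z:D|lebesgue. U z * frechet_derivative \<phi> (at z) v)
             = - (LINT z:D|lebesgue. (G z \<bullet> v) * \<phi> z)))"

text \<open>
  On an open set the weak gradient is unique up to a null set, so the choice made here is immaterial.
\<close>

definition weak_gradient :: "'a::euclidean_space set \<Rightarrow> ('a \<Rightarrow> real) \<Rightarrow> 'a \<Rightarrow> 'a" where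
  "weak_gradient D U = (SOME G. has_weak_gradient_on U G D)"


section \<open>The weighted Sobolev space on the extended domain\<close>

text \<open>
  A point of the extended space is a pair \<open>(x, y)\<close> with \<open>x\<close> in \<open>\<real>\<^sup>d\<close> and \<open>y\<close> real.  The inner product
  and the norm of the pair type are the Euclidean ones of dimension \<open>d + 1\<close>.
\<close>

definition halfspace :: "('a::euclidean_space \<times> real) set" where
  "halfspace = UNIV \<times> {0<..}"

definition slab :: "real \<Rightarrow> ('a::euclidean_space \<times> real) set" where
  "slab Y = UNIV \<times> {0<..<Y}"

definition rho :: "'a::euclidean_space \<times> real \<Rightarrow> real" where
  "rho z = sqrt (1 + (norm (fst z))\<^sup>2 + (snd z)\<^sup>2)"

definition H1rho_density ::
  "real \<Rightarrow> ('a::euclidean_space \<times> real) set \<Rightarrow> ('a \<times> real \<Rightarrow> real) \<Rightarrow> 'a \<times> real \<Rightarrow> real" where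
  "H1rho_density \<alpha> D U z =
     snd z powr \<alpha> * ((norm (weak_gradient D U z))\<^sup>2 + inverse ((rho z)\<^sup>2) * (U z)\<^sup>2)"

definition H1rho ::
  "real \<Rightarrow> ('a::euclidean_space \<times> real) set \<Rightarrow> ('a \<times> real \<Rightarrow> real) set" where
  "H1rho \<alpha> D =
     {U. (\<exists>G. has_weak_gradient_on U G D) \<and> set_integrable lebesgue D (H1rho_density \<alpha> D U)}"

definition H1rho_norm ::
  "real \<Rightarrow> ('a::euclidean_space \<times> real) set \<Rightarrow> ('a \<times> real \<Rightarrow> real) \<Rightarrow> real" where
  "H1rho_norm \<alpha> D U = sqrt (LINT z:D|lebesgue. H1rho_density \<alpha> D U z)"

definition H1rho_tendsto ::
  "real \<Rightarrow> ('a::euclidean_space \<times> real) set \<Rightarrow>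
   ('i \<Rightarrow> 'a \<times> real \<Rightarrow> real) \<Rightarrow> ('a \<times> real \<Rightarrow> real) \<Rightarrow> 'i filter \<Rightarrow> bool" where
  "H1rho_tendsto \<alpha> D W U F \<longleftrightarrow>
     (\<forall>\<^sub>F i in F. W i \<in> H1rho \<alpha> D) \<and> U \<in> H1rho \<alpha> D \<and>
     ((\<lambda>i. H1rho_norm \<alpha> D (\<lambda>z. W i z - U z)) \<longlongrightarrow> 0) F"

text \<open>
  The trace at \<open>y = 0\<close> is the limit in \<open>L\<^sup>2\<^sub>l\<^sub>o\<^sub>c\<close> of the slices \<open>U(\<cdot>, y)\<close> as \<open>y \<down> 0\<close>.  The limit is an
  essential one, because only almost every slice of an equivalence class is meaningful.  For a
  function continuous up to \<open>y = 0\<close> this gives its restriction.  For \<open>-1 < \<alpha> < 1\<close> every element of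
  the weighted space on a slab or on the half space has a trace, by
  \<open>U(x, y) - U(x, 0) = \<integral>\<^sub>0\<^sup>y \<partial>\<^sub>y U(x, t) dt\<close> and Cauchy-Schwarz; it is unique up to a null set.
\<close>

definition has_trace0 :: "('a::euclidean_space \<times> real \<Rightarrow> real) \<Rightarrow> ('a \<Rightarrow> real) \<Rightarrow> bool" where
  "has_trace0 U g \<longleftrightarrow>
     g \<in> borel_measurable lebesgue \<and>
     (\<forall>R. \<forall>\<epsilon>>0. \<exists>\<delta>>0. AE y in lebesgue. 0 < y \<and> y < \<delta> \<longrightarrow>
        (\<integral>\<^sup>+x\<in>ball 0 R. ennreal ((U (x, y) - g x)\<^sup>2) \<partial>lebesgue) < ennreal \<epsilon>)"

definition tr0 :: "('a::euclidean_space \<times> real \<Rightarrow> real) \<Rightarrow> 'a \<Rightarrow> real" where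
  "tr0 U = (SOME g. has_trace0 U g)"


section \<open>The variational problems\<close>

definition d_const :: "real \<Rightarrow> real" where
  "d_const \<beta> = 2 powr (1 - 2 * \<beta>) * Gamma (1 - \<beta>) / Gamma \<beta>"

text \<open>Application of the block matrix with diagonal blocks \<open>M\<close> and \<open>1\<close>.\<close>

definition block_mult :: "real^'n^'n \<Rightarrow> (real^'n) \<times> real \<Rightarrow> (real^'n) \<times> real" where
  "block_mult M w = (M *v fst w, snd w)"

definition bilinear_form ::
  "real \<Rightarrow> real \<Rightarrow> (real^'n \<Rightarrow> real^'n^'n) \<Rightarrow> ((real^'n) \<times> real) set \<Rightarrow>
   ((real^'n) \<times> real \<Rightarrow> real) \<Rightarrow> ((real^'n) \<times> real \<Rightarrow> real) \<Rightarrow> real" where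
  "bilinear_form \<beta> s \<AA> D U V =
     (LINT z:D|lebesgue. snd z powr (1 - 2 * \<beta>) *
        (block_mult (\<AA> (fst z)) (weak_gradient D U z) \<bullet> weak_gradient D V z))
     + s * d_const \<beta> * (LINT x|lebesgue. tr0 U x * tr0 V x)"

definition trial_space ::
  "real \<Rightarrow> real \<Rightarrow> ((real^'n) \<times> real) set \<Rightarrow> ((real^'n) \<times> real \<Rightarrow> real) set" where
  "trial_space \<beta> s D = {V \<in> H1rho (1 - 2 * \<beta>) D. s > 0 \<longrightarrow> tr0 V \<in> L2}"

definition solves_on ::
  "real \<Rightarrow> real \<Rightarrow> (real^'n \<Rightarrow> real^'n^'n) \<Rightarrow> (real^'n \<Rightarrow> real) \<Rightarrow>
   ((real^'n) \<times> real) set \<Rightarrow> ((real^'n) \<times> real \<Rightarrow> real) \<Rightarrow> bool" where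
  "solves_on \<beta> s \<AA> f D U \<longleftrightarrow>
     U \<in> trial_space \<beta> s D \<and>
     (\<forall>V \<in> trial_space \<beta> s D. bilinear_form \<beta> s \<AA> D U V = d_const \<beta> * L2_inner f (tr0 V))"

end

theory Submission
  imports Defs
begin

text \<open>
  The difference \<open>e\<close> of the truncated and the full solution is an almost admissible test function for both
  problems.  On the slab of height \<open>Y\<close> it is admissible.  For the half space it is multiplied by a cutoff
  function \<open>\<eta>\<close> that is 1 for \<open>\<bar>x\<bar> \<le> R\<close>, \<open>y \<le> R\<close> and vanishes beyond \<open>2 R\<close>, where \<open>R = Y / 3\<close>.
  Once \<open>R\<close> exceeds the size of the support of \<open>f\<close>, both weak formulations have the same right-hand side,
  and their difference reads
  \<open>A\<^sup>Y(e, e) = \<integral> y\<^sup>\<alpha> \<AA>\<nabla>U \<cdot> \<nabla>(\<eta> e - e) + s d \<integral> tr U (\<eta> - 1) tr e\<close>.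
  The right-hand side sees \<open>U\<close> only far away from the origin, where little energy is left, because \<open>U\<close>
  has finite energy.  This is \<open>truncation_energy_estimate\<close>; together with \<open>energy_tail_tendsto_0\<close> it gives
  both limits.

  The term \<open>e \<nabla>\<eta>\<close> is bounded by \<open>\<bar>e\<bar> / \<rho>\<close>, because \<open>\<nabla>\<eta>\<close> has size \<open>1 / R\<close> and lives at distance \<open>R\<close>.
  To absorb it, and to pass from the energy to the full norm, a Hardy inequality for \<open>e / \<rho>\<close> is needed on
  the slab with a constant that does not depend on \<open>Y\<close> (\<open>uniform_Hardy\<close>).  There are two
  sources for it.  If \<open>s > 0\<close>, the form controls the trace, and a one-dimensional weighted Hardy inequality
  on vertical lines controls the rest (\<open>trace_Hardy\<close>).  If \<open>s = 0\<close>, then \<open>d = 3\<close>, and the classical Hardy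
  inequality in \<open>x\<close> applies, with \<open>y\<close> as a parameter (\<open>horizontal_Hardy\<close>).

  Both inequalities, and the existence, uniqueness and linearity of traces, have to be derived for weakly
  differentiable functions.  The common tool is \<open>weak_difference_formula\<close>: for a fixed vector \<open>h v\<close>, the
  difference \<open>U(z + h v) - U(z)\<close> is the integral of the directional derivative for almost every \<open>z\<close>.
  In the vertical direction it yields \<open>U(x, y) = c(x) + \<integral>\<^sub>0\<^sup>y \<partial>\<^sub>y U(x, t) dt\<close>, hence the trace \<open>c\<close>;
  in the horizontal directions it replaces the chain rule for \<open>U\<^sup>2\<close> by a discrete integration by parts.
\<close>

section \<open>Smooth functions\<close>

lemma C_times_SucI:
  assumes "\<And>x. (f has_derivative f' x) (at x)" and "\<And>v. C_times k (\<lambda>x. f' x v)"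
  shows "C_times (Suc k) f"
proof -
  have "frechet_derivative f (at x) = f' x" for x
    using assms(1) frechet_derivative_at by metis
  then show ?thesis
    using assms by (auto simp: differentiable_on_def differentiable_def)
qed

lemma C_times_SucD:
  assumes "C_times (Suc k) f"
  shows "(f has_derivative frechet_derivative f (at x)) (at x)"
    and "C_times k (\<lambda>x. frechet_derivative f (at x) v)"
  using assms by (auto simp: differentiable_on_def frechet_derivative_works[symmetric])

lemma C_times_Suc_imp: "C_times (Suc k) f \<Longrightarrow> C_times k f"
proof (induction k arbitrary: f)
  case 0
  then show ?case
    by (auto simp: differentiable_imp_continuous_on)
next
  case (Suc k)
  then show ?case by (auto simp del: C_times.simps(1))
qed

lemma C_times_const: "C_times k (\<lambda>x. c)"
proof (induction k arbitrary: c)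
  case (Suc k)
  show ?case
    by (rule C_times_SucI[where f' = "\<lambda>x v. 0"]) (auto intro: Suc)
qed auto

lemma C_times_linear: "bounded_linear f \<Longrightarrow> C_times k f"
proof (induction k)
  case 0
  then show ?case by (simp add: linear_continuous_on)
next
  case (Suc k)
  show ?case
    by (rule C_times_SucI[where f' = "\<lambda>x. f"])
      (auto intro: C_times_const bounded_linear_imp_has_derivative Suc)
qed

lemma C_times_add: "C_times k f \<Longrightarrow> C_times k g \<Longrightarrow> C_times k (\<lambda>x. f x + g x)"
proof (induction k arbitrary: f g)
  case 0
  then show ?case by (auto intro: continuous_intros)
next
  case (Suc k)
  note C_times_SucD[OF Suc.prems(1)] C_times_SucD[OF Suc.prems(2)]
  then show ?case
    by (intro C_times_SucI[where f' = "\<lambda>x v. frechet_derivative f (at x) v + frechet_derivative g (at x) v"]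
         has_derivative_add Suc.IH) auto
qed

lemma C_times_mult:
  fixes f g :: "'a::real_normed_vector \<Rightarrow> real"
  shows "C_times k f \<Longrightarrow> C_times k g \<Longrightarrow> C_times k (\<lambda>x. f x * g x)"
proof (induction k arbitrary: f g)
  case 0
  then show ?case by (auto intro: continuous_intros)
next
  case (Suc k)
  note D = C_times_SucD[OF Suc.prems(1)] C_times_SucD[OF Suc.prems(2)]
  show ?case
    by (rule C_times_SucI[where f' = "\<lambda>x v. f x * frechet_derivative g (at x) v + frechet_derivative f (at x) v * g x"])
     (auto intro!: has_derivative_mult D Suc.IH C_times_add Suc.prems[THEN C_times_Suc_imp])
qed

lemma C_times_compose:
  fixes \<sigma> :: "real \<Rightarrow> real" and q :: "'a::real_normed_vector \<Rightarrow> real"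
  shows "C_times k \<sigma> \<Longrightarrow> C_times k q \<Longrightarrow> C_times k (\<lambda>x. \<sigma> (q x))"
proof (induction k arbitrary: \<sigma>)
  case 0
  then show ?case by (auto intro: continuous_on_compose2)
next
  case (Suc k)
  note D = C_times_SucD[OF Suc.prems(1)] C_times_SucD[OF Suc.prems(2)]
  have "((\<lambda>x. \<sigma> (q x)) has_derivative
      (\<lambda>v. frechet_derivative \<sigma> (at (q x)) 1 * frechet_derivative q (at x) v)) (at x)" for x
  proof -
    have "frechet_derivative \<sigma> (at (q x)) w = frechet_derivative \<sigma> (at (q x)) 1 * w" for w
      using linear_cmul[OF has_derivative_linear[OF D(1)[of "q x"]], of w 1] by simp
    then show ?thesis
      by (intro has_derivative_eq_rhs[OF has_derivative_compose[OF D(3)[of x] D(1)[of "q x"]]] ext)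
  qed
  then show ?case
    by (rule C_times_SucI)
      (rule C_times_mult[OF Suc.IH[OF D(2) C_times_Suc_imp[OF Suc.prems(2)]] D(4)])
qed

lemma C_times_inverse:
  fixes q :: "'a::real_normed_vector \<Rightarrow> real"
  shows "C_times k q \<Longrightarrow> (\<And>x. q x \<noteq> 0) \<Longrightarrow> C_times k (\<lambda>x. inverse (q x))"
proof (induction k)
  case 0
  then show ?case by (auto intro: continuous_intros)
next
  case (Suc k)
  note D = C_times_SucD[OF Suc.prems(1)]
  have "((\<lambda>x. inverse (q x)) has_derivative
      (\<lambda>v. (-1) * (inverse (q x) * frechet_derivative q (at x) v * inverse (q x)))) (at x)" for x
    using Deriv.has_derivative_inverse[OF Suc.prems(2) D(1), of x] by simp
  then show ?case
    by (rule C_times_SucI)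
      (intro C_times_mult C_times_const D Suc.IH Suc.prems(2) Suc.prems(1)[THEN C_times_Suc_imp])
qed

lemma smooth_const [intro]: "smooth (\<lambda>x. c)"
  and smooth_linear: "bounded_linear l \<Longrightarrow> smooth l"
  and smooth_add [intro]: "smooth f \<Longrightarrow> smooth g \<Longrightarrow> smooth (\<lambda>x. f x + g x)"
  by (auto simp: smooth_def intro: C_times_const C_times_linear C_times_add)

lemma
  fixes f g :: "'a::real_normed_vector \<Rightarrow> real"
  shows smooth_mult [intro]: "smooth f \<Longrightarrow> smooth g \<Longrightarrow> smooth (\<lambda>x. f x * g x)"
    and smooth_inverse: "smooth f \<Longrightarrow> (\<And>x. f x \<noteq> 0) \<Longrightarrow> smooth (\<lambda>x. inverse (f x))"
    and smooth_compose: "smooth \<sigma> \<Longrightarrow> smooth f \<Longrightarrow> smooth (\<lambda>x. \<sigma> (f x) :: real)"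
  by (auto simp: smooth_def intro: C_times_mult C_times_inverse C_times_compose)

lemma smooth_prod:
  fixes f :: "'i \<Rightarrow> 'a::real_normed_vector \<Rightarrow> real"
  assumes "\<And>i. i \<in> I \<Longrightarrow> smooth (f i)"
  shows "smooth (\<lambda>x. \<Prod>i\<in>I. f i x)"
  using assms
proof (induction I rule: infinite_finite_induct)
  case (insert i I)
  have "smooth (\<lambda>x. f i x * (\<Prod>i\<in>I. f i x))"
    using insert by (intro smooth_mult) auto
  then show ?case using insert by simp
qed (auto)

lemma smooth_sum:
  fixes f :: "'i \<Rightarrow> 'a::real_normed_vector \<Rightarrow> real"
  assumes "\<And>i. i \<in> I \<Longrightarrow> smooth (f i)"
  shows "smooth (\<lambda>x. \<Sum>i\<in>I. f i x)"
  using assms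
proof (induction I rule: infinite_finite_induct)
  case (insert i I)
  have "smooth (\<lambda>x. f i x + (\<Sum>i\<in>I. f i x))"
    using insert by (intro smooth_add) auto
  then show ?case using insert by simp
qed (auto)

lemma smooth_diff:
  fixes f g :: "'a::real_normed_vector \<Rightarrow> real"
  assumes "smooth f" "smooth g"
  shows "smooth (\<lambda>x. f x - g x)"
  using smooth_add[OF assms(1) smooth_mult[OF smooth_const[of "-1"] assms(2)]] by simp

lemma smooth_inner: "smooth (\<lambda>x::'a::real_inner. x \<bullet> a)"
  by (intro smooth_linear bounded_linear_inner_left)

lemma smooth_norm_square: "smooth (\<lambda>x::'a::euclidean_space. (norm x)\<^sup>2)"
proof -
  have "(\<lambda>x::'a. (norm x)\<^sup>2) = (\<lambda>x. \<Sum>b\<in>Basis. (x \<bullet> b) * (x \<bullet> b))"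
    by (simp add: fun_eq_iff power2_norm_eq_inner euclidean_inner[of "x" "x" for x])
  then show ?thesis
    by (auto intro!: smooth_sum smooth_mult smooth_inner)
qed

lemma smooth_compose_linear:
  assumes "smooth f" "bounded_linear l"
  shows "smooth (\<lambda>x. f (l x))"
proof -
  have "C_times k f \<Longrightarrow> C_times k (\<lambda>x. f (l x))" for k
  proof (induction k arbitrary: f)
    case 0
    then show ?case
      using assms(2) by (auto intro: continuous_on_compose2 linear_continuous_on)
  next
    case (Suc k)
    note D = C_times_SucD[OF Suc.prems]
    show ?case
      by (rule C_times_SucI[where f' = "\<lambda>x v. frechet_derivative f (at (l x)) (l v)"])
       (auto intro!: Suc.IH[OF D(2)] D(2) has_derivative_compose[OF bounded_linear_imp_has_derivative[OF assms(2)] D(1)])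
  qed
  then show ?thesis using assms by (auto simp: smooth_def)
qed

lemma smooth_has_derivative:
  "smooth f \<Longrightarrow> (f has_derivative frechet_derivative f (at x)) (at x)"
  by (rule C_times_SucD(1)[where k=0]) (simp only: smooth_def)

lemma smooth_frechet: "smooth f \<Longrightarrow> smooth (\<lambda>x. frechet_derivative f (at x) v)"
  using C_times_SucD(2) by (metis smooth_def)

lemma smooth_continuous: "smooth f \<Longrightarrow> continuous_on A f"
proof -
  assume "smooth f" then have "C_times 0 f" unfolding smooth_def by blast
  then show ?thesis using continuous_on_subset by auto
qed

lemma smooth_borel:
  "smooth f \<Longrightarrow> f \<in> borel_measurable borel"
  by (intro borel_measurable_continuous_onI smooth_continuous)

text \<open>
  The family of functions \<open>p (1 / t) exp (- 1 / t)\<close> with a polynomial \<open>p\<close> is closed under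
  differentiation, and each member extends continuously by zero; this makes the induction for the
  smoothness of \<open>exp (- 1 / t)\<close> go through.
\<close>

definition flat :: "real poly \<Rightarrow> real \<Rightarrow> real" where
  "flat p t = (if 0 < t then poly p (1 / t) * exp (- 1 / t) else 0)"

lemma flat_tendsto_0: "((\<lambda>t. poly p (1 / t) * exp (- 1 / t)) \<longlongrightarrow> (0::real)) (at_right 0)"
proof -
  have "((\<lambda>u. poly p u * exp (- u)) \<longlongrightarrow> (0::real)) at_top"
  proof -
    have eq: "poly p u * exp (- u) = (\<Sum>i\<le>degree p. coeff p i * (u ^ i / exp u))" for u
      by (simp add: poly_altdef sum_distrib_right exp_minus divide_inverse mult.assoc)
    have "((\<lambda>u. \<Sum>i\<le>degree p. coeff p i * (u ^ i / exp u)) \<longlongrightarrow> (\<Sum>i\<le>degree p. coeff p i * 0)) at_top"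
      by (intro tendsto_sum tendsto_mult tendsto_const tendsto_power_div_exp_0)
    then show ?thesis by (simp add: eq)
  qed
  then have "((\<lambda>u. poly p u * exp (- u)) \<longlongrightarrow> (0::real)) (filtermap inverse (at_right 0))"
    by (simp add: at_top_to_right)
  then show ?thesis
    by (simp add: filterlim_filtermap divide_inverse)
qed

lemma flat_has_derivative:
  "(flat p has_real_derivative flat ([:0,0,1:] * (p - pderiv p)) t) (at t)"
proof -
  consider "t > 0" | "t < 0" | "t = 0" by linarith
  then show ?thesis
  proof cases
    case 1
    have D: "((\<lambda>t. poly p (1 / t) * exp (- 1 / t)) has_real_derivative flat ([:0,0,1:] * (p - pderiv p)) t) (at t)"
      using 1 unfolding flat_def
      by (auto intro!: derivative_eq_intros simp: field_simps power2_eq_square)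
    have ev: "\<forall>\<^sub>F s in nhds t. flat p s = poly p (1 / s) * exp (- 1 / s)"
      using eventually_nhds_in_open[of "{0<..}" t] 1 by (auto elim!: eventually_mono simp: flat_def)
    show ?thesis using D by (subst DERIV_cong_ev[OF refl ev refl])
  next
    case 2
    have ev: "\<forall>\<^sub>F s in nhds t. flat p s = 0"
      using eventually_nhds_in_open[of "{..<0}" t] 2 by (auto elim!: eventually_mono simp: flat_def)
    have "((\<lambda>_. 0) has_real_derivative flat ([:0,0,1:] * (p - pderiv p)) t) (at t)"
      using 2 by (simp add: flat_def)
    then show ?thesis by (subst DERIV_cong_ev[OF refl ev refl])
  next
    case 3
    have R: "((\<lambda>s. flat p s / s) \<longlongrightarrow> 0) (at_right 0)"
    proof (rule Lim_transform_eventually[OF flat_tendsto_0[of "[:0,1:] * p"]])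
      show "\<forall>\<^sub>F s in at_right 0. poly ([:0, 1:] * p) (1 / s) * exp (- 1 / s) = flat p s / s"
        by (auto simp: eventually_at_filter flat_def)
    qed
    have L: "((\<lambda>s. flat p s / s) \<longlongrightarrow> 0) (at_left 0)"
      by (rule Lim_transform_eventually[OF tendsto_const]) (auto simp: eventually_at_filter flat_def)
    have "((\<lambda>s. flat p s / s) \<longlongrightarrow> 0) (at 0)"
      using R L by (simp add: filterlim_split_at)
    then show ?thesis
      using 3 by (simp add: has_field_derivative_iff flat_def)
  qed
qed

lemma smooth_flat: "smooth (flat p)"
proof -
  have "C_times k (flat p)" for k
  proof (induction k arbitrary: p)
    case 0
    have "isCont (flat p) t" for t
      using flat_has_derivative DERIV_isCont by blast
    then show ?case by (simp add: continuous_on_eq_continuous_at)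
  next
    case (Suc k)
    show ?case
      by (rule C_times_SucI[where f' = "\<lambda>t v. flat ([:0,0,1:] * (p - pderiv p)) t * v"])
       (use flat_has_derivative in \<open>auto simp: has_field_derivative_def intro!: C_times_mult Suc C_times_const simp del: mult_pCons_left\<close>)
  qed
  then show ?thesis by (auto simp: smooth_def)
qed

abbreviation bump :: "real \<Rightarrow> real" where "bump \<equiv> flat 1"

lemma bump_pos: "0 < t \<Longrightarrow> 0 < bump t" and bump_zero: "t \<le> 0 \<Longrightarrow> bump t = 0"
  and bump_nonneg: "0 \<le> bump t" and bump_le_1: "bump t \<le> 1"
  by (auto simp: flat_def)

text \<open>
  Scaling the argument sharpens the bump into a step function; products of such bumps approximate
  indicator functions of boxes.
\<close>

lemma bump_scaled_tendsto_1: "0 < t \<Longrightarrow> (\<lambda>n. bump (real (Suc n) * t)) \<longlonglongrightarrow> 1"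
proof -
  assume t: "0 < t"
  have "(\<lambda>n. exp (- (inverse (real (Suc n)) * (1 / t)))) \<longlonglongrightarrow> exp (- (0 * (1 / t)))"
    by (intro tendsto_intros LIMSEQ_inverse_real_of_nat)
  moreover have "bump (real (Suc n) * t) = exp (- (inverse (real (Suc n)) * (1 / t)))" for n
  proof -
    have "0 < real (Suc n) * t" using t by simp
    then show ?thesis by (simp add: flat_def inverse_eq_divide)
  qed
  ultimately show ?thesis by simp
qed

definition test_function :: "'a::euclidean_space set \<Rightarrow> ('a \<Rightarrow> real) \<Rightarrow> bool" where
  "test_function D \<phi> \<longleftrightarrow> smooth \<phi> \<and> compact (closure {z. \<phi> z \<noteq> 0}) \<and> closure {z. \<phi> z \<noteq> 0} \<subseteq> D"

lemma test_functionI: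
  assumes "smooth \<phi>" "compact K" "K \<subseteq> D" "\<And>z. z \<notin> K \<Longrightarrow> \<phi> z = 0"
  shows "test_function D \<phi>"
proof -
  have "closure {z. \<phi> z \<noteq> 0} \<subseteq> K"
    using assms by (intro closure_minimal compact_imp_closed) auto
  then show ?thesis
    using assms closed_Int_compact[OF closed_closure[of "{z. \<phi> z \<noteq> 0}"] assms(2)]
    by (auto simp: test_function_def Int_absorb2)
qed

lemma test_functionE:
  assumes "test_function D \<phi>"
  obtains K where "smooth \<phi>" "compact K" "K \<subseteq> D" "\<And>z. z \<notin> K \<Longrightarrow> \<phi> z = 0"
    "\<And>z v. z \<notin> K \<Longrightarrow> frechet_derivative \<phi> (at z) v = 0"
proof -
  define K where "K = closure {z. \<phi> z \<noteq> 0}"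
  have "closed K" by (simp add: K_def)
  have 0: "\<phi> z = 0" if "z \<notin> K" for z
    using that closure_subset[of "{z. \<phi> z \<noteq> 0}"] unfolding K_def by auto
  moreover have "frechet_derivative \<phi> (at z) v = 0" if "z \<notin> K" for z v
  proof -
    have "(\<phi> has_derivative (\<lambda>_. 0)) (at z)"
      by (rule has_derivative_transform_within_open[of "\<lambda>_. 0" _ _ _ "- K"])
        (use that 0 \<open>closed K\<close> in \<open>auto\<close>)
    then show ?thesis using frechet_derivative_at by metis
  qed
  ultimately show ?thesis using that[of K] assms unfolding test_function_def K_def by blast
qed

lemma test_function_bounds:
  assumes "test_function D \<phi>"
  shows "\<exists>C. 0 \<le> C \<and> (\<forall>z. \<bar>\<phi> z\<bar> \<le> C) \<and> (\<forall>z v. \<bar>frechet_derivative \<phi> (at z) v\<bar> \<le> C * norm v) \<and>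
    (\<forall>z w. \<bar>\<phi> w - \<phi> z\<bar> \<le> C * norm (w - z))"
proof -
  obtain K where K: "smooth \<phi>" "compact K" "K \<subseteq> D" "\<And>z. z \<notin> K \<Longrightarrow> \<phi> z = 0"
    "\<And>z v. z \<notin> K \<Longrightarrow> frechet_derivative \<phi> (at z) v = 0"
    using test_functionE[OF assms] by metis
  have bd: "\<exists>C\<ge>0. \<forall>z. \<bar>\<psi> z\<bar> \<le> C" if "smooth \<psi>" "\<And>z. z \<notin> K \<Longrightarrow> \<psi> z = 0" for \<psi> :: "'a \<Rightarrow> real"
  proof -
    have "bounded (\<psi> ` K)"
      using K that by (intro compact_imp_bounded compact_continuous_image smooth_continuous)
    then obtain C where C: "0 < C" "\<forall>y\<in>\<psi> ` K. norm y \<le> C" using bounded_pos by blast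
    then have "\<bar>\<psi> z\<bar> \<le> C" for z using that(2)[of z] by (cases "z \<in> K") auto
    then show ?thesis using C by (intro exI[of _ C]) auto
  qed
  obtain C0 where C0: "C0 \<ge> 0" "\<And>z. \<bar>\<phi> z\<bar> \<le> C0" using bd[OF K(1,4)] by auto
  have "\<exists>C\<ge>0. \<forall>z. \<bar>frechet_derivative \<phi> (at z) b\<bar> \<le> C" for b
    using bd[OF smooth_frechet[OF K(1)] K(5)] by blast
  then obtain B where B: "\<And>b. B b \<ge> 0" "\<And>b z. \<bar>frechet_derivative \<phi> (at z) b\<bar> \<le> B b" by metis
  \<comment> \<open>The derivative is linear, so bounds in the basis directions suffice.\<close>
  define C where "C = C0 + (\<Sum>b\<in>Basis. B b)"
  have SB: "0 \<le> (\<Sum>b\<in>Basis. B b)" by (intro sum_nonneg B)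
  have lin: "linear (frechet_derivative \<phi> (at z))" for z
    by (rule has_derivative_linear[OF smooth_has_derivative[OF K(1)]])
  have D: "\<bar>frechet_derivative \<phi> (at z) v\<bar> \<le> C * norm v" for z v
  proof -
    have "frechet_derivative \<phi> (at z) v = frechet_derivative \<phi> (at z) (\<Sum>b\<in>Basis. (v \<bullet> b) *\<^sub>R b)"
      by (simp add: euclidean_representation)
    also have "\<dots> = (\<Sum>b\<in>Basis. (v \<bullet> b) * frechet_derivative \<phi> (at z) b)"
      by (simp add: linear_sum[OF lin] linear_cmul[OF lin])
    also have "\<bar>\<dots>\<bar> \<le> (\<Sum>b\<in>Basis. norm v * B b)"
      by (intro order_trans[OF sum_abs] sum_mono) (auto simp: abs_mult intro!: mult_mono B Basis_le_norm)
    also have "\<dots> \<le> C * norm v"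
      using C0(1) by (simp add: C_def sum_distrib_left algebra_simps)
    finally show ?thesis .
  qed
  have L: "\<bar>\<phi> w - \<phi> z\<bar> \<le> C * norm (w - z)" for z w
  proof -
    have "norm (\<phi> w - \<phi> z) \<le> C * norm (w - z)"
    proof (rule differentiable_bound[of UNIV])
      show "(\<phi> has_derivative frechet_derivative \<phi> (at x)) (at x within UNIV)" for x
        using smooth_has_derivative[OF K(1)] by simp
      show "onorm (frechet_derivative \<phi> (at x)) \<le> C" for x
        using D by (intro onorm_le) auto
    qed auto
    then show ?thesis by simp
  qed
  show ?thesis
  proof (intro exI[of _ C] conjI allI)
    show "\<bar>\<phi> z\<bar> \<le> C" for z using C0(2)[of z] SB by (simp add: C_def)
    show "0 \<le> C" using C0(1) SB by (simp add: C_def)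
  qed (fact D L)+
qed

lemma test_function_box:
  fixes a b :: "'a::euclidean_space"
  assumes "cbox a b \<subseteq> D"
  shows "test_function D (\<lambda>z. \<Prod>i\<in>Basis. bump (real (Suc n) * (z \<bullet> i - a \<bullet> i)) * bump (real (Suc n) * (b \<bullet> i - z \<bullet> i)))"
proof (rule test_functionI[of _ "cbox a b"])
  show "smooth (\<lambda>z. \<Prod>i\<in>Basis. bump (real (Suc n) * (z \<bullet> i - a \<bullet> i)) * bump (real (Suc n) * (b \<bullet> i - z \<bullet> i)))"
    by (intro smooth_prod smooth_mult smooth_compose[OF smooth_flat] smooth_diff smooth_const smooth_inner)
  fix z assume "z \<notin> cbox a b"
  then obtain i where "i \<in> Basis" "z \<bullet> i < a \<bullet> i \<or> b \<bullet> i < z \<bullet> i" by (force simp: mem_box)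
  then show "(\<Prod>i\<in>Basis. bump (real (Suc n) * (z \<bullet> i - a \<bullet> i)) * bump (real (Suc n) * (b \<bullet> i - z \<bullet> i))) = 0"
    by (intro prod_zero bexI[of _ i]) (auto intro!: bump_zero simp: mult_nonneg_nonpos)
qed (use assms in auto)

lemma box_bump_bounds:
  fixes a b z :: "'a::euclidean_space"
  defines "\<phi> \<equiv> \<lambda>n z. \<Prod>i\<in>Basis. bump (real (Suc n) * (z \<bullet> i - a \<bullet> i)) * bump (real (Suc n) * (b \<bullet> i - z \<bullet> i))"
  shows "0 \<le> \<phi> n z" "\<phi> n z \<le> indicator (box a b) z" "(\<lambda>n. \<phi> n z) \<longlonglongrightarrow> indicator (box a b) z"
proof -
  have zero: "\<phi> n z = 0" if "z \<notin> box a b" for n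
  proof -
    obtain i where "i \<in> Basis" "z \<bullet> i \<le> a \<bullet> i \<or> b \<bullet> i \<le> z \<bullet> i" using \<open>z \<notin> box a b\<close> by (force simp: mem_box)
    then show ?thesis
      unfolding \<phi>_def by (intro prod_zero bexI[of _ i]) (auto intro!: bump_zero simp: mult_nonneg_nonpos)
  qed
  show "0 \<le> \<phi> n z" unfolding \<phi>_def by (intro prod_nonneg ballI mult_nonneg_nonneg bump_nonneg)
  have "\<phi> n z \<le> 1"
    unfolding \<phi>_def by (intro prod_le_1) (auto intro!: bump_nonneg bump_le_1 mult_le_one mult_nonneg_nonneg)
  then show "\<phi> n z \<le> indicator (box a b) z"
    using zero by (cases "z \<in> box a b") auto
  show "(\<lambda>n. \<phi> n z) \<longlonglongrightarrow> indicator (box a b) z"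
  proof (cases "z \<in> box a b")
    case True
    have "(\<lambda>n. \<phi> n z) \<longlonglongrightarrow> (\<Prod>i\<in>(Basis::'a set). 1 * 1)"
      unfolding \<phi>_def using True
      by (intro tendsto_prod tendsto_mult bump_scaled_tendsto_1) (auto simp: mem_box)
    then show ?thesis using True by simp
  qed (simp add: zero)
qed

text \<open>
  The quotient of two one-sided bumps is a smooth step from 1 to 0.  It is applied to \<open>(\<bar>x\<bar> / R)\<^sup>2\<close>, so that the
  thresholds 1 and 4 become the radii \<open>R\<close> and \<open>2 R\<close>.
\<close>

definition cutoff :: "real \<Rightarrow> real" where
  "cutoff t = bump (4 - t) * inverse (bump (4 - t) + bump (t - 1))"

lemma cutoff_denom: "0 < bump (4 - t) + bump (t - 1)"
  using bump_pos[of "4 - t"] bump_pos[of "t - 1"] bump_nonneg[of "4 - t"] bump_nonneg[of "t - 1"]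
  by (cases "t < 4") (auto simp: add_pos_nonneg add_nonneg_pos)

lemma smooth_cutoff: "smooth cutoff"
  unfolding cutoff_def using cutoff_denom less_irrefl
  by (intro smooth_mult smooth_inverse smooth_add smooth_compose[OF smooth_flat] smooth_diff smooth_const)
    (auto simp: smooth_linear[OF bounded_linear_ident] intro!: less_imp_neq[symmetric])

lemma cutoff_eq_1: "t \<le> 1 \<Longrightarrow> cutoff t = 1" and cutoff_eq_0: "4 \<le> t \<Longrightarrow> cutoff t = 0"
  and cutoff_nonneg: "0 \<le> cutoff t" and cutoff_le_1: "cutoff t \<le> 1"
  using cutoff_denom[of t] bump_nonneg[of "4-t"] bump_nonneg[of "t-1"] bump_pos[of "4-t"]
  by (auto simp: cutoff_def bump_zero divide_inverse[symmetric])

text \<open>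
  The step itself has unbounded support; multiplied by a reflected copy it becomes a test function with
  the same derivative on the relevant half line.
\<close>

lemma cutoff_derivative_bound:
  obtains C where "0 \<le> C" "\<And>t v. \<bar>frechet_derivative cutoff (at t) v\<bar> \<le> C * \<bar>v\<bar>"
    "\<And>t v. t < 1 \<Longrightarrow> frechet_derivative cutoff (at t) v = 0"
proof -
  let ?\<phi> = "\<lambda>t. cutoff t * cutoff (1 - t)"
  have sm: "smooth ?\<phi>"
    by (intro smooth_mult smooth_cutoff smooth_compose[OF smooth_cutoff] smooth_diff smooth_const smooth_linear bounded_linear_ident)
  have "test_function UNIV ?\<phi>"
  proof (rule test_functionI[of _ "{-3..4}"])
  qed (use sm in \<open>auto simp: cutoff_eq_0 not_le\<close>)
  then obtain C where C: "0 \<le> C" "\<And>z v. \<bar>frechet_derivative ?\<phi> (at z) v\<bar> \<le> C * norm v"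
    by (auto dest: test_function_bounds)
  have flat: "frechet_derivative cutoff (at t) v = 0" if "t < 1" for t v
  proof -
    have "(cutoff has_derivative (\<lambda>_. 0)) (at t)"
      by (rule has_derivative_transform_within_open[of "\<lambda>_. 1" _ _ _ "{..<1}"]) (use that in \<open>auto simp: cutoff_eq_1\<close>)
    then show ?thesis using frechet_derivative_at by metis
  qed
  have "\<bar>frechet_derivative cutoff (at t) v\<bar> \<le> C * \<bar>v\<bar>" for t v
  proof (cases "t < 1")
    case True
    then show ?thesis using flat C(1) by simp
  next
    case False
    have "(cutoff has_derivative frechet_derivative ?\<phi> (at t)) (at t)"
      by (rule has_derivative_transform_within_open[of ?\<phi> _ _ _ "{1/2<..}"])
        (use False smooth_has_derivative[OF sm] in \<open>auto simp: cutoff_eq_1\<close>)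
    then show ?thesis using C(2) frechet_derivative_at by (metis real_norm_def)
  qed
  then show ?thesis using that C(1) flat by blast
qed

section \<open>The fundamental lemma of the calculus of variations\<close>

text \<open>
  The positive and the negative part are densities of two measures that agree on boxes, which are an
  intersection-stable generator of the Borel sets; hence the two densities agree.
\<close>

lemma AE_zero_if_box_integrals_zero:
  fixes k :: "'a::euclidean_space \<Rightarrow> real"
  assumes k: "integrable lborel k" and zero: "\<And>a b. (LINT z:box a b|lborel. k z) = 0"
  shows "AE z in lborel. k z = 0"
proof -
  have [measurable]: "k \<in> borel_measurable borel" using k by auto
  let ?p = "\<lambda>z. max 0 (k z)" and ?n = "\<lambda>z. max 0 (- k z)"
  let ?M = "density lborel (\<lambda>z. ennreal (?p z))" and ?N = "density lborel (\<lambda>z. ennreal (?n z))"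
  have ip: "integrable lborel ?p" and iN: "integrable lborel ?n"
    using k by (auto intro!: integrable_max)
  have e: "emeasure (density lborel (\<lambda>z. ennreal (f z))) (box a b) = ennreal (LINT z:box a b|lborel. f z)"
    if "integrable lborel f" "\<And>z. 0 \<le> f z" for f :: "'a \<Rightarrow> real" and a b
  proof -
    have [measurable]: "f \<in> borel_measurable borel" using that by auto
    have "emeasure (density lborel (\<lambda>z. ennreal (f z))) (box a b)
        = (\<integral>\<^sup>+z. ennreal (indicator (box a b) z *\<^sub>R f z) \<partial>lborel)"
      by (auto simp: emeasure_density intro!: nn_integral_cong split: split_indicator)
    also have "\<dots> = ennreal (LINT z:box a b|lborel. f z)"
      unfolding set_lebesgue_integral_def using that
      by (intro nn_integral_eq_integral integrable_mult_indicator) auto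
    finally show ?thesis .
  qed
  have "?M = ?N"
  proof (rule measure_eqI_generator_eq)
    let ?E = "range (\<lambda>(a, b). box a b::'a set)"
    show "Int_stable ?E" by (auto simp: Int_stable_def box_Int_box)
    show "?E \<subseteq> Pow UNIV" "sets ?M = sigma_sets UNIV ?E" "sets ?N = sigma_sets UNIV ?E"
      by (simp_all add: borel_eq_box)
    let ?A = "\<lambda>n::nat. box (- (real n *\<^sub>R One)) (real n *\<^sub>R One) :: 'a set"
    show "range ?A \<subseteq> ?E" "(\<Union>i. ?A i) = UNIV" unfolding UN_box_eq_UNIV by auto
    show "emeasure ?M (?A i) \<noteq> \<infinity>" for i by (subst e[OF ip]) auto
    show "emeasure ?M X = emeasure ?N X" if "X \<in> ?E" for X
    proof -
      obtain a b where X: "X = box a b" using \<open>X \<in> ?E\<close> by auto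
      have "(LINT z:box a b|lborel. ?p z) - (LINT z:box a b|lborel. ?n z)
          = (LINT z:box a b|lborel. ?p z - ?n z)"
        using ip iN by (intro set_integral_diff(2)[symmetric])
          (auto simp: set_integrable_def intro!: integrable_mult_indicator simp del: real_scaleR_def)
      also have "\<dots> = (LINT z:box a b|lborel. k z)"
        by (rule arg_cong[where f="\<lambda>f. set_lebesgue_integral lborel (box a b) f"]) (auto simp: fun_eq_iff)
      finally show ?thesis
        unfolding X using zero[of a b] by (simp add: e[OF ip] e[OF iN])
    qed
  qed
  then have "AE z in lborel. ennreal (?p z) = ennreal (?n z)"
    by (intro sigma_finite_measure.density_unique[OF sigma_finite_lborel]) auto
  then show ?thesis
    by eventually_elim (auto simp: max_def split: if_splits)
qed

definition locally_integrable :: "'a::euclidean_space set \<Rightarrow> ('a \<Rightarrow> 'b::euclidean_space) \<Rightarrow> bool" where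
  "locally_integrable D f \<longleftrightarrow> (\<forall>K. compact K \<and> K \<subseteq> D \<longrightarrow> set_integrable lebesgue K f)"

lemma locally_integrable_subset: "locally_integrable D f \<Longrightarrow> D' \<subseteq> D \<Longrightarrow> locally_integrable D' f"
  by (auto simp: locally_integrable_def)

lemma locally_integrable_inner:
  "locally_integrable D f \<Longrightarrow> locally_integrable D (\<lambda>z. f z \<bullet> v)"
proof -
  assume *: "locally_integrable D f"
  have "integrable lebesgue (\<lambda>z. (indicator K z *\<^sub>R f z) \<bullet> v)" if "compact K" "K \<subseteq> D" for K
    using * that by (intro integrable_inner_left) (auto simp: locally_integrable_def set_integrable_def)
  then show ?thesis by (simp add: locally_integrable_def set_integrable_def)
qed

lemma locally_integrable_diff:
  "locally_integrable D f \<Longrightarrow> locally_integrable D g \<Longrightarrow> locally_integrable D (\<lambda>z. f z - g z)"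
  by (auto simp: locally_integrable_def intro: set_integral_diff)

lemma borel_imp_lebesgue:
  fixes f :: "'a::euclidean_space \<Rightarrow> 'b::topological_space"
  shows "f \<in> borel_measurable borel \<Longrightarrow> f \<in> borel_measurable lebesgue"
  by (rule measurable_completion) simp

lemma integrable_mult_compact_support:
  fixes f :: "'a::euclidean_space \<Rightarrow> 'b::euclidean_space" and \<psi> :: "'a \<Rightarrow> real"
  assumes f: "locally_integrable D f" and \<psi>: "continuous_on UNIV \<psi>"
    and K: "compact K" "K \<subseteq> D" "\<And>z. z \<notin> K \<Longrightarrow> \<psi> z = 0"
  shows "integrable lebesgue (\<lambda>z. \<psi> z *\<^sub>R f z)"
proof -
  have "bounded (\<psi> ` K)"
    using K \<psi> continuous_on_subset[of UNIV \<psi> K] by (intro compact_imp_bounded compact_continuous_image) auto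
  then obtain C where C: "\<And>z. z \<in> K \<Longrightarrow> \<bar>\<psi> z\<bar> \<le> C" by (auto simp: bounded_iff)
  have I: "integrable lebesgue (\<lambda>z. indicator K z *\<^sub>R f z)"
    using f K by (auto simp: locally_integrable_def set_integrable_def)
  have eq: "\<psi> z *\<^sub>R f z = \<psi> z *\<^sub>R (indicator K z *\<^sub>R f z)" for z
    using K(3)[of z] by (auto split: split_indicator)
  have [measurable]: "\<psi> \<in> borel_measurable lebesgue"
    by (intro borel_imp_lebesgue borel_measurable_continuous_onI \<psi>)
  have [measurable]: "(\<lambda>z. indicator K z *\<^sub>R f z) \<in> borel_measurable lebesgue" using I by auto
  show ?thesis
  proof (rule Bochner_Integration.integrable_bound)
    show "integrable lebesgue (\<lambda>z. C *\<^sub>R (indicator K z *\<^sub>R f z))"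
      using I by (intro integrable_scaleR_right)
    show "(\<lambda>z. \<psi> z *\<^sub>R f z) \<in> borel_measurable lebesgue" unfolding eq by measurable
    show "AE z in lebesgue. norm (\<psi> z *\<^sub>R f z) \<le> norm (C *\<^sub>R (indicator K z *\<^sub>R f z))"
      using C by (intro AE_I2) (auto split: split_indicator intro!: mult_right_mono intro: order_trans[OF _ abs_ge_self] simp: K)
  qed
qed

lemma integrable_mult_test_function:
  fixes f :: "'a::euclidean_space \<Rightarrow> real"
  assumes f: "locally_integrable D f" and "test_function D \<phi>"
  shows "integrable lebesgue (\<lambda>z. f z * \<phi> z)"
    and "integrable lebesgue (\<lambda>z. f z * frechet_derivative \<phi> (at z) v)"
proof -
  obtain K where K: "smooth \<phi>" "compact K" "K \<subseteq> D" "\<And>z. z \<notin> K \<Longrightarrow> \<phi> z = 0"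
    "\<And>z v. z \<notin> K \<Longrightarrow> frechet_derivative \<phi> (at z) v = 0"
    using assms(2) by (elim test_functionE) blast
  show "integrable lebesgue (\<lambda>z. f z * \<phi> z)"
    using integrable_mult_compact_support[OF f smooth_continuous[OF K(1)] K(2,3,4)] by (simp add: mult.commute)
  show "integrable lebesgue (\<lambda>z. f z * frechet_derivative \<phi> (at z) v)"
    using integrable_mult_compact_support[OF f smooth_continuous[OF smooth_frechet[OF K(1)]] K(2,3,5)]
    by (simp add: mult.commute)
qed

lemma locally_integrable_measurable:
  fixes f :: "'a::euclidean_space \<Rightarrow> 'b::euclidean_space"
  assumes "open D" "locally_integrable D f"
  shows "(\<lambda>z. indicator D z *\<^sub>R f z) \<in> borel_measurable lebesgue"
proof -
  obtain C :: "nat \<Rightarrow> 'a set" where C: "\<And>n. compact (C n)" "\<And>n. C n \<subseteq> D"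
    "\<And>n. C n \<subseteq> interior (C (Suc n))" "\<Union> (range C) = D" "\<And>K. \<lbrakk>compact K; K \<subseteq> D\<rbrakk> \<Longrightarrow> \<exists>N. \<forall>n\<ge>N. K \<subseteq> C n"
    using open_Union_compact_subsets[OF assms(1)] by metis
  show ?thesis
  proof (rule borel_measurable_LIMSEQ_metric)
    show "(\<lambda>z. indicator (C n) z *\<^sub>R f z) \<in> borel_measurable lebesgue" for n
      using assms(2) C(1,2) unfolding locally_integrable_def set_integrable_def
      by (intro borel_measurable_integrable) blast
    fix z
    show "(\<lambda>n. indicator (C n) z *\<^sub>R f z) \<longlonglongrightarrow> indicator D z *\<^sub>R f z"
    proof (cases "z \<in> D")
      case True
      then obtain N where "\<forall>n\<ge>N. z \<in> C n" using C(5)[of "{z}"] by auto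
      then show ?thesis using True
        by (intro tendsto_eventually eventually_sequentiallyI[of N]) auto
    next
      case False
      then show ?thesis using C(2) by (intro tendsto_eventually always_eventually) (auto split: split_indicator)
    qed
  qed
qed

lemma integrable_lebesgue_borelE:
  fixes f :: "'a::euclidean_space \<Rightarrow> real"
  assumes "f \<in> borel_measurable lebesgue"
  obtains g where "g \<in> borel_measurable borel" "AE z in lborel. f z = g z"
  using completion_ex_borel_measurable_real[OF assms] by auto

text \<open>
  Smooth bumps increase to the indicator of a box, so a function that annihilates all test functions
  has vanishing integral over each box.
\<close>

lemma fundamental_lemma:
  fixes h :: "'a::euclidean_space \<Rightarrow> real"
  assumes "open D" and h: "locally_integrable D h"
    and zero: "\<And>\<phi>. test_function D \<phi> \<Longrightarrow> (LINT z|lebesgue. h z * \<phi> z) = 0"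
  shows "AE z in lebesgue. z \<in> D \<longrightarrow> h z = 0"
proof -
  have box: "AE z in lebesgue. z \<in> box a b \<longrightarrow> h z = 0" if ab: "cbox a b \<subseteq> D" for a b
  proof -
    have I: "integrable lebesgue (\<lambda>z. indicator (cbox a b) z * h z)"
      using h ab by (auto simp: locally_integrable_def set_integrable_def)
    have J: "integrable lebesgue (\<lambda>z. indicator (box a b) z * h z)"
      using integrable_mult_indicator[OF _ I, of "box a b"] box_subset_cbox[of a b]
      by (auto elim!: Bochner_Integration.integrable_cong[THEN iffD1, rotated -1] split: split_indicator)
    have box0: "(LINT z|lebesgue. indicator (box c d) z * h z) = 0" if cd: "cbox c d \<subseteq> cbox a b" for c d
    proof -
      define \<phi> where "\<phi> = (\<lambda>n (z::'a). \<Prod>i\<in>Basis. bump (real (Suc n) * (z \<bullet> i - c \<bullet> i)) * bump (real (Suc n) * (d \<bullet> i - z \<bullet> i)))"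
      have t: "test_function D (\<phi> n)" for n
        unfolding \<phi>_def using cd ab by (intro test_function_box) auto
      have b: "0 \<le> \<phi> n z" "\<phi> n z \<le> indicator (box c d) z" "(\<lambda>n. \<phi> n z) \<longlonglongrightarrow> indicator (box c d) z" for n z
        unfolding \<phi>_def by (rule box_bump_bounds)+
      have "(\<lambda>n. LINT z|lebesgue. h z * \<phi> n z) \<longlonglongrightarrow> (LINT z|lebesgue. indicator (box c d) z * h z)"
      proof (rule integral_dominated_convergence)
        show "integrable lebesgue (\<lambda>z. norm (indicator (cbox a b) z * h z))" using I by auto
        show "(\<lambda>z. h z * \<phi> n z) \<in> borel_measurable lebesgue" for n
          using integrable_mult_test_function(1)[OF h t] by auto
        show "AE z in lebesgue. (\<lambda>n. h z * \<phi> n z) \<longlonglongrightarrow> indicator (box c d) z * h z"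
          by (subst mult.commute) (intro AE_I2 tendsto_mult tendsto_const b(3))
        show "AE z in lebesgue. norm (h z * \<phi> n z) \<le> norm (indicator (cbox a b) z * h z)" for n
        proof (intro AE_I2)
          fix z
          have "indicator (box c d) z \<le> (indicator (cbox a b) z :: real)"
            using cd box_subset_cbox[of c d] by (auto split: split_indicator)
          with b(1,2)[of n z] have "\<bar>\<phi> n z\<bar> \<le> indicator (cbox a b) z" by auto
          from mult_left_mono[OF this, of "\<bar>h z\<bar>"]
          show "norm (h z * \<phi> n z) \<le> norm (indicator (cbox a b) z * h z)"
            by (simp add: abs_mult mult.commute)
        qed
        show "(\<lambda>z. indicator (box c d) z * h z) \<in> borel_measurable lebesgue"
        proof -
          have "(\<lambda>z. indicator (box c d) z * (indicator (cbox a b) z * h z)) \<in> borel_measurable lebesgue"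
            by (rule borel_measurable_times[OF _ borel_measurable_integrable[OF I]]) (auto intro: borel_imp_lebesgue)
          also have "(\<lambda>z. indicator (box c d) z * (indicator (cbox a b) z * h z)) = (\<lambda>z. indicator (box c d) z * h z)"
            using cd box_subset_cbox[of c d] by (auto simp: fun_eq_iff split: split_indicator)
          finally show ?thesis .
        qed
      qed
      then show ?thesis by (simp add: zero[OF t] LIMSEQ_const_iff)
    qed
    obtain k where k: "k \<in> borel_measurable borel" "AE z in lborel. indicator (box a b) z * h z = k z"
      using integrable_lebesgue_borelE[of "\<lambda>z. indicator (box a b) z * h z"] J by auto
    have kL: "AE z in lebesgue. indicator (box a b) z * h z = k z" using k(2) AE_completion by blast
    have ik: "integrable lborel k"
    proof -
      have "integrable lebesgue k"
        using J kL k(1) by (subst integrable_cong_AE[symmetric, OF _ _ kL]) (auto intro: borel_imp_lebesgue)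
      then show ?thesis using k(1) by (simp add: integrable_completion)
    qed
    have "AE z in lborel. k z = 0"
    proof (rule AE_zero_if_box_integrals_zero[OF ik])
      fix c d
      let ?c = "\<Sum>i\<in>Basis. max (c\<bullet>i) (a\<bullet>i) *\<^sub>R i" and ?d = "\<Sum>i\<in>Basis. min (d\<bullet>i) (b\<bullet>i) *\<^sub>R i"
      have sub: "cbox ?c ?d \<subseteq> cbox a b" by (auto simp: mem_box)
      have "(LINT z:box c d|lborel. k z) = (LINT z|lebesgue. indicator (box c d) z *\<^sub>R k z)"
        unfolding set_lebesgue_integral_def using k(1) by (intro integral_completion[symmetric]) auto
      also have "\<dots> = (LINT z|lebesgue. indicator (box ?c ?d) z * h z)"
      proof (rule integral_cong_AE)
        show "(\<lambda>z. indicator (box c d) z *\<^sub>R k z) \<in> borel_measurable lebesgue"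
          using k(1) by (intro borel_imp_lebesgue) auto
        have eq: "indicator (box ?c ?d) z * h z = indicator (box c d) z * (indicator (box a b) z * h z)" for z
          unfolding box_Int_box[symmetric] by (auto split: split_indicator)
        show "(\<lambda>z. indicator (box ?c ?d) z * h z) \<in> borel_measurable lebesgue"
          unfolding eq
          by (rule borel_measurable_times[OF _ borel_measurable_integrable[OF J]]) (auto intro: borel_imp_lebesgue)
        show "AE z in lebesgue. indicator (box c d) z *\<^sub>R k z = indicator (box ?c ?d) z * h z"
          unfolding eq using kL by eventually_elim auto
      qed
      also have "\<dots> = 0" by (rule box0[OF sub])
      finally show "(LINT z:box c d|lborel. k z) = 0" .
    qed
    then have "AE z in lebesgue. k z = 0" by (rule AE_completion)
    with kL show ?thesis by eventually_elim (auto split: split_indicator_asm)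
  qed
  \<comment> \<open>Rational boxes whose closure lies in the set form a countable cover.\<close>
  obtain \<D> where \<D>: "countable \<D>" "\<And>X. X \<in> \<D> \<Longrightarrow> \<exists>a b. X = box a b \<and> cbox a b \<subseteq> D" "\<Union>\<D> = D"
  proof -
    let ?\<D> = "(\<lambda>f :: 'a \<Rightarrow> real \<times> real. box (\<Sum>i\<in>Basis. fst (f i) *\<^sub>R i) (\<Sum>i\<in>Basis. snd (f i) *\<^sub>R i))
       ` {f \<in> Basis \<rightarrow>\<^sub>E \<rat> \<times> \<rat>. cbox (\<Sum>i\<in>Basis. fst (f i) *\<^sub>R i) (\<Sum>i\<in>Basis. snd (f i) *\<^sub>R i) \<subseteq> D}"
    show thesis
    proof (rule that[of ?\<D>])
      show "countable ?\<D>"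
        by (intro countable_image countable_subset[OF Collect_subset] countable_PiE countable_SIGMA countable_rat finite_Basis)
      show "\<Union> ?\<D> = D"
      proof (intro equalityI subsetI)
        fix x assume "x \<in> D"
        then obtain e where e: "0 < e" "ball x e \<subseteq> D" using \<open>open D\<close> openE by blast
        then obtain a b where "\<forall>i\<in>Basis. a \<bullet> i \<in> \<rat> \<and> b \<bullet> i \<in> \<rat>" "x \<in> box a b" "box a b \<subseteq> ball x (e / 2)"
          using rational_boxes[of "e / 2" x] by auto
        moreover from this have "cbox a b \<subseteq> ball x e"
          using closure_mono[of "box a b" "ball x (e / 2)"] closure_box[of a b] e(1) by fastforce
        ultimately have ab: "\<forall>i\<in>Basis. a \<bullet> i \<in> \<rat> \<and> b \<bullet> i \<in> \<rat>" "x \<in> box a b" "cbox a b \<subseteq> ball x e"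
          by auto
        define f where "f = restrict (\<lambda>i. (a \<bullet> i, b \<bullet> i)) Basis"
        have f: "(\<Sum>i\<in>Basis. fst (f i) *\<^sub>R i) = a" "(\<Sum>i\<in>Basis. snd (f i) *\<^sub>R i) = b"
          by (simp_all add: f_def euclidean_representation cong: sum.cong)
        have "f \<in> Basis \<rightarrow>\<^sub>E \<rat> \<times> \<rat>" using ab(1) by (auto simp: f_def)
        then show "x \<in> \<Union> ?\<D>"
          using ab e f by (intro UnionI[OF imageI[of f]]) auto
      qed (use box_subset_cbox in blast)
    qed blast
  qed
  have "AE z in lebesgue. \<forall>X\<in>\<D>. z \<in> X \<longrightarrow> h z = 0"
    using \<D>(1) by (subst AE_ball_countable) (use \<D>(2) box in blast)+
  then show ?thesis by eventually_elim (use \<D>(3) in blast)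
qed

section \<open>Calculus of weak gradients\<close>

text \<open>
  Test functions vanish outside the domain, so all integrals may be extended to the whole space,
  where they can be manipulated without reference to the domain.
\<close>

lemma has_weak_gradient_iff:
  "has_weak_gradient_on U G D \<longleftrightarrow> locally_integrable D U \<and> locally_integrable D G \<and>
     (\<forall>\<phi> v. test_function D \<phi> \<longrightarrow>
       (LINT z|lebesgue. U z * frechet_derivative \<phi> (at z) v) = - (LINT z|lebesgue. (G z \<bullet> v) * \<phi> z))"
proof -
  have "(LINT z:D|lebesgue. U z * frechet_derivative \<phi> (at z) v) = (LINT z|lebesgue. U z * frechet_derivative \<phi> (at z) v)
     \<and> (LINT z:D|lebesgue. (G z \<bullet> v) * \<phi> z) = (LINT z|lebesgue. (G z \<bullet> v) * \<phi> z)"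
    if "test_function D \<phi>" for \<phi> v
  proof -
    obtain K where K: "K \<subseteq> D" "\<And>z. z \<notin> K \<Longrightarrow> \<phi> z = 0"
        "\<And>z v. z \<notin> K \<Longrightarrow> frechet_derivative \<phi> (at z) v = 0"
      using \<open>test_function D \<phi>\<close> by (elim test_functionE) blast
    have "\<phi> z = 0 \<and> frechet_derivative \<phi> (at z) v = 0" if "z \<notin> D" for z
      using K that by blast
    then show ?thesis
      unfolding set_lebesgue_integral_def
      by (intro conjI Bochner_Integration.integral_cong refl) (auto split: split_indicator)
  qed
  then show ?thesis
    unfolding has_weak_gradient_on_def locally_integrable_def test_function_def[symmetric] by auto
qed

lemma has_weak_gradient_unique:
  assumes "open D" "has_weak_gradient_on U G D" "has_weak_gradient_on U G' D"
  shows "AE z in lebesgue. z \<in> D \<longrightarrow> G z = G' z"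
proof -
  have "AE z in lebesgue. z \<in> D \<longrightarrow> (G z - G' z) \<bullet> b = 0" for b
  proof (rule fundamental_lemma[OF assms(1)])
    have G: "locally_integrable D (\<lambda>z. G z \<bullet> b)" "locally_integrable D (\<lambda>z. G' z \<bullet> b)"
      using assms by (auto simp: has_weak_gradient_iff intro: locally_integrable_inner)
    show "locally_integrable D (\<lambda>z. (G z - G' z) \<bullet> b)"
      using locally_integrable_diff[OF G] by (simp add: inner_diff_left)
    fix \<phi> assume t: "test_function D \<phi>"
    note I = integrable_mult_test_function(1)[OF G(1) t] integrable_mult_test_function(1)[OF G(2) t]
    have "(LINT z|lebesgue. (G z - G' z) \<bullet> b * \<phi> z) = (LINT z|lebesgue. (G z \<bullet> b) * \<phi> z) - (LINT z|lebesgue. (G' z \<bullet> b) * \<phi> z)"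
      using I by (simp add: inner_diff_left left_diff_distrib)
    also have "\<dots> = 0" using assms(2,3) t by (simp add: has_weak_gradient_iff)
    finally show "(LINT z|lebesgue. (G z - G' z) \<bullet> b * \<phi> z) = 0" .
  qed
  then have "AE z in lebesgue. \<forall>b\<in>Basis. z \<in> D \<longrightarrow> (G z - G' z) \<bullet> b = 0"
    by (intro AE_finite_allI) auto
  then show ?thesis
    by eventually_elim (auto simp: euclidean_eq_iff[of "G _" "G' _"] inner_diff_left)
qed

lemma has_weak_gradient_subset:
  assumes "has_weak_gradient_on U G D" "D' \<subseteq> D"
  shows "has_weak_gradient_on U G D'"
  using assms by (auto simp: has_weak_gradient_iff test_function_def intro: locally_integrable_subset)

lemma has_weak_gradient_diff:
  assumes "has_weak_gradient_on U G D" "has_weak_gradient_on V H D"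
  shows "has_weak_gradient_on (\<lambda>z. U z - V z) (\<lambda>z. G z - H z) D"
  unfolding has_weak_gradient_iff
proof (intro conjI allI impI)
  have L: "locally_integrable D U" "locally_integrable D G" "locally_integrable D V" "locally_integrable D H"
    using assms by (auto simp: has_weak_gradient_iff)
  then show "locally_integrable D (\<lambda>z. U z - V z)" "locally_integrable D (\<lambda>z. G z - H z)"
    by (auto intro: locally_integrable_diff)
  fix \<phi> v assume t: "test_function D \<phi>"
  note I = L(1,3)[THEN integrable_mult_test_function(2), OF t, of v]
    L(2,4)[THEN locally_integrable_inner, THEN integrable_mult_test_function(1), OF t, of v]
  have "(LINT z|lebesgue. (U z - V z) * frechet_derivative \<phi> (at z) v)
      = (LINT z|lebesgue. U z * frechet_derivative \<phi> (at z) v) - (LINT z|lebesgue. V z * frechet_derivative \<phi> (at z) v)"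
    using I by (simp add: left_diff_distrib)
  also have "\<dots> = - ((LINT z|lebesgue. (G z \<bullet> v) * \<phi> z) - (LINT z|lebesgue. (H z \<bullet> v) * \<phi> z))"
    using assms t by (simp add: has_weak_gradient_iff)
  also have "\<dots> = - (LINT z|lebesgue. ((G z - H z) \<bullet> v) * \<phi> z)"
    using I by (simp add: left_diff_distrib inner_diff_left)
  finally show "(LINT z|lebesgue. (U z - V z) * frechet_derivative \<phi> (at z) v) = - (LINT z|lebesgue. ((G z - H z) \<bullet> v) * \<phi> z)" .
qed

definition gradient :: "('a::euclidean_space \<Rightarrow> real) \<Rightarrow> 'a \<Rightarrow> 'a" where
  "gradient \<eta> z = (\<Sum>b\<in>Basis. frechet_derivative \<eta> (at z) b *\<^sub>R b)"

lemma gradient_inner: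
  assumes "smooth \<eta>"
  shows "gradient \<eta> z \<bullet> v = frechet_derivative \<eta> (at z) v"
proof -
  have lin: "linear (frechet_derivative \<eta> (at z))"
    using has_derivative_linear[OF smooth_has_derivative[OF assms]] .
  have "frechet_derivative \<eta> (at z) v = frechet_derivative \<eta> (at z) (\<Sum>b\<in>Basis. (v \<bullet> b) *\<^sub>R b)"
    by (simp add: euclidean_representation)
  also have "\<dots> = gradient \<eta> z \<bullet> v"
    by (simp add: gradient_def linear_sum[OF lin] linear_cmul[OF lin] inner_sum_left mult.commute inner_commute[of v])
  finally show ?thesis by simp
qed

text \<open>
  If \<open>\<eta>\<close> vanishes near the points of \<open>D2\<close> outside \<open>D\<close>, then \<open>\<eta> \<phi>\<close> is a test function on \<open>D\<close> for each test
  function \<open>\<phi>\<close> on \<open>D2\<close>.  Testing the weak gradient on \<open>D\<close> with \<open>\<eta> \<phi>\<close> gives the product rule on \<open>D2\<close>.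
\<close>

lemma has_weak_gradient_cutoff:
  assumes e: "has_weak_gradient_on e G D" and "smooth \<eta>" and "D \<subseteq> D2"
    and K: "closed K" "K \<inter> D2 \<subseteq> D" "\<And>z. z \<notin> K \<Longrightarrow> \<eta> z = 0"
  shows "has_weak_gradient_on (\<lambda>z. \<eta> z * e z) (\<lambda>z. \<eta> z *\<^sub>R G z + e z *\<^sub>R gradient \<eta> z) D2"
  unfolding has_weak_gradient_iff
proof (intro conjI allI impI)
  have L: "locally_integrable D e" "locally_integrable D G"
    using assms by (auto simp: has_weak_gradient_iff)
  have d0: "frechet_derivative \<eta> (at z) v = 0" if "z \<notin> K" for z v
  proof -
    have "(\<eta> has_derivative (\<lambda>_. 0)) (at z)"
      by (rule has_derivative_transform_within_open[of "\<lambda>_. 0" _ _ _ "- K"])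
        (use that K in auto)
    then show ?thesis using frechet_derivative_at by metis
  qed
  then have g0: "gradient \<eta> z = 0" if "z \<notin> K" for z using that by (simp add: gradient_def)
  have cut: "set_integrable lebesgue C (\<lambda>z. \<psi> z *\<^sub>R f z)"
    if "compact C" "C \<subseteq> D2" "locally_integrable D f" "continuous_on UNIV \<psi>" "\<And>z. z \<notin> K \<Longrightarrow> \<psi> z = 0"
    for C \<psi> and f :: "'a \<Rightarrow> 'c::euclidean_space"
  proof -
    have CK: "compact (C \<inter> K)" "C \<inter> K \<subseteq> D" using that K by (auto intro: compact_Int_closed)
    then have I: "integrable lebesgue (\<lambda>z. indicator (C \<inter> K) z *\<^sub>R f z)"
      using that by (auto simp: locally_integrable_def set_integrable_def)
    have "bounded (\<psi> ` C)"
      using that continuous_on_subset[of UNIV \<psi> C] by (intro compact_imp_bounded compact_continuous_image) auto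
    then obtain B where B: "\<And>z. z \<in> C \<Longrightarrow> \<bar>\<psi> z\<bar> \<le> B" by (auto simp: bounded_iff)
    have [measurable]: "\<psi> \<in> borel_measurable lebesgue"
      by (intro borel_imp_lebesgue borel_measurable_continuous_onI that)
    have [measurable]: "(\<lambda>z. indicator (C \<inter> K) z *\<^sub>R f z) \<in> borel_measurable lebesgue" using I by auto
    have eq: "indicator C z *\<^sub>R (\<psi> z *\<^sub>R f z) = \<psi> z *\<^sub>R (indicator (C \<inter> K) z *\<^sub>R f z)" for z
      using that(5)[of z] by (auto split: split_indicator)
    show ?thesis
      unfolding set_integrable_def
    proof (rule Bochner_Integration.integrable_bound)
      show "integrable lebesgue (\<lambda>z. B *\<^sub>R (indicator (C \<inter> K) z *\<^sub>R f z))"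
        using I by (intro integrable_scaleR_right)
      show "(\<lambda>z. indicator C z *\<^sub>R (\<psi> z *\<^sub>R f z)) \<in> borel_measurable lebesgue" unfolding eq by measurable
      show "AE z in lebesgue. norm (indicator C z *\<^sub>R (\<psi> z *\<^sub>R f z)) \<le> norm (B *\<^sub>R (indicator (C \<inter> K) z *\<^sub>R f z))"
        unfolding eq using B by (intro AE_I2) (auto split: split_indicator intro!: mult_right_mono intro: order_trans[OF _ abs_ge_self])
    qed
  qed
  show Le: "locally_integrable D2 (\<lambda>z. \<eta> z * e z)"
    unfolding locally_integrable_def
    using cut[OF _ _ L(1) smooth_continuous[OF \<open>smooth \<eta>\<close>] K(3)] by simp
  have grad_int: "set_integrable lebesgue C (\<lambda>z. e z *\<^sub>R gradient \<eta> z)" if "compact C" "C \<subseteq> D2" for C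
  proof -
    have "set_integrable lebesgue C (\<lambda>z. \<Sum>b\<in>Basis. (frechet_derivative \<eta> (at z) b *\<^sub>R e z) *\<^sub>R b)"
    proof -
      have "integrable lebesgue (\<lambda>z. \<Sum>b\<in>Basis. (indicator C z *\<^sub>R (frechet_derivative \<eta> (at z) b *\<^sub>R e z)) *\<^sub>R b)"
        using cut[OF that L(1) smooth_continuous[OF smooth_frechet[OF \<open>smooth \<eta>\<close>]] d0, unfolded set_integrable_def]
        by (intro Bochner_Integration.integrable_sum integrable_scaleR_left)
      then show ?thesis by (simp add: set_integrable_def scaleR_sum_right)
    qed
    then show ?thesis by (simp add: gradient_def scaleR_sum_right mult.commute)
  qed
  show LG: "locally_integrable D2 (\<lambda>z. \<eta> z *\<^sub>R G z + e z *\<^sub>R gradient \<eta> z)"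
    unfolding locally_integrable_def
    using cut[OF _ _ L(2) smooth_continuous[OF \<open>smooth \<eta>\<close>] K(3)] grad_int by (auto intro: set_integral_add)
  fix \<phi> v assume t: "test_function D2 \<phi>"
  obtain S where S: "smooth \<phi>" "compact S" "S \<subseteq> D2" "\<And>z. z \<notin> S \<Longrightarrow> \<phi> z = 0"
    "\<And>z v. z \<notin> S \<Longrightarrow> frechet_derivative \<phi> (at z) v = 0"
    using t by (elim test_functionE) blast
  have t': "test_function D (\<lambda>z. \<eta> z * \<phi> z)"
    by (rule test_functionI[of _ "S \<inter> K"])
      (use S K \<open>smooth \<eta>\<close> in \<open>auto intro: smooth_mult compact_Int_closed\<close>)
  have der: "frechet_derivative (\<lambda>z. \<eta> z * \<phi> z) (at z) v
      = \<eta> z * frechet_derivative \<phi> (at z) v + frechet_derivative \<eta> (at z) v * \<phi> z" for z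
    by (simp only: frechet_derivative_at[OF has_derivative_mult[OF smooth_has_derivative[OF \<open>smooth \<eta>\<close>] smooth_has_derivative[OF S(1)]], symmetric])
  have I1: "integrable lebesgue (\<lambda>z. \<eta> z * e z * frechet_derivative \<phi> (at z) v)"
    by (rule integrable_mult_test_function(2)[OF Le t])
  have I2: "integrable lebesgue (\<lambda>z. ((\<eta> z *\<^sub>R G z + e z *\<^sub>R gradient \<eta> z) \<bullet> v) * \<phi> z)"
    by (rule integrable_mult_test_function(1)[OF locally_integrable_inner[OF LG] t])
  have I3: "integrable lebesgue (\<lambda>z. e z * frechet_derivative (\<lambda>z. \<eta> z * \<phi> z) (at z) v)"
    by (rule integrable_mult_test_function(2)[OF L(1) t'])
  have I4: "integrable lebesgue (\<lambda>z. (G z \<bullet> v) * (\<eta> z * \<phi> z))"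
    by (rule integrable_mult_test_function(1)[OF locally_integrable_inner[OF L(2)] t'])
  have "(LINT z|lebesgue. \<eta> z * e z * frechet_derivative \<phi> (at z) v)
      + (LINT z|lebesgue. ((\<eta> z *\<^sub>R G z + e z *\<^sub>R gradient \<eta> z) \<bullet> v) * \<phi> z)
      = (LINT z|lebesgue. \<eta> z * e z * frechet_derivative \<phi> (at z) v
          + ((\<eta> z *\<^sub>R G z + e z *\<^sub>R gradient \<eta> z) \<bullet> v) * \<phi> z)"
    using I1 I2 by simp
  also have "\<dots> = (LINT z|lebesgue. e z * frechet_derivative (\<lambda>z. \<eta> z * \<phi> z) (at z) v + (G z \<bullet> v) * (\<eta> z * \<phi> z))"
    by (intro Bochner_Integration.integral_cong refl)
      (simp add: der inner_add_left gradient_inner[OF \<open>smooth \<eta>\<close>] algebra_simps)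
  also have "\<dots> = 0"
    using I3 I4 e t' by (simp add: has_weak_gradient_iff)
  finally show "(LINT z|lebesgue. \<eta> z * e z * frechet_derivative \<phi> (at z) v)
      = - (LINT z|lebesgue. ((\<eta> z *\<^sub>R G z + e z *\<^sub>R gradient \<eta> z) \<bullet> v) * \<phi> z)" by simp
qed

lemma has_weak_gradient_weak_gradient:
  "has_weak_gradient_on U G D \<Longrightarrow> has_weak_gradient_on U (weak_gradient D U) D"
  unfolding weak_gradient_def by (rule someI[of "\<lambda>G. has_weak_gradient_on U G D"])

lemma weak_gradient_eq_AE:
  "open D \<Longrightarrow> has_weak_gradient_on U G D \<Longrightarrow> AE z in lebesgue. z \<in> D \<longrightarrow> weak_gradient D U z = G z"
  using has_weak_gradient_unique has_weak_gradient_weak_gradient by blast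

lemma has_weak_gradient_measurable:
  assumes "open D" "has_weak_gradient_on U G D"
  shows "(\<lambda>z. indicator D z *\<^sub>R U z) \<in> borel_measurable lebesgue"
    "(\<lambda>z. indicator D z *\<^sub>R G z) \<in> borel_measurable lebesgue"
  using assms by (auto simp: has_weak_gradient_iff simp del: real_scaleR_def intro!: locally_integrable_measurable)

text \<open>
  The density of the weighted norm with an explicit gradient; uniqueness of weak gradients makes every
  weak gradient as good as the one selected in the definition of the norm.
\<close>

definition sobolev_density :: "real \<Rightarrow> ('a::euclidean_space \<times> real \<Rightarrow> real) \<Rightarrow> ('a \<times> real \<Rightarrow> 'a \<times> real) \<Rightarrow> 'a \<times> real \<Rightarrow> real" where
  "sobolev_density \<alpha> U G z = snd z powr \<alpha> * ((norm (G z))\<^sup>2 + inverse ((rho z)\<^sup>2) * (U z)\<^sup>2)"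

lemma sobolev_density_nonneg: "0 \<le> sobolev_density \<alpha> U G z"
  by (simp add: sobolev_density_def)

lemma measurable_snd_powr [measurable]:
  "(\<lambda>z::'a::euclidean_space \<times> real. snd z powr \<alpha>) \<in> borel_measurable borel"
proof -
  have [measurable]: "(snd :: 'a \<times> real \<Rightarrow> real) \<in> borel_measurable borel"
    by (intro borel_measurable_continuous_onI continuous_intros)
  show ?thesis by measurable
qed

lemma rho_pos: "0 < rho z" and rho_square: "(rho z)\<^sup>2 = 1 + (norm (fst z))\<^sup>2 + (snd z)\<^sup>2"
proof -
  have "0 < 1 + (norm (fst z))\<^sup>2 + (snd z)\<^sup>2" by (smt (verit) zero_le_power2)
  then show "0 < rho z" "(rho z)\<^sup>2 = 1 + (norm (fst z))\<^sup>2 + (snd z)\<^sup>2" by (simp_all add: rho_def)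
qed

lemma measurable_rho [measurable]: "rho \<in> borel_measurable borel"
  unfolding rho_def by (intro borel_measurable_continuous_onI continuous_intros)

lemma sobolev_density_measurable:
  assumes "open D" "has_weak_gradient_on U G D"
  shows "(\<lambda>z. indicator D z *\<^sub>R sobolev_density \<alpha> U G z) \<in> borel_measurable lebesgue"
proof -
  note [measurable] = has_weak_gradient_measurable[OF assms] borel_imp_lebesgue[OF measurable_rho] borel_imp_lebesgue[OF measurable_snd_powr]
  have eq: "indicator D z *\<^sub>R sobolev_density \<alpha> U G z = snd z powr \<alpha> * ((norm (indicator D z *\<^sub>R G z))\<^sup>2
      + inverse ((rho z)\<^sup>2) * (indicator D z *\<^sub>R U z)\<^sup>2)" for z
    by (auto simp: sobolev_density_def split: split_indicator)
  show ?thesis unfolding eq by measurable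
qed

lemma H1rho_density_AE:
  assumes "open D" "has_weak_gradient_on U G D"
  shows "AE z in lebesgue. indicator D z *\<^sub>R H1rho_density \<alpha> D U z = indicator D z *\<^sub>R sobolev_density \<alpha> U G z"
  using weak_gradient_eq_AE[OF assms]
  by eventually_elim (auto simp: H1rho_density_def sobolev_density_def split: split_indicator)

lemma H1rho_density_eq: "H1rho_density \<alpha> D U = sobolev_density \<alpha> U (weak_gradient D U)"
  by (simp add: H1rho_density_def sobolev_density_def fun_eq_iff)

lemma
  assumes "open D" "has_weak_gradient_on U G D"
  shows H1rho_iff: "U \<in> H1rho \<alpha> D \<longleftrightarrow> set_integrable lebesgue D (sobolev_density \<alpha> U G)"
    and H1rho_norm_eq: "H1rho_norm \<alpha> D U = sqrt (LINT z:D|lebesgue. sobolev_density \<alpha> U G z)"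
proof -
  note m = sobolev_density_measurable[OF assms(1) has_weak_gradient_weak_gradient[OF assms(2)], of \<alpha>, folded H1rho_density_eq]
    sobolev_density_measurable[OF assms, of \<alpha>]
  show "U \<in> H1rho \<alpha> D \<longleftrightarrow> set_integrable lebesgue D (sobolev_density \<alpha> U G)"
    using assms integrable_cong_AE[OF m H1rho_density_AE[OF assms]]
    by (auto simp: H1rho_def set_integrable_def)
  show "H1rho_norm \<alpha> D U = sqrt (LINT z:D|lebesgue. sobolev_density \<alpha> U G z)"
    using integral_cong_AE[OF m H1rho_density_AE[OF assms]]
    by (simp add: H1rho_norm_def set_lebesgue_integral_def)
qed

lemma H1rhoE:
  assumes "U \<in> H1rho \<alpha> D"
  obtains G where "has_weak_gradient_on U G D" "weak_gradient D U = G" "set_integrable lebesgue D (sobolev_density \<alpha> U G)"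
proof -
  have "has_weak_gradient_on U (weak_gradient D U) D" "set_integrable lebesgue D (H1rho_density \<alpha> D U)"
    using assms has_weak_gradient_weak_gradient by (auto simp: H1rho_def)
  then show ?thesis using that by (simp add: H1rho_density_eq)
qed

lemma open_slab [simp]: "open (slab Y)" and open_halfspace [simp]: "open halfspace"
  by (auto simp: slab_def halfspace_def intro!: open_Times)

section \<open>Difference quotients of weakly differentiable functions\<close>

lemma
  fixes f :: "'a::euclidean_space \<Rightarrow> 'b::{banach, second_countable_topology}"
  assumes [measurable]: "f \<in> borel_measurable borel"
  shows integral_lborel_translate: "(LINT z|lborel. f (z + c)) = (LINT z|lborel. f z)"
    and integrable_lborel_translate: "integrable lborel (\<lambda>z. f (z + c)) \<longleftrightarrow> integrable lborel f"
  using integral_distr[of "(+) c" lborel borel f] integrable_distr_eq[of "(+) c" lborel borel f]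
  by (simp_all add: lborel_distr_plus add.commute)

lemma nn_integral_lborel_translate:
  fixes f :: "'a::euclidean_space \<Rightarrow> ennreal"
  assumes [measurable]: "f \<in> borel_measurable borel"
  shows "(\<integral>\<^sup>+z. f (z + c) \<partial>lborel) = (\<integral>\<^sup>+z. f z \<partial>lborel)"
  using nn_integral_distr[of "(+) c" lborel borel f] by (simp add: lborel_distr_plus add.commute)

lemma AE_lborel_translate:
  fixes P :: "'a::euclidean_space \<Rightarrow> bool"
  assumes "AE z in lborel. P z"
  shows "AE z in lborel. P (z + c)"
proof -
  have "AE z in distr lborel borel ((+) c). P z" using assms unfolding lborel_distr_plus .
  then have "AE z in lborel. P (c + z)" by (rule AE_distrD[rotated]) simp
  then show ?thesis by (simp add: add.commute)
qed

text \<open>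
  Lebesgue measure is complete and therefore not a product measure; Borel versions make Fubini's
  theorem applicable.
\<close>

lemma has_weak_gradient_borelE:
  fixes U :: "'a::euclidean_space \<Rightarrow> real"
  assumes "open D" "has_weak_gradient_on U G D"
  obtains u g where "u \<in> borel_measurable borel" "g \<in> borel_measurable borel"
    "AE z in lborel. z \<in> D \<longrightarrow> u z = U z" "AE z in lborel. z \<in> D \<longrightarrow> g z = G z \<bullet> v"
proof -
  note m = has_weak_gradient_measurable[OF assms]
  obtain u where u: "u \<in> borel_measurable borel" "AE z in lborel. indicator D z *\<^sub>R U z = u z"
    using integrable_lebesgue_borelE[OF m(1)] by auto
  have "(\<lambda>z. (indicator D z *\<^sub>R G z) \<bullet> v) \<in> borel_measurable lebesgue"
    using m(2) by (intro borel_measurable_inner) auto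
  then obtain g where g: "g \<in> borel_measurable borel" "AE z in lborel. (indicator D z *\<^sub>R G z) \<bullet> v = g z"
    using integrable_lebesgue_borelE by blast
  show thesis
    by (rule that[OF u(1) g(1)], use u(2) in eventually_elim, force, use g(2) in eventually_elim, force)
qed

lemma set_integrable_borel_version:
  fixes f F :: "'a::euclidean_space \<Rightarrow> real"
  assumes "compact K" "K \<subseteq> D" "locally_integrable D F" and [measurable]: "f \<in> borel_measurable borel"
    and "AE z in lborel. z \<in> D \<longrightarrow> f z = F z"
  shows "set_integrable lborel K f"
proof -
  have I: "integrable lebesgue (\<lambda>z. indicator K z *\<^sub>R F z)"
    using assms by (auto simp: locally_integrable_def set_integrable_def)
  have [measurable]: "K \<in> sets borel" using assms by (intro borel_closed compact_imp_closed)
  have "integrable lebesgue (\<lambda>z. indicator K z *\<^sub>R f z)"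
  proof (rule integrable_cong_AE[THEN iffD1, OF _ _ _ I])
    show "AE z in lebesgue. indicator K z *\<^sub>R F z = indicator K z *\<^sub>R f z"
      using AE_completion[OF assms(5)] by eventually_elim (use assms(2) in \<open>auto split: split_indicator\<close>)
  qed (use I in \<open>auto intro: borel_imp_lebesgue simp del: real_scaleR_def\<close>)
  then show ?thesis by (simp add: set_integrable_def integrable_completion)
qed

lemma fundamental_lemma_borel:
  fixes h :: "'a::euclidean_space \<Rightarrow> real"
  assumes "open D" and [measurable]: "h \<in> borel_measurable borel"
    and h: "\<And>K. compact K \<Longrightarrow> K \<subseteq> D \<Longrightarrow> set_integrable lborel K h"
    and zero: "\<And>\<phi>. test_function D \<phi> \<Longrightarrow> (LINT z|lborel. h z * \<phi> z) = 0"
  shows "AE z in lborel. z \<in> D \<longrightarrow> h z = 0"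
proof -
  have "AE z in lebesgue. z \<in> D \<longrightarrow> h z = 0"
  proof (rule fundamental_lemma[OF assms(1)])
    have "set_integrable lebesgue K h" if "compact K" "K \<subseteq> D" for K
    proof -
      have [measurable]: "K \<in> sets borel" using that by (intro borel_closed compact_imp_closed)
      show ?thesis using h[OF that] by (simp add: set_integrable_def integrable_completion)
    qed
    then show "locally_integrable D h" by (simp add: locally_integrable_def)
    fix \<phi> :: "'a \<Rightarrow> real" assume t: "test_function D \<phi>"
    then have [measurable]: "\<phi> \<in> borel_measurable borel" by (auto simp: test_function_def intro: smooth_borel)
    show "(LINT z|lebesgue. h z * \<phi> z) = 0"
      using zero[OF t] by (simp add: integral_completion)
  qed
  then show ?thesis by (simp add: AE_completion_iff)
qed

lemma frechet_derivative_translate: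
  assumes "smooth \<phi>"
  shows "frechet_derivative (\<lambda>z. \<phi> (z - c)) (at z) v = frechet_derivative \<phi> (at (z - c)) v"
proof -
  have "((\<lambda>z. \<phi> (z - c)) has_derivative (\<lambda>v. frechet_derivative \<phi> (at (z - c)) v)) (at z)"
    by (rule has_derivative_compose[OF _ smooth_has_derivative[OF assms], of "\<lambda>z. z - c" "\<lambda>v. v"])
      (auto intro!: derivative_eq_intros)
  then show ?thesis using frechet_derivative_at by metis
qed

lemma smooth_translate: "smooth \<phi> \<Longrightarrow> smooth (\<lambda>z. \<phi> (z - c))"
proof -
  assume "smooth \<phi>"
  have "C_times k \<phi> \<Longrightarrow> C_times k (\<lambda>z. \<phi> (z - c))" for k
  proof (induction k arbitrary: \<phi>)
    case 0
    then show ?case by (auto intro!: continuous_on_compose2[of UNIV \<phi>] continuous_intros)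
  next
    case (Suc k)
    note D = C_times_SucD[OF Suc.prems]
    have "((\<lambda>z. \<phi> (z - c)) has_derivative (\<lambda>v. frechet_derivative \<phi> (at (z - c)) v)) (at z)" for z
      by (rule has_derivative_compose[OF _ D(1), of "\<lambda>z. z - c" "\<lambda>v. v"])
        (auto intro!: derivative_eq_intros)
    then show ?case
      by (rule C_times_SucI) (rule Suc.IH[OF D(2)])
  qed
  then show ?thesis using \<open>smooth \<phi>\<close> by (auto simp: smooth_def)
qed

text \<open>
  Testing the weak gradient with the translates of a test function, and integrating over the
  translation parameter, gives the fundamental theorem of calculus along almost every segment
  of a given direction and length.
\<close>

lemma weak_difference_formula:
  fixes U :: "'a::euclidean_space \<Rightarrow> real"
  assumes D: "open D" "has_weak_gradient_on U G D"
    and u[measurable]: "u \<in> borel_measurable borel" and g[measurable]: "g \<in> borel_measurable borel"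
    and uU: "AE z in lborel. z \<in> D \<longrightarrow> u z = U z"
    and gG: "AE z in lborel. z \<in> D \<longrightarrow> g z = G z \<bullet> v"
    and "open D'" "0 \<le> h" and D': "\<And>z t. z \<in> D' \<Longrightarrow> 0 \<le> t \<Longrightarrow> t \<le> h \<Longrightarrow> z + t *\<^sub>R v \<in> D"
  shows "AE z in lborel. z \<in> D' \<longrightarrow> u (z + h *\<^sub>R v) - u z = (LINT t:{0..h}|lborel. g (z + t *\<^sub>R v))"
proof -
  have LU: "locally_integrable D U" and LG: "locally_integrable D (\<lambda>z. G z \<bullet> v)"
    using D by (auto simp: has_weak_gradient_iff intro: locally_integrable_inner)
  note su = set_integrable_borel_version[OF _ _ LU u uU] and sg = set_integrable_borel_version[OF _ _ LG g gG]
  have weak: "(LINT z|lborel. u z * frechet_derivative \<phi> (at z) v) = - (LINT z|lborel. g z * \<phi> z)"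
    if t: "test_function D \<phi>" for \<phi>
  proof -
    obtain K where K: "smooth \<phi>" "K \<subseteq> D" "\<And>z. z \<notin> K \<Longrightarrow> \<phi> z = 0"
        "\<And>z v. z \<notin> K \<Longrightarrow> frechet_derivative \<phi> (at z) v = 0"
      using t by (elim test_functionE) blast
    have out: "\<phi> z = 0 \<and> frechet_derivative \<phi> (at z) v = 0" if "z \<notin> D" for z using K that by blast
    have [measurable]: "\<phi> \<in> borel_measurable borel" "(\<lambda>z. frechet_derivative \<phi> (at z) v) \<in> borel_measurable borel"
      using K(1) by (auto intro: smooth_borel smooth_frechet)
    have "(LINT z|lborel. u z * frechet_derivative \<phi> (at z) v) = (LINT z|lebesgue. u z * frechet_derivative \<phi> (at z) v)"
      by (simp add: integral_completion)
    also have "\<dots> = (LINT z|lebesgue. U z * frechet_derivative \<phi> (at z) v)"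
      using integrable_mult_test_function(2)[OF LU t, of v] AE_completion[OF uU]
      by (intro integral_cong_AE) (auto intro: borel_imp_lebesgue elim!: eventually_mono simp: out)
    also have "\<dots> = - (LINT z|lebesgue. (G z \<bullet> v) * \<phi> z)"
      using D t by (simp add: has_weak_gradient_iff)
    also have "(LINT z|lebesgue. (G z \<bullet> v) * \<phi> z) = (LINT z|lebesgue. g z * \<phi> z)"
      using integrable_mult_test_function(1)[OF LG t] AE_completion[OF gG]
      by (intro integral_cong_AE) (auto intro: borel_imp_lebesgue elim!: eventually_mono simp: out)
    also have "\<dots> = (LINT z|lborel. g z * \<phi> z)" by (simp add: integral_completion)
    finally show ?thesis .
  qed
  define k where "k = (\<lambda>z. u (z + h *\<^sub>R v) - u z - (LINT t|lborel. indicator {0..h} t * g (z + t *\<^sub>R v)))"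
  have [measurable]: "k \<in> borel_measurable borel"
    unfolding k_def by measurable
  \<comment> \<open>The compact set that is swept when \<open>K\<close> moves along the segment.\<close>
  define S where "S K = (\<lambda>(z, t). z + t *\<^sub>R v) ` (K \<times> {0..h})" for K
  have S: "compact (S K)" "S K \<subseteq> D" if "compact K" "K \<subseteq> D'" for K
    using that D' unfolding S_def
    by (auto intro!: compact_continuous_image compact_Times continuous_intros simp: case_prod_unfold)
  have SI: "z + t *\<^sub>R v \<in> S K" if "z \<in> K" "0 \<le> t" "t \<le> h" for z t K
    using that by (auto simp: S_def)
  have prod_integrable: "integrable (lborel \<Otimes>\<^sub>M lborel) (\<lambda>(t, z). indicator {0..h} t * (f (z + t *\<^sub>R v) * c t z))"
    if f: "integrable lborel f" and c[measurable]: "(\<lambda>(t, z). c t z) \<in> borel_measurable (borel \<Otimes>\<^sub>M borel)"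
      and C: "\<And>t z. \<bar>c t z\<bar> \<le> C" for f :: "'a \<Rightarrow> real" and c :: "real \<Rightarrow> 'a \<Rightarrow> real" and C
  proof -
    have [measurable]: "f \<in> borel_measurable borel" using f by auto
    have I: "integrable (lborel \<Otimes>\<^sub>M lborel) (\<lambda>(t, z). indicator {0..h} t * f (z + t *\<^sub>R v))"
    proof (rule lborel_pair.Fubini_integrable)
      show "integrable lborel (\<lambda>t. LINT z|lborel. norm (case (t, z) of (t, z) \<Rightarrow> indicator {0..h} t * f (z + t *\<^sub>R v)))"
        using \<open>0 \<le> h\<close> integrable_real_indicator[of "{0..h}" lborel]
        by (simp add: abs_mult integral_lborel_translate[of "\<lambda>z. \<bar>f z\<bar>"])
      show "AE t in lborel. integrable lborel (\<lambda>z. case (t, z) of (t, z) \<Rightarrow> indicator {0..h} t * f (z + t *\<^sub>R v))"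
        using f by (simp add: integrable_lborel_translate)
    qed measurable
    show ?thesis
    proof (rule Bochner_Integration.integrable_bound)
      show "integrable (lborel \<Otimes>\<^sub>M lborel) (\<lambda>x. C * (case x of (t, z) \<Rightarrow> indicator {0..h} t * f (z + t *\<^sub>R v)))"
        using I by simp
      have "\<bar>indicator {0..h} t * (f (z + t *\<^sub>R v) * c t z)\<bar> \<le> \<bar>C * (indicator {0..h} t * f (z + t *\<^sub>R v))\<bar>" for t z
        using mult_right_mono[OF order_trans[OF C[of t z] abs_ge_self[of C]], of "\<bar>f (z + t *\<^sub>R v)\<bar>"]
        by (auto simp: abs_mult mult.commute split: split_indicator)
      then show "AE x in lborel \<Otimes>\<^sub>M lborel. norm (case x of (t, z) \<Rightarrow> indicator {0..h} t * (f (z + t *\<^sub>R v) * c t z))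
         \<le> norm (C * (case x of (t, z) \<Rightarrow> indicator {0..h} t * f (z + t *\<^sub>R v)))"
        by (intro AE_I2) auto
    qed measurable
  qed
  have "AE z in lborel. z \<in> D' \<longrightarrow> k z = 0"
  proof (rule fundamental_lemma_borel[OF \<open>open D'\<close>])
    fix K assume K: "compact K" "K \<subseteq> D'"
    have [measurable]: "K \<in> sets borel" "S K \<in> sets borel" using K S by (auto intro!: borel_closed compact_imp_closed)
    have iu: "integrable lborel (\<lambda>z. indicator (S K) z * u z)" and ig: "integrable lborel (\<lambda>z. indicator (S K) z * g z)"
      using su[OF S[OF K]] sg[OF S[OF K]] by (auto simp: set_integrable_def)
    have "integrable lborel (\<lambda>z. indicator K z * (indicator (S K) (z + h *\<^sub>R v) * u (z + h *\<^sub>R v)))"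
      by (rule integrable_real_mult_indicator[of K lborel "\<lambda>z. indicator (S K) (z + h *\<^sub>R v) * u (z + h *\<^sub>R v)", simplified mult.commute[of _ "indicator K _"]])
        (use iu integrable_lborel_translate[of "\<lambda>z. indicator (S K) z * u z" "h *\<^sub>R v"] in auto)
    moreover have "indicator K z * (indicator (S K) (z + h *\<^sub>R v) * u (z + h *\<^sub>R v)) = indicator K z * u (z + h *\<^sub>R v)" for z
      using SI[of z K h] \<open>0 \<le> h\<close> by (auto split: split_indicator)
    ultimately have i1: "integrable lborel (\<lambda>z. indicator K z * u (z + h *\<^sub>R v))" by simp
    have i2: "integrable lborel (\<lambda>z. indicator K z * u z)"
      using su[OF K(1)] K(2) D'[of _ 0] \<open>0 \<le> h\<close> by (auto simp: set_integrable_def)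
    have "integrable (lborel \<Otimes>\<^sub>M lborel)
        (\<lambda>(t, z). indicator {0..h} t * ((indicator (S K) (z + t *\<^sub>R v) * g (z + t *\<^sub>R v)) * indicator K z))"
      by (rule prod_integrable[OF ig, of "\<lambda>t z. indicator K z" 1]) (auto split: split_indicator)
    from lborel_pair.integrable_snd[OF this]
    have "integrable lborel (\<lambda>z. LINT t|lborel. indicator {0..h} t * ((indicator (S K) (z + t *\<^sub>R v) * g (z + t *\<^sub>R v)) * indicator K z))"
      by simp
    moreover have "(LINT t|lborel. indicator {0..h} t * ((indicator (S K) (z + t *\<^sub>R v) * g (z + t *\<^sub>R v)) * indicator K z))
        = indicator K z * (LINT t|lborel. indicator {0..h} t * g (z + t *\<^sub>R v))" for z
      unfolding integral_mult_right_zero[symmetric]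
      by (intro Bochner_Integration.integral_cong refl) (use SI[of z K] in \<open>auto split: split_indicator\<close>)
    ultimately have i3: "integrable lborel (\<lambda>z. indicator K z * (LINT t|lborel. indicator {0..h} t * g (z + t *\<^sub>R v)))" by simp
    show "set_integrable lborel K k"
      using i1 i2 i3 by (simp add: set_integrable_def k_def right_diff_distrib)
  next
    fix \<phi> :: "'a \<Rightarrow> real" assume t: "test_function D' \<phi>"
    obtain K where K: "smooth \<phi>" "compact K" "K \<subseteq> D'" "\<And>z. z \<notin> K \<Longrightarrow> \<phi> z = 0"
        "\<And>z v. z \<notin> K \<Longrightarrow> frechet_derivative \<phi> (at z) v = 0"
      using t by (elim test_functionE) blast
    obtain C where C: "0 \<le> C" "\<forall>z. \<bar>\<phi> z\<bar> \<le> C" "\<forall>z v. \<bar>frechet_derivative \<phi> (at z) v\<bar> \<le> C * norm v"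
      using test_function_bounds[OF t] by blast
    note C = C(1) C(2)[rule_format] C(3)[rule_format]
    define d\<phi> where "d\<phi> z = frechet_derivative \<phi> (at z) v" for z
    have [measurable]: "\<phi> \<in> borel_measurable borel" "d\<phi> \<in> borel_measurable borel"
      using K(1) unfolding d\<phi>_def[abs_def] by (auto intro: smooth_borel smooth_frechet)
    note SK = S[OF K(2,3)]
    have [measurable]: "K \<in> sets borel" "S K \<in> sets borel" using K SK by (auto intro!: borel_closed compact_imp_closed)
    have iu: "integrable lborel (\<lambda>z. indicator (S K) z * u z)" and ig: "integrable lborel (\<lambda>z. indicator (S K) z * g z)"
      using su[OF SK] sg[OF SK] by (auto simp: set_integrable_def)
    have tt: "test_function D (\<lambda>z. \<phi> (z - t *\<^sub>R v))" if "0 \<le> t" "t \<le> h" for t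
    proof (rule test_functionI[OF smooth_translate[OF K(1)] SK])
      fix z assume "z \<notin> S K"
      then have "z - t *\<^sub>R v \<notin> K" using SI[of "z - t *\<^sub>R v" K t] that by auto
      then show "\<phi> (z - t *\<^sub>R v) = 0" by (rule K)
    qed
    have i: "integrable lborel (\<lambda>z. (indicator (S K) z * u z) * \<phi> (z - t *\<^sub>R v))" for t
    proof (rule Bochner_Integration.integrable_bound)
      show "integrable lborel (\<lambda>z. (indicator (S K) z * u z) * C)" using iu by (rule integrable_mult_left)
      show "AE z in lborel. norm ((indicator (S K) z * u z) * \<phi> (z - t *\<^sub>R v)) \<le> norm ((indicator (S K) z * u z) * C)"
        unfolding norm_mult using order_trans[OF C(2) abs_ge_self[of C]] by (intro AE_I2 mult_left_mono) auto
    qed measurable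
    have cut: "u z * \<phi> (z - t *\<^sub>R v) = (indicator (S K) z * u z) * \<phi> (z - t *\<^sub>R v)" if "0 \<le> t" "t \<le> h" for z t
      using K(4)[of "z - t *\<^sub>R v"] SI[of "z - t *\<^sub>R v" K t] that by (auto split: split_indicator)
    have dcut: "(indicator (S K) z * u z) * d\<phi> (z - t *\<^sub>R v) = u z * d\<phi> (z - t *\<^sub>R v)" if "0 \<le> t" "t \<le> h" for z t
      using K(5)[of "z - t *\<^sub>R v" v] SI[of "z - t *\<^sub>R v" K t] that by (auto split: split_indicator simp: d\<phi>_def)
    have pg: "integrable (lborel \<Otimes>\<^sub>M lborel)
        (\<lambda>(t, z). indicator {0..h} t * ((indicator (S K) (z + t *\<^sub>R v) * g (z + t *\<^sub>R v)) * \<phi> z))"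
      by (rule prod_integrable[OF ig, of "\<lambda>t z. \<phi> z" C]) (use C in auto)
    have eqg: "indicator {0..h} t * ((indicator (S K) (z + t *\<^sub>R v) * g (z + t *\<^sub>R v)) * \<phi> z)
        = indicator {0..h} t * (g (z + t *\<^sub>R v) * \<phi> z)" for t z
      using K(4)[of z] SI[of z K t] by (auto split: split_indicator)
    have pu: "integrable (lborel \<Otimes>\<^sub>M lborel)
        (\<lambda>(t, z). indicator {0..h} t * ((indicator (S K) z * u z) * d\<phi> (z - t *\<^sub>R v)))"
    proof -
      have I: "integrable (lborel \<Otimes>\<^sub>M lborel) (\<lambda>(t, z). indicator {0..h} t * (indicator (S K) z * u z))"
        by (rule lborel_pair.Fubini_integrable) (use iu \<open>0 \<le> h\<close> integrable_real_indicator[of "{0..h}" lborel] in \<open>auto simp: abs_mult\<close>)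
      show ?thesis
      proof (rule Bochner_Integration.integrable_bound)
        show "integrable (lborel \<Otimes>\<^sub>M lborel) (\<lambda>x. C * norm v * (case x of (t, z) \<Rightarrow> indicator {0..h} t * (indicator (S K) z * u z)))"
          using I by (rule integrable_mult_right)
        have "\<bar>indicator {0..h} t * ((indicator (S K) z * u z) * d\<phi> (z - t *\<^sub>R v))\<bar>
            \<le> \<bar>C * norm v * (indicator {0..h} t * (indicator (S K) z * u z))\<bar>" for t z
          using mult_right_mono[OF C(3)[of "z - t *\<^sub>R v" v], of "\<bar>u z\<bar>"] C(1)
          by (auto simp: abs_mult mult.commute d\<phi>_def split: split_indicator)
        then show "AE x in lborel \<Otimes>\<^sub>M lborel. norm (case x of (t, z) \<Rightarrow> indicator {0..h} t * ((indicator (S K) z * u z) * d\<phi> (z - t *\<^sub>R v)))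
          \<le> norm (C * norm v * (case x of (t, z) \<Rightarrow> indicator {0..h} t * (indicator (S K) z * u z)))"
          by (intro AE_I2) auto
      qed measurable
    qed
    have A: "(LINT z|lborel. u (z + h *\<^sub>R v) * \<phi> z) = (LINT z|lborel. u z * \<phi> (z - h *\<^sub>R v))"
      using integral_lborel_translate[of "\<lambda>z. u z * \<phi> (z - h *\<^sub>R v)" "h *\<^sub>R v"] by simp
    have iA: "integrable lborel (\<lambda>z. u (z + h *\<^sub>R v) * \<phi> z)"
      using integrable_lborel_translate[of "\<lambda>z. u z * \<phi> (z - h *\<^sub>R v)" "h *\<^sub>R v"] i[of h] cut[of h] \<open>0 \<le> h\<close> by simp
    have iu\<phi>: "integrable lborel (\<lambda>z. u z * \<phi> (z - t *\<^sub>R v))" if "0 \<le> t" "t \<le> h" for t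
      unfolding cut[OF that] by (rule i)
    have iB: "integrable lborel (\<lambda>z. u z * \<phi> z)"
      using iu\<phi>[of 0] \<open>0 \<le> h\<close> by simp
    have Fsnd: "(LINT t|lborel. indicator {0..h} t * (g (z + t *\<^sub>R v) * \<phi> z)) = (LINT t|lborel. indicator {0..h} t * g (z + t *\<^sub>R v)) * \<phi> z" for z
      by (simp flip: mult.assoc)
    have iC: "integrable lborel (\<lambda>z. (LINT t|lborel. indicator {0..h} t * g (z + t *\<^sub>R v)) * \<phi> z)"
      using lborel_pair.integrable_snd[OF pg] by (simp add: eqg Fsnd)
    have "(LINT z|lborel. (LINT t|lborel. indicator {0..h} t * g (z + t *\<^sub>R v)) * \<phi> z)
        = (LINT z|lborel. LINT t|lborel. indicator {0..h} t * (g (z + t *\<^sub>R v) * \<phi> z))"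
      by (simp add: Fsnd)
    also have "\<dots> = (LINT t|lborel. LINT z|lborel. indicator {0..h} t * (g (z + t *\<^sub>R v) * \<phi> z))"
      using lborel_pair.Fubini_integral[OF pg] by (simp add: eqg)
    also have "\<dots> = (LINT t|lborel. LINT z|lborel. - (indicator {0..h} t * ((indicator (S K) z * u z) * d\<phi> (z - t *\<^sub>R v))))"
    proof (rule Bochner_Integration.integral_cong[OF refl])
      fix t :: real
      show "(LINT z|lborel. indicator {0..h} t * (g (z + t *\<^sub>R v) * \<phi> z))
          = (LINT z|lborel. - (indicator {0..h} t * ((indicator (S K) z * u z) * d\<phi> (z - t *\<^sub>R v))))"
      proof (cases "t \<in> {0..h}")
        case True
        have "(LINT z|lborel. g (z + t *\<^sub>R v) * \<phi> z) = (LINT z|lborel. g z * \<phi> (z - t *\<^sub>R v))"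
          using integral_lborel_translate[of "\<lambda>z. g z * \<phi> (z - t *\<^sub>R v)" "t *\<^sub>R v"] by simp
        also have "\<dots> = - (LINT z|lborel. u z * d\<phi> (z - t *\<^sub>R v))"
          using weak[OF tt, of t] True by (simp add: frechet_derivative_translate[OF K(1)] d\<phi>_def)
        also have "\<dots> = - (LINT z|lborel. (indicator (S K) z * u z) * d\<phi> (z - t *\<^sub>R v))"
          using True by (simp only: dcut atLeastAtMost_iff)
        finally show ?thesis using True by simp
      qed simp
    qed
    also have "\<dots> = - (LINT z|lborel. LINT t|lborel. indicator {0..h} t * ((indicator (S K) z * u z) * d\<phi> (z - t *\<^sub>R v)))"
      using lborel_pair.Fubini_integral[OF pu] by simp
    also have "\<dots> = (LINT z|lborel. - (LINT t|lborel. indicator {0..h} t * ((indicator (S K) z * u z) * d\<phi> (z - t *\<^sub>R v))))"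
      by (rule integral_minus[symmetric])
    also have "\<dots> = (LINT z|lborel. (indicator (S K) z * u z) * (\<phi> (z - h *\<^sub>R v) - \<phi> z))"
    proof (rule Bochner_Integration.integral_cong[OF refl])
      fix z
      have "(LINT t|lborel. indicator {0..h} t *\<^sub>R (- d\<phi> (z - t *\<^sub>R v))) = \<phi> (z - h *\<^sub>R v) - \<phi> (z - 0 *\<^sub>R v)"
      proof (rule integral_FTC_Icc[OF \<open>0 \<le> h\<close>])
        fix t
        have "((\<lambda>t. z - t *\<^sub>R v) has_derivative (\<lambda>r. - r *\<^sub>R v)) (at t within {0..h})"
          by (auto intro!: derivative_eq_intros)
        from has_derivative_compose[OF this smooth_has_derivative[OF K(1)]]
        have "((\<lambda>t. \<phi> (z - t *\<^sub>R v)) has_derivative (\<lambda>r. frechet_derivative \<phi> (at (z - t *\<^sub>R v)) (- r *\<^sub>R v))) (at t within {0..h})" .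
        moreover have "frechet_derivative \<phi> (at (z - t *\<^sub>R v)) (- r *\<^sub>R v) = r *\<^sub>R (- d\<phi> (z - t *\<^sub>R v))" for r
          using linear_cmul[OF has_derivative_linear[OF smooth_has_derivative[OF K(1)]], of "z - t *\<^sub>R v" "- r" v]
          by (simp add: d\<phi>_def)
        ultimately show "((\<lambda>t. \<phi> (z - t *\<^sub>R v)) has_vector_derivative - d\<phi> (z - t *\<^sub>R v)) (at t within {0..h})"
          by (simp add: has_vector_derivative_def)
      next
        show "continuous_on {0..h} (\<lambda>t. - d\<phi> (z - t *\<^sub>R v))"
          unfolding d\<phi>_def
          by (intro continuous_on_minus continuous_on_compose2[OF smooth_continuous[OF smooth_frechet[OF K(1)], of UNIV]] continuous_intros) auto
      qed
      then have "(LINT t|lborel. indicator {0..h} t * d\<phi> (z - t *\<^sub>R v)) = - (\<phi> (z - h *\<^sub>R v) - \<phi> z)" by simp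
      moreover have "(LINT t|lborel. indicator {0..h} t * ((indicator (S K) z * u z) * d\<phi> (z - t *\<^sub>R v)))
          = (indicator (S K) z * u z) * (LINT t|lborel. indicator {0..h} t * d\<phi> (z - t *\<^sub>R v))"
        unfolding integral_mult_right_zero[symmetric] by (simp only: mult.left_commute)
      ultimately show "- (LINT t|lborel. indicator {0..h} t * ((indicator (S K) z * u z) * d\<phi> (z - t *\<^sub>R v)))
          = (indicator (S K) z * u z) * (\<phi> (z - h *\<^sub>R v) - \<phi> z)" by (simp only: mult_minus_right minus_minus)
    qed
    also have "\<dots> = (LINT z|lborel. u z * \<phi> (z - h *\<^sub>R v) - u z * \<phi> z)"
      using cut[OF \<open>0 \<le> h\<close> order_refl] cut[OF order_refl \<open>0 \<le> h\<close>]
      by (simp only: right_diff_distrib scaleR_zero_left diff_zero)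
    also have "\<dots> = (LINT z|lborel. u z * \<phi> (z - h *\<^sub>R v)) - (LINT z|lborel. u z * \<phi> z)"
      using iu\<phi>[of h] iB \<open>0 \<le> h\<close> by simp
    finally show "(LINT z|lborel. k z * \<phi> z) = 0"
      using iA iB iC A by (simp add: k_def left_diff_distrib)
  qed measurable
  then show ?thesis
    by eventually_elim (simp add: k_def set_lebesgue_integral_def)
qed

section \<open>Traces\<close>

lemma measurable_fst_borel [measurable]: "(fst :: 'a::euclidean_space \<times> 'b::euclidean_space \<Rightarrow> 'a) \<in> borel_measurable borel"
  and measurable_snd_borel [measurable]: "(snd :: 'a::euclidean_space \<times> 'b::euclidean_space \<Rightarrow> 'b) \<in> borel_measurable borel"
  by (intro borel_measurable_continuous_onI continuous_intros)+

lemma measurable_indicator_slab [measurable]: "slab Y \<in> sets borel" "halfspace \<in> sets borel"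
  by simp_all

lemma AE_lborel_fst:
  assumes "AE z in (lborel :: ('a::euclidean_space \<times> 'b::euclidean_space) measure). P z"
  shows "AE x in lborel. AE y in lborel. P (x, y)"
  using lborel_pair.AE_pair[of P, unfolded lborel_prod, OF assms] .

lemma AE_lborel_snd:
  assumes "AE z in (lborel :: ('a::euclidean_space \<times> 'b::euclidean_space) measure). P z"
  shows "AE y in lborel. AE x in lborel. P (x, y)"
proof -
  have "AE z in distr (lborel \<Otimes>\<^sub>M lborel) (lborel \<Otimes>\<^sub>M lborel) (\<lambda>(x, y). (y, x)). P z"
    using assms lborel_pair.distr_pair_swap by (metis lborel_prod)
  then have "AE w in (lborel \<Otimes>\<^sub>M lborel). P (case w of (x, y) \<Rightarrow> (y, x))"
    by (rule AE_distrD[rotated]) measurable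
  from lborel_pair.AE_pair[OF this] show ?thesis by simp
qed

lemma AE_lborel_intro:
  fixes P :: "'a::euclidean_space \<times> 'b::euclidean_space \<Rightarrow> bool"
  assumes "Measurable.pred borel P" "AE x in lborel. AE y in lborel. P (x, y)"
  shows "AE z in lborel. P z"
proof -
  have "sets (lborel \<Otimes>\<^sub>M lborel :: ('a \<times> 'b) measure) = sets borel"
    by (simp only: lborel_prod sets_lborel)
  then have "{z \<in> space (lborel \<Otimes>\<^sub>M lborel). P z} \<in> sets (lborel \<Otimes>\<^sub>M lborel)"
    using assms(1) by (simp only: pred_def space_pair_measure space_lborel space_borel UNIV_Times_UNIV)
  from lborel_pair.AE_pair_measure[OF this assms(2)] show ?thesis unfolding lborel_prod .
qed

lemma AE_obtain_between:
  assumes "AE y in lborel. Q y" "a < (b::real)"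
  shows "\<exists>y. a < y \<and> y < b \<and> Q y"
proof (rule ccontr)
  assume "\<not> ?thesis"
  then have "AE y in lborel. y \<notin> {a<..<b}" using assms(1) by (auto elim: eventually_mono)
  then have "{a<..<b} \<in> null_sets lborel" by (subst AE_iff_null_sets) auto
  then show False using assms(2) by (auto simp: null_sets_def)
qed

lemma nn_integral_lborel_prod_iterated:
  fixes f :: "'a::euclidean_space \<times> 'b::euclidean_space \<Rightarrow> ennreal"
  assumes [measurable]: "f \<in> borel_measurable borel"
  shows "(\<integral>\<^sup>+x. \<integral>\<^sup>+y. f (x, y) \<partial>lborel \<partial>lborel) = (\<integral>\<^sup>+z. f z \<partial>lborel)"
  using lborel.nn_integral_fst[of f lborel] by (simp add: lborel_prod)

lemma nn_integral_powr_0: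
  assumes "\<gamma> < 1" "0 \<le> y"
  shows "(\<integral>\<^sup>+t. ennreal (indicator {0<..<y} t * t powr (-\<gamma>)) \<partial>lborel) = ennreal (y powr (1 - \<gamma>) / (1 - \<gamma>))"
proof -
  have "((\<lambda>t. t powr (-\<gamma>)) has_integral (y powr (1 - \<gamma>) / (1 - \<gamma>))) {0..y}"
    using has_integral_powr_from_0[of "-\<gamma>" y] assms by simp
  then have "((\<lambda>t. indicator {0..y} t * t powr (-\<gamma>)) has_integral (y powr (1 - \<gamma>) / (1 - \<gamma>))) UNIV"
    unfolding has_integral_restrict_UNIV[symmetric, of "\<lambda>t. t powr (-\<gamma>)" _ "{0..y}"]
    by (rule has_integral_eq[rotated]) (auto split: split_indicator)
  then have "(\<integral>\<^sup>+t. ennreal (indicator {0..y} t * t powr (-\<gamma>)) \<partial>lborel) = ennreal (y powr (1 - \<gamma>) / (1 - \<gamma>))"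
    by (intro nn_integral_has_integral_lborel) auto
  moreover have "AE t in lborel. t \<noteq> 0 \<and> t \<noteq> y"
    using AE_lborel_singleton[of "0::real"] AE_lborel_singleton[of y] by eventually_elim auto
  then have "(\<integral>\<^sup>+t. ennreal (indicator {0..y} t * t powr (-\<gamma>)) \<partial>lborel)
     = (\<integral>\<^sup>+t. ennreal (indicator {0<..<y} t * t powr (-\<gamma>)) \<partial>lborel)"
    by (intro nn_integral_cong_AE, elim eventually_mono) (auto split: split_indicator)
  ultimately show ?thesis by simp
qed

text \<open>
  The integrand is split as \<open>t\<^bsup>-\<gamma>/2\<^esup> \<cdot> t\<^bsup>\<gamma>/2\<^esup> \<bar>p\<bar>\<close>, where the square of the first factor is integrable at 0
  because \<open>\<gamma> < 1\<close>.
\<close>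

lemma weighted_Cauchy_Schwarz:
  fixes p :: "real \<Rightarrow> real"
  assumes [measurable]: "p \<in> borel_measurable borel" and "\<gamma> < 1" "0 \<le> y"
  shows "(\<integral>\<^sup>+t. ennreal (indicator {0<..<y} t * \<bar>p t\<bar>) \<partial>lborel)\<^sup>2
    \<le> ennreal (y powr (1 - \<gamma>) / (1 - \<gamma>)) * (\<integral>\<^sup>+t. ennreal (indicator {0<..<y} t * (t powr \<gamma> * (p t)\<^sup>2)) \<partial>lborel)"
proof -
  let ?f = "\<lambda>t. ennreal (indicator {0<..<y} t * t powr (-\<gamma>/2))"
  let ?g = "\<lambda>t. ennreal (indicator {0<..<y} t * (t powr (\<gamma>/2) * \<bar>p t\<bar>))"
  have eq: "(\<integral>\<^sup>+t. ennreal (indicator {0<..<y} t * \<bar>p t\<bar>) \<partial>lborel) = (\<integral>\<^sup>+t. ?f t * ?g t \<partial>lborel)"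
  proof (rule nn_integral_cong)
    fix t :: real
    have "t powr (-\<gamma>/2) * t powr (\<gamma>/2) = 1" if "0 < t" using that by (simp add: powr_add[symmetric])
    then show "ennreal (indicator {0<..<y} t * \<bar>p t\<bar>) = ?f t * ?g t"
      by (auto simp: ennreal_mult'[symmetric] split: split_indicator simp flip: mult.assoc)
  qed
  have cs: "(\<integral>\<^sup>+t. ?f t * ?g t \<partial>lborel)\<^sup>2 \<le> (\<integral>\<^sup>+t. ?f t ^ 2 \<partial>lborel) * (\<integral>\<^sup>+t. ?g t ^ 2 \<partial>lborel)"
    by (rule Cauchy_Schwarz_nn_integral) auto
  have "(\<integral>\<^sup>+t. ?f t ^ 2 \<partial>lborel) = (\<integral>\<^sup>+t. ennreal (indicator {0<..<y} t * t powr (-\<gamma>)) \<partial>lborel)"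
  proof (rule nn_integral_cong)
    fix t :: real
    have "(t powr (-\<gamma>/2))\<^sup>2 = t powr (-\<gamma>)" by (simp add: power2_eq_square powr_add[symmetric])
    then show "?f t ^ 2 = ennreal (indicator {0<..<y} t * t powr (-\<gamma>))"
      by (auto simp: ennreal_power split: split_indicator)
  qed
  also have "\<dots> = ennreal (y powr (1 - \<gamma>) / (1 - \<gamma>))"
    by (rule nn_integral_powr_0) (use assms in auto)
  finally have f2: "(\<integral>\<^sup>+t. ?f t ^ 2 \<partial>lborel) = ennreal (y powr (1 - \<gamma>) / (1 - \<gamma>))" .
  have g2: "(\<integral>\<^sup>+t. ?g t ^ 2 \<partial>lborel) = (\<integral>\<^sup>+t. ennreal (indicator {0<..<y} t * (t powr \<gamma> * (p t)\<^sup>2)) \<partial>lborel)"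
  proof (rule nn_integral_cong)
    fix t :: real
    have "(t powr (\<gamma>/2))\<^sup>2 = t powr \<gamma>" by (simp add: power2_eq_square powr_add[symmetric])
    then show "?g t ^ 2 = ennreal (indicator {0<..<y} t * (t powr \<gamma> * (p t)\<^sup>2))"
      by (auto simp: ennreal_power power_mult_distrib split: split_indicator)
  qed
  show ?thesis using cs unfolding eq f2 g2 .
qed

definition vertical_integral :: "('a \<times> real \<Rightarrow> real) \<Rightarrow> 'a \<times> real \<Rightarrow> real" where
  "vertical_integral p z = (LINT t|lborel. (if 0 < t \<and> t < snd z then p (fst z, t) else 0))"

lemma measurable_Pair_borel [measurable (raw)]:
  fixes f :: "'c \<Rightarrow> 'a::euclidean_space" and g :: "'c \<Rightarrow> 'b::euclidean_space"
  assumes "f \<in> M \<rightarrow>\<^sub>M borel" "g \<in> M \<rightarrow>\<^sub>M borel"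
  shows "(\<lambda>x. (f x, g x)) \<in> borel_measurable M"
  using assms by (rule borel_measurable_Pair)

lemma measurable_vertical_integral [measurable]:
  fixes p :: "'a::euclidean_space \<times> real \<Rightarrow> real"
  assumes [measurable]: "p \<in> borel_measurable borel"
  shows "vertical_integral p \<in> borel_measurable borel"
  unfolding vertical_integral_def[abs_def] by measurable

lemma vertical_integral_square_le:
  fixes p :: "'a::euclidean_space \<times> real \<Rightarrow> real"
  assumes [measurable]: "p \<in> borel_measurable borel" and "\<gamma> < 1" "0 \<le> y"
  shows "ennreal ((vertical_integral p (x, y))\<^sup>2)
    \<le> ennreal (y powr (1 - \<gamma>) / (1 - \<gamma>)) * (\<integral>\<^sup>+t. ennreal (indicator {0<..<y} t * (t powr \<gamma> * (p (x, t))\<^sup>2)) \<partial>lborel)"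
proof -
  let ?q = "\<lambda>t. if 0 < t \<and> t < y then p (x, t) else 0"
  have "ennreal \<bar>vertical_integral p (x, y)\<bar> \<le> (\<integral>\<^sup>+t. ennreal \<bar>?q t\<bar> \<partial>lborel)"
  proof (cases "integrable lborel ?q")
    case True
    from integral_norm_bound_ennreal[OF True] show ?thesis by (simp add: vertical_integral_def cong: if_cong)
  next
    case False
    then show ?thesis by (simp add: vertical_integral_def not_integrable_integral_eq cong: if_cong)
  qed
  also have "\<dots> = (\<integral>\<^sup>+t. ennreal (indicator {0<..<y} t * \<bar>p (x, t)\<bar>) \<partial>lborel)"
    by (intro nn_integral_cong) (auto split: split_indicator)
  finally have "(ennreal \<bar>vertical_integral p (x, y)\<bar>)\<^sup>2 \<le> (\<integral>\<^sup>+t. ennreal (indicator {0<..<y} t * \<bar>p (x, t)\<bar>) \<partial>lborel)\<^sup>2"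
    by (rule power_mono) simp
  also have "\<dots> \<le> ennreal (y powr (1 - \<gamma>) / (1 - \<gamma>)) * (\<integral>\<^sup>+t. ennreal (indicator {0<..<y} t * (t powr \<gamma> * (p (x, t))\<^sup>2)) \<partial>lborel)"
    by (rule weighted_Cauchy_Schwarz) (use assms in auto)
  finally show ?thesis by (simp add: ennreal_power)
qed

lemma slab_Pair_iff: "(x, y) \<in> slab Y \<longleftrightarrow> 0 < y \<and> y < Y"
  and slab_iff: "z \<in> slab Y \<longleftrightarrow> 0 < snd z \<and> snd z < Y" and halfspace_iff: "z \<in> halfspace \<longleftrightarrow> 0 < snd z"
  by (auto simp: slab_def halfspace_def mem_Times_iff)

lemma finite_weighted_slice:
  fixes p :: "'a::euclidean_space \<times> real \<Rightarrow> real"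
  assumes [measurable]: "p \<in> borel_measurable borel" and \<gamma>: "\<gamma> < 1" and Y: "0 \<le> Y"
    and fin: "(\<integral>\<^sup>+t. ennreal (indicator {0<..<Y} t * (t powr \<gamma> * (p (x, t))\<^sup>2)) \<partial>lborel) < \<infinity>"
  shows "integrable lborel (\<lambda>t. indicator {0<..<Y} t * p (x, t))"
proof (rule integrableI_bounded)
  let ?I = "\<integral>\<^sup>+t. ennreal (indicator {0<..<Y} t * \<bar>p (x, t)\<bar>) \<partial>lborel"
  have "?I\<^sup>2 \<le> ennreal (Y powr (1 - \<gamma>) / (1 - \<gamma>)) * (\<integral>\<^sup>+t. ennreal (indicator {0<..<Y} t * (t powr \<gamma> * (p (x, t))\<^sup>2)) \<partial>lborel)"
    by (rule weighted_Cauchy_Schwarz) (use assms in auto)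
  also have "\<dots> < \<infinity>" using fin by (simp add: ennreal_mult_less_top)
  finally have "?I \<noteq> \<infinity>" by (auto simp: power2_eq_square)
  moreover have "(\<integral>\<^sup>+t. ennreal (norm (indicator {0<..<Y} t * p (x, t))) \<partial>lborel) = ?I"
    by (intro nn_integral_cong) (auto simp: abs_mult)
  ultimately show "(\<integral>\<^sup>+t. ennreal (norm (indicator {0<..<Y} t * p (x, t))) \<partial>lborel) < \<infinity>"
    by (simp add: top.not_eq_extremum)
qed measurable

lemma vertical_derivative_energy:
  fixes G :: "'a::euclidean_space \<times> real \<Rightarrow> 'a \<times> real"
  assumes pG: "AE z in lborel. z \<in> slab Y \<longrightarrow> p z = G z \<bullet> (0, 1)"
  shows "(\<integral>\<^sup>+z. ennreal (indicator (slab Y) z * (snd z powr \<alpha> * (p z)\<^sup>2)) \<partial>lborel)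
    \<le> (\<integral>\<^sup>+z. ennreal (indicator (slab Y) z * (snd z powr \<alpha> * (norm (G z))\<^sup>2)) \<partial>lebesgue)"
  unfolding nn_integral_completion
proof (rule nn_integral_mono_AE)
  have le: "(G z \<bullet> (0, 1))\<^sup>2 \<le> (norm (G z))\<^sup>2" for z
  proof -
    have "\<bar>G z \<bullet> (0, 1)\<bar> \<le> norm (G z)" using Cauchy_Schwarz_ineq2[of "G z" "(0, 1)"] by (simp add: norm_Pair)
    then show ?thesis by (simp add: abs_le_square_iff[symmetric])
  qed
  show "AE z in lborel. ennreal (indicator (slab Y) z * (snd z powr \<alpha> * (p z)\<^sup>2))
      \<le> ennreal (indicator (slab Y) z * (snd z powr \<alpha> * (norm (G z))\<^sup>2))"
    using pG by eventually_elim (auto split: split_indicator intro!: ennreal_leI mult_left_mono le)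
qed

text \<open>
  On almost every vertical line the difference formula holds for almost every pair of heights.
  Therefore the function minus the vertical primitive of its vertical derivative is constant on almost
  every line, and its average over the line provides a measurable choice of that constant.
\<close>

lemma vertical_representation:
  fixes U :: "'a::euclidean_space \<times> real \<Rightarrow> real"
  assumes U: "has_weak_gradient_on U G (slab Y)" and "0 < Y" "\<alpha> < 1"
    and fin: "set_integrable lebesgue (slab Y) (\<lambda>z. snd z powr \<alpha> * (norm (G z))\<^sup>2)"
  shows "\<exists>u p c. u \<in> borel_measurable borel \<and> p \<in> borel_measurable borel \<and> c \<in> borel_measurable borel \<and>
    (AE z in lborel. z \<in> slab Y \<longrightarrow> u z = U z) \<and> (AE z in lborel. z \<in> slab Y \<longrightarrow> p z = G z \<bullet> (0, 1)) \<and>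
    (AE z in lborel. z \<in> slab Y \<longrightarrow> u z = c (fst z) + vertical_integral p z)"
proof -
  obtain u p where m[measurable]: "u \<in> borel_measurable borel" "p \<in> borel_measurable borel"
    and uU: "AE z in lborel. z \<in> slab Y \<longrightarrow> u z = U z"
    and pG: "AE z in lborel. z \<in> slab Y \<longrightarrow> p z = G z \<bullet> (0, 1)"
    using has_weak_gradient_borelE[OF open_slab U, of "(0, 1)"] by blast
  have pfin: "(\<integral>\<^sup>+z. ennreal (indicator (slab Y) z * (snd z powr \<alpha> * (p z)\<^sup>2)) \<partial>lborel) < \<infinity>"
  proof -
    have "(\<integral>\<^sup>+z. ennreal (norm (indicator (slab Y) z *\<^sub>R (snd z powr \<alpha> * (norm (G z))\<^sup>2))) \<partial>lebesgue) < \<infinity>"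
      using fin unfolding set_integrable_def integrable_iff_bounded by blast
    then show ?thesis
      using vertical_derivative_energy[OF pG, of \<alpha>] by (simp add: abs_mult le_less_trans)
  qed
  have "AE x in lborel. (\<integral>\<^sup>+t. ennreal (indicator {0<..<Y} t * (t powr \<alpha> * (p (x, t))\<^sup>2)) \<partial>lborel) \<noteq> \<infinity>"
  proof (rule nn_integral_PInf_AE)
    have "(\<integral>\<^sup>+x. \<integral>\<^sup>+t. ennreal (indicator {0<..<Y} t * (t powr \<alpha> * (p (x, t))\<^sup>2)) \<partial>lborel \<partial>lborel)
      = (\<integral>\<^sup>+z. ennreal (indicator (slab Y) z * (snd z powr \<alpha> * (p z)\<^sup>2)) \<partial>lborel)"
      by (subst nn_integral_lborel_prod_iterated[symmetric])
        (auto intro!: nn_integral_cong simp: slab_Pair_iff split: split_indicator)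
    with pfin show "(\<integral>\<^sup>+x. \<integral>\<^sup>+t. ennreal (indicator {0<..<Y} t * (t powr \<alpha> * (p (x, t))\<^sup>2)) \<partial>lborel \<partial>lborel) \<noteq> \<infinity>" by simp
  qed measurable
  then have int: "AE x in lborel. integrable lborel (\<lambda>t. indicator {0<..<Y} t * p (x, t))"
    by eventually_elim (rule finite_weighted_slice[OF m(2) \<open>\<alpha> < 1\<close>], use \<open>0 < Y\<close> in \<open>auto simp: top.not_eq_extremum\<close>)
  define D where "D h z = (LINT t|lborel. (if 0 \<le> t \<and> t \<le> h then p (z + t *\<^sub>R (0, 1)) else 0))" for h :: real and z
  define P where "P h z \<longleftrightarrow> (0 < h \<and> 0 < snd z \<and> snd z + h < Y \<longrightarrow> u (z + h *\<^sub>R (0, 1)) - u z = D h z)" for h z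
  have Dm[measurable]: "(\<lambda>w. D (fst w) (snd w)) \<in> borel_measurable (lborel \<Otimes>\<^sub>M lborel)"
    unfolding D_def by measurable
  have Pm: "{w \<in> space (lborel \<Otimes>\<^sub>M lborel). P (fst w) (snd w)} \<in> sets (lborel \<Otimes>\<^sub>M lborel)"
    unfolding P_def by measurable
  have "AE z in lborel. P h z" for h
  proof (cases "0 < h")
    case True
    have "AE z in lborel. z \<in> slab (Y - h) \<longrightarrow> u (z + h *\<^sub>R (0, 1)) - u z = (LINT t:{0..h}|lborel. p (z + t *\<^sub>R (0, 1)))"
      by (rule weak_difference_formula[OF open_slab U m uU pG open_slab]) (use True in \<open>auto simp: slab_iff\<close>)
    moreover have "(LINT t:{0..h}|lborel. p (z + t *\<^sub>R (0, 1))) = D h z" for z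
      unfolding set_lebesgue_integral_def D_def by (intro Bochner_Integration.integral_cong refl) (auto split: split_indicator)
    ultimately show ?thesis by (auto elim!: eventually_mono simp: P_def slab_iff)
  qed (simp add: P_def)
  then have "AE h in lborel. AE z in lborel. P h z" by simp
  then have "AE z in lborel. AE h in lborel. P h z"
    by (subst lborel_pair.AE_commute[OF Pm, symmetric])
  from AE_lborel_fst[OF this] have "AE x in lborel. AE y in lborel. AE h in lborel. P h (x, y)" .
  with int have line: "AE x in lborel. \<exists>k. AE y in lborel. 0 < y \<and> y < Y \<longrightarrow> u (x, y) - vertical_integral p (x, y) = k"
  proof eventually_elim
    fix x assume I: "integrable lborel (\<lambda>t. indicator {0<..<Y} t * p (x, t))"
      and ae: "AE y in lborel. AE h in lborel. P h (x, y)"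
    have vi: "integrable lborel (\<lambda>t. if 0 < t \<and> t < y then p (x, t) else 0)" if "y \<le> Y" for y
      by (rule Bochner_Integration.integrable_bound[OF I]) (use that in \<open>auto split: split_indicator\<close>)
    have diff: "u (x, y') - vertical_integral p (x, y') = u (x, y) - vertical_integral p (x, y)"
      if "P (y' - y) (x, y)" "0 < y" "y < y'" "y' < Y" for y y'
    proof -
      have "D (y' - y) (x, y) = (LINT t|lborel. (if y \<le> t \<and> t \<le> y' then p (x, t) else 0))"
        using integral_lborel_translate[of "\<lambda>t. if y \<le> t \<and> t \<le> y' then p (x, t) else 0" y]
        unfolding D_def by (simp add: add.commute le_diff_eq cong: if_cong)
      also have "\<dots> = (LINT t|lborel. (if 0 < t \<and> t < y' then p (x, t) else 0) - (if 0 < t \<and> t < y then p (x, t) else 0))"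
      proof (rule integral_cong_AE)
        show "AE t in lborel. (if y \<le> t \<and> t \<le> y' then p (x, t) else 0)
            = (if 0 < t \<and> t < y' then p (x, t) else 0) - (if 0 < t \<and> t < y then p (x, t) else 0)"
          using AE_lborel_singleton[of y'] by eventually_elim (use that in auto)
      qed measurable
      also have "\<dots> = vertical_integral p (x, y') - vertical_integral p (x, y)"
        using vi[of y'] vi[of y] that by (simp add: vertical_integral_def cong: if_cong)
      finally show ?thesis using that by (simp add: P_def)
    qed
    let ?S = "\<lambda>y y'. 0 < y \<and> y < y' \<and> y' < Y \<longrightarrow> u (x, y') - vertical_integral p (x, y') = u (x, y) - vertical_integral p (x, y)"
    have up: "AE y in lborel. AE y' in lborel. ?S y y'"
      using ae
    proof eventually_elim
      fix y assume "AE h in lborel. P h (x, y)"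
      from AE_lborel_translate[OF this, of "-y"] show "AE y' in lborel. ?S y y'"
        by eventually_elim (use diff in auto)
    qed
    have "{w \<in> space (lborel \<Otimes>\<^sub>M lborel). ?S (fst w) (snd w)} \<in> sets (lborel \<Otimes>\<^sub>M lborel)"
    proof -
      define q where "q y = u (x, y) - vertical_integral p (x, y)" for y
      have [measurable]: "q \<in> borel_measurable borel" unfolding q_def by measurable
      show ?thesis unfolding q_def[symmetric] by measurable
    qed
    from lborel_pair.AE_commute[OF this] up have down: "AE y' in lborel. AE y in lborel. ?S y y'" by (rule iffD1)
    from up down have "AE y in lborel. (AE y' in lborel. ?S y y') \<and> (AE y' in lborel. ?S y' y)"
      by (rule eventually_conj)
    \<comment> \<open>Almost every height serves as the reference height of this line.\<close>
    from AE_obtain_between[OF this \<open>0 < Y\<close>] obtain y0 where y0: "0 < y0" "y0 < Y"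
      "AE y' in lborel. ?S y0 y'" "AE y' in lborel. ?S y' y0" by (elim exE conjE)
    from y0(3,4) have "AE y in lborel. 0 < y \<and> y < Y \<longrightarrow> u (x, y) - vertical_integral p (x, y) = u (x, y0) - vertical_integral p (x, y0)"
      by eventually_elim (use y0(1,2) in \<open>smt (verit)\<close>)
    then show "\<exists>k. AE y in lborel. 0 < y \<and> y < Y \<longrightarrow> u (x, y) - vertical_integral p (x, y) = k" by blast
  qed
  define c where "c x = (LINT y|lborel. (if 0 < y \<and> y < Y then u (x, y) - vertical_integral p (x, y) else 0)) / Y" for x
  have [measurable]: "c \<in> borel_measurable borel"
    unfolding c_def[abs_def] by measurable
  have "AE x in lborel. AE y in lborel. (x, y) \<in> slab Y \<longrightarrow> u (x, y) = c (fst (x, y)) + vertical_integral p (x, y)"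
    using line
  proof eventually_elim
    fix x assume "\<exists>k. AE y in lborel. 0 < y \<and> y < Y \<longrightarrow> u (x, y) - vertical_integral p (x, y) = k"
    then obtain k where k: "AE y in lborel. 0 < y \<and> y < Y \<longrightarrow> u (x, y) - vertical_integral p (x, y) = k" by blast
    have "(LINT y|lborel. (if 0 < y \<and> y < Y then u (x, y) - vertical_integral p (x, y) else 0))
        = (LINT y|lborel. k * indicator {0<..<Y} y)"
      by (intro integral_cong_AE) (use k in \<open>auto elim!: eventually_mono split: split_indicator\<close>)
    also have "\<dots> = k * Y" using \<open>0 < Y\<close> by simp
    finally have "c x = k" using \<open>0 < Y\<close> by (simp add: c_def)
    with k show "AE y in lborel. (x, y) \<in> slab Y \<longrightarrow> u (x, y) = c (fst (x, y)) + vertical_integral p (x, y)"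
      by (auto elim!: eventually_mono simp: slab_Pair_iff)
  qed
  then have "AE z in lborel. z \<in> slab Y \<longrightarrow> u z = c (fst z) + vertical_integral p z"
    by (intro AE_lborel_intro) auto
  then show ?thesis using uU pG m by (intro exI[of _ u] exI[of _ p] exI[of _ c]) auto
qed

text \<open>
  The slice at height \<open>y\<close> differs from \<open>c\<close> by a vertical primitive, whose square is at most a
  multiple of \<open>y\<^bsup>1 - \<alpha>\<^esup>\<close> times the weighted energy of the line.
\<close>

lemma has_trace0_representation:
  fixes U :: "'a::euclidean_space \<times> real \<Rightarrow> real"
  assumes m[measurable]: "u \<in> borel_measurable borel" "p \<in> borel_measurable borel" "c \<in> borel_measurable borel"
    and uU: "AE z in lborel. z \<in> slab Y \<longrightarrow> u z = U z"
    and rep: "AE z in lborel. z \<in> slab Y \<longrightarrow> u z = c (fst z) + vertical_integral p z"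
    and fin: "(\<integral>\<^sup>+z. ennreal (indicator (slab Y) z * (snd z powr \<alpha> * (p z)\<^sup>2)) \<partial>lborel) < \<infinity>"
    and "0 < Y" and \<alpha>: "\<alpha> < 1"
  shows "has_trace0 U c"
  unfolding has_trace0_def
proof (intro conjI allI impI)
  show "c \<in> borel_measurable lebesgue" by (rule borel_imp_lebesgue) simp
  fix R \<epsilon> :: real assume "0 < \<epsilon>"
  define M where "M = (\<integral>\<^sup>+z. ennreal (indicator (slab Y) z * (snd z powr \<alpha> * (p z)\<^sup>2)) \<partial>lborel)"
  obtain m where m: "M = ennreal m" "0 \<le> m" using fin unfolding M_def[symmetric] by (cases M) auto
  have "((\<lambda>y. y powr (1 - \<alpha>) / (1 - \<alpha>) * m) \<longlongrightarrow> 0 powr (1 - \<alpha>) / (1 - \<alpha>) * m) (at_right 0)"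
    using \<alpha> by (intro tendsto_intros tendsto_powr') (auto simp: eventually_at_filter)
  then have "\<forall>\<^sub>F y in at_right 0. y powr (1 - \<alpha>) / (1 - \<alpha>) * m < \<epsilon>"
    using \<open>0 < \<epsilon>\<close> by (intro order_tendstoD) auto
  then obtain b where b: "0 < b" "\<And>y. 0 < y \<Longrightarrow> y < b \<Longrightarrow> y powr (1 - \<alpha>) / (1 - \<alpha>) * m < \<epsilon>"
    by (auto simp: eventually_at_right_field)
  have "AE z in lborel. z \<in> slab Y \<longrightarrow> U z - c (fst z) = vertical_integral p z"
    using uU rep by eventually_elim auto
  from AE_lborel_snd[OF this]
  have ae: "AE y in lborel. AE x in lborel. 0 < y \<and> y < Y \<longrightarrow> U (x, y) - c x = vertical_integral p (x, y)"
    by (simp add: slab_Pair_iff)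
  have "AE y in lborel. 0 < y \<and> y < min b Y \<longrightarrow> (\<integral>\<^sup>+x\<in>ball 0 R. ennreal ((U (x, y) - c x)\<^sup>2) \<partial>lebesgue) < ennreal \<epsilon>"
    using ae
  proof eventually_elim
    fix y assume ae: "AE x in lborel. 0 < y \<and> y < Y \<longrightarrow> U (x, y) - c x = vertical_integral p (x, y)"
    show "0 < y \<and> y < min b Y \<longrightarrow> (\<integral>\<^sup>+x\<in>ball 0 R. ennreal ((U (x, y) - c x)\<^sup>2) \<partial>lebesgue) < ennreal \<epsilon>"
    proof
      assume y: "0 < y \<and> y < min b Y"
      have "(\<integral>\<^sup>+x\<in>ball 0 R. ennreal ((U (x, y) - c x)\<^sup>2) \<partial>lebesgue)
        \<le> (\<integral>\<^sup>+x. ennreal (y powr (1 - \<alpha>) / (1 - \<alpha>)) * (\<integral>\<^sup>+t. ennreal (indicator {0<..<Y} t * (t powr \<alpha> * (p (x, t))\<^sup>2)) \<partial>lborel) \<partial>lborel)"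
        unfolding nn_integral_completion
      proof (rule nn_integral_mono_AE)
        show "AE x in lborel. ennreal ((U (x, y) - c x)\<^sup>2) * indicator (ball 0 R) x
          \<le> ennreal (y powr (1 - \<alpha>) / (1 - \<alpha>)) * (\<integral>\<^sup>+t. ennreal (indicator {0<..<Y} t * (t powr \<alpha> * (p (x, t))\<^sup>2)) \<partial>lborel)"
          using ae
        proof eventually_elim
          fix x assume "0 < y \<and> y < Y \<longrightarrow> U (x, y) - c x = vertical_integral p (x, y)"
          then have "ennreal ((U (x, y) - c x)\<^sup>2) * indicator (ball 0 R) x \<le> ennreal ((vertical_integral p (x, y))\<^sup>2)"
            using y by (auto split: split_indicator)
          also have "\<dots> \<le> ennreal (y powr (1 - \<alpha>) / (1 - \<alpha>)) * (\<integral>\<^sup>+t. ennreal (indicator {0<..<y} t * (t powr \<alpha> * (p (x, t))\<^sup>2)) \<partial>lborel)"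
            by (rule vertical_integral_square_le) (use y \<alpha> in auto)
          also have "\<dots> \<le> ennreal (y powr (1 - \<alpha>) / (1 - \<alpha>)) * (\<integral>\<^sup>+t. ennreal (indicator {0<..<Y} t * (t powr \<alpha> * (p (x, t))\<^sup>2)) \<partial>lborel)"
            by (intro mult_left_mono nn_integral_mono ennreal_leI) (use y in \<open>auto split: split_indicator\<close>)
          finally show "ennreal ((U (x, y) - c x)\<^sup>2) * indicator (ball 0 R) x
            \<le> ennreal (y powr (1 - \<alpha>) / (1 - \<alpha>)) * (\<integral>\<^sup>+t. ennreal (indicator {0<..<Y} t * (t powr \<alpha> * (p (x, t))\<^sup>2)) \<partial>lborel)" .
        qed
      qed
      also have "\<dots> = ennreal (y powr (1 - \<alpha>) / (1 - \<alpha>)) * (\<integral>\<^sup>+x. \<integral>\<^sup>+t. ennreal (indicator {0<..<Y} t * (t powr \<alpha> * (p (x, t))\<^sup>2)) \<partial>lborel \<partial>lborel)"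
        by (rule nn_integral_cmult) measurable
      also have "(\<integral>\<^sup>+x. \<integral>\<^sup>+t. ennreal (indicator {0<..<Y} t * (t powr \<alpha> * (p (x, t))\<^sup>2)) \<partial>lborel \<partial>lborel) = M"
        unfolding M_def
        by (subst nn_integral_lborel_prod_iterated[symmetric])
          (auto intro!: nn_integral_cong simp: slab_Pair_iff split: split_indicator)
      also have "ennreal (y powr (1 - \<alpha>) / (1 - \<alpha>)) * M = ennreal (y powr (1 - \<alpha>) / (1 - \<alpha>) * m)"
        unfolding m(1) by (rule ennreal_mult[symmetric]) (use \<alpha> m(2) in auto)
      also have "\<dots> < ennreal \<epsilon>"
        using b(2)[of y] y \<open>0 < \<epsilon>\<close> by (intro ennreal_lessI) auto
      finally show "(\<integral>\<^sup>+x\<in>ball 0 R. ennreal ((U (x, y) - c x)\<^sup>2) \<partial>lebesgue) < ennreal \<epsilon>" .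
    qed
  qed
  from AE_completion[OF this] show "\<exists>\<delta>>0. AE y in lebesgue. 0 < y \<and> y < \<delta> \<longrightarrow> (\<integral>\<^sup>+x\<in>ball 0 R. ennreal ((U (x, y) - c x)\<^sup>2) \<partial>lebesgue) < ennreal \<epsilon>"
    using b(1) \<open>0 < Y\<close> by (intro exI[of _ "min b Y"] conjI) simp_all
qed

text \<open>
  Traces are compared through slices, and subadditivity of the integral of squares needs measurable
  slices.  A measurable function guarantees this for almost every height only.
\<close>

definition measurable_slices :: "('a::euclidean_space \<times> real \<Rightarrow> real) \<Rightarrow> bool" where
  "measurable_slices U \<longleftrightarrow> (\<exists>Y>0. AE y in lborel. 0 < y \<and> y < Y \<longrightarrow> (\<lambda>x. U (x, y)) \<in> borel_measurable lebesgue)"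

lemma borel_measurable_lebesgue_AE:
  fixes f g :: "'a::euclidean_space \<Rightarrow> real"
  assumes "g \<in> borel_measurable lebesgue" "AE x in lebesgue. f x = g x"
  shows "f \<in> borel_measurable lebesgue"
proof (rule measurableI)
  fix A :: "real set" assume "A \<in> sets borel"
  then have A: "g -` A \<in> sets lebesgue" using measurable_sets[OF assms(1)] by auto
  have "AE x in lebesgue. x \<in> g -` A \<longleftrightarrow> x \<in> f -` A"
    using assms(2) by eventually_elim auto
  from completion.in_sets_AE[OF this A] have "f -` A \<in> sets lebesgue" by simp
  then show "f -` A \<inter> space lebesgue \<in> sets lebesgue" by simp
qed simp

lemma measurable_slices_of_version:
  assumes [measurable]: "u \<in> borel_measurable borel" and "AE z in lborel. z \<in> slab Y \<longrightarrow> u z = U z" "0 < Y"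
  shows "measurable_slices U"
  unfolding measurable_slices_def
proof (intro exI conjI)
  from AE_lborel_snd[OF assms(2)]
  have "AE y in lborel. AE x in lborel. 0 < y \<and> y < Y \<longrightarrow> u (x, y) = U (x, y)" by (simp add: slab_Pair_iff)
  then show "AE y in lborel. 0 < y \<and> y < Y \<longrightarrow> (\<lambda>x. U (x, y)) \<in> borel_measurable lebesgue"
  proof eventually_elim
    fix y assume *: "AE x in lborel. 0 < y \<and> y < Y \<longrightarrow> u (x, y) = U (x, y)"
    show "0 < y \<and> y < Y \<longrightarrow> (\<lambda>x. U (x, y)) \<in> borel_measurable lebesgue"
    proof
      assume y: "0 < y \<and> y < Y"
      show "(\<lambda>x. U (x, y)) \<in> borel_measurable lebesgue"
      proof (rule borel_measurable_lebesgue_AE)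
        show "(\<lambda>x. u (x, y)) \<in> borel_measurable lebesgue" by (rule borel_imp_lebesgue) measurable
        show "AE x in lebesgue. U (x, y) = u (x, y)"
          using AE_completion[OF *] by eventually_elim (use y in auto)
      qed
    qed
  qed
qed fact

lemma has_trace0_measurable: "has_trace0 U g \<Longrightarrow> g \<in> borel_measurable lebesgue"
  by (simp add: has_trace0_def)

lemma has_trace0D:
  assumes "has_trace0 U g" "0 < \<epsilon>"
  shows "\<exists>\<delta>>0. AE y in lborel. 0 < y \<and> y < \<delta> \<longrightarrow> (\<integral>\<^sup>+x\<in>ball 0 R. ennreal ((U (x, y) - g x)\<^sup>2) \<partial>lebesgue) < ennreal \<epsilon>"
  using assms unfolding has_trace0_def by (simp add: AE_completion_iff)

lemma square_diff_le: "(a - b)\<^sup>2 \<le> 2 * a\<^sup>2 + 2 * (b::real)\<^sup>2"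
  using sum_squares_ge_zero[of "a + b" 0] by (simp add: power2_eq_square algebra_simps)

lemma nn_integral_square_diff_le:
  fixes a b :: "'a::euclidean_space \<Rightarrow> real"
  assumes [measurable]: "a \<in> borel_measurable lebesgue" "b \<in> borel_measurable lebesgue" "B \<in> sets lebesgue"
  shows "(\<integral>\<^sup>+x\<in>B. ennreal ((a x - b x)\<^sup>2) \<partial>lebesgue)
    \<le> 2 * (\<integral>\<^sup>+x\<in>B. ennreal ((a x)\<^sup>2) \<partial>lebesgue) + 2 * (\<integral>\<^sup>+x\<in>B. ennreal ((b x)\<^sup>2) \<partial>lebesgue)"
proof -
  have "(\<integral>\<^sup>+x\<in>B. ennreal ((a x - b x)\<^sup>2) \<partial>lebesgue)
    \<le> (\<integral>\<^sup>+x. 2 * (ennreal ((a x)\<^sup>2) * indicator B x) + 2 * (ennreal ((b x)\<^sup>2) * indicator B x) \<partial>lebesgue)"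
  proof (rule nn_integral_mono)
    fix x
    have "ennreal ((a x - b x)\<^sup>2) \<le> ennreal (2 * (a x)\<^sup>2 + 2 * (b x)\<^sup>2)"
      by (intro ennreal_leI square_diff_le)
    also have "\<dots> = 2 * ennreal ((a x)\<^sup>2) + 2 * ennreal ((b x)\<^sup>2)"
      by (simp add: ennreal_mult)
    finally show "ennreal ((a x - b x)\<^sup>2) * indicator B x
      \<le> 2 * (ennreal ((a x)\<^sup>2) * indicator B x) + 2 * (ennreal ((b x)\<^sup>2) * indicator B x)"
      by (auto split: split_indicator)
  qed
  also have "\<dots> = 2 * (\<integral>\<^sup>+x\<in>B. ennreal ((a x)\<^sup>2) \<partial>lebesgue) + 2 * (\<integral>\<^sup>+x\<in>B. ennreal ((b x)\<^sup>2) \<partial>lebesgue)"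
    by (simp add: nn_integral_add nn_integral_cmult)
  finally show ?thesis .
qed

text \<open>
  At some small height the slice is measurable and close to both candidates, so they are close to each
  other on every ball.
\<close>

lemma has_trace0_unique:
  assumes g: "has_trace0 U g" and h: "has_trace0 U h" and "measurable_slices U"
  shows "AE x in lebesgue. g x = h x"
proof -
  obtain Y where Y: "Y > 0" "AE y in lborel. 0 < y \<and> y < Y \<longrightarrow> (\<lambda>x. U (x, y)) \<in> borel_measurable lebesgue"
    using assms(3) by (auto simp: measurable_slices_def)
  note [measurable] = has_trace0_measurable[OF g] has_trace0_measurable[OF h]
  have small: "(\<integral>\<^sup>+x\<in>ball 0 R. ennreal ((g x - h x)\<^sup>2) \<partial>lebesgue) \<le> ennreal \<epsilon>" if "0 < \<epsilon>" for R \<epsilon>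
  proof -
    have "0 < \<epsilon> / 4" using that by simp
    then obtain \<delta>1 \<delta>2 where \<delta>: "\<delta>1 > 0" "\<delta>2 > 0"
      "AE y in lborel. 0 < y \<and> y < \<delta>1 \<longrightarrow> (\<integral>\<^sup>+x\<in>ball 0 R. ennreal ((U (x, y) - g x)\<^sup>2) \<partial>lebesgue) < ennreal (\<epsilon> / 4)"
      "AE y in lborel. 0 < y \<and> y < \<delta>2 \<longrightarrow> (\<integral>\<^sup>+x\<in>ball 0 R. ennreal ((U (x, y) - h x)\<^sup>2) \<partial>lebesgue) < ennreal (\<epsilon> / 4)"
      using has_trace0D[OF g, of "\<epsilon> / 4" R] has_trace0D[OF h, of "\<epsilon> / 4" R] by blast
    have "0 < min Y (min \<delta>1 \<delta>2)" using Y \<delta> by simp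
    from AE_obtain_between[OF eventually_conj[OF Y(2) eventually_conj[OF \<delta>(3,4)]] this]
    obtain y where y: "(\<lambda>x. U (x, y)) \<in> borel_measurable lebesgue"
      "(\<integral>\<^sup>+x\<in>ball 0 R. ennreal ((U (x, y) - g x)\<^sup>2) \<partial>lebesgue) < ennreal (\<epsilon> / 4)"
      "(\<integral>\<^sup>+x\<in>ball 0 R. ennreal ((U (x, y) - h x)\<^sup>2) \<partial>lebesgue) < ennreal (\<epsilon> / 4)" by auto
    note [measurable] = y(1)
    have "(\<integral>\<^sup>+x\<in>ball 0 R. ennreal ((g x - h x)\<^sup>2) \<partial>lebesgue) = (\<integral>\<^sup>+x\<in>ball 0 R. ennreal (((U (x, y) - h x) - (U (x, y) - g x))\<^sup>2) \<partial>lebesgue)"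
      by (simp add: algebra_simps)
    also have "\<dots> \<le> 2 * (\<integral>\<^sup>+x\<in>ball 0 R. ennreal ((U (x, y) - h x)\<^sup>2) \<partial>lebesgue) + 2 * (\<integral>\<^sup>+x\<in>ball 0 R. ennreal ((U (x, y) - g x)\<^sup>2) \<partial>lebesgue)"
      by (rule nn_integral_square_diff_le) auto
    also have "\<dots> \<le> 2 * ennreal (\<epsilon> / 4) + 2 * ennreal (\<epsilon> / 4)"
      using y(2,3) by (intro add_mono mult_left_mono) auto
    also have "\<dots> = ennreal \<epsilon>" using that
      by (simp add: ennreal_plus[symmetric] ennreal_mult'[symmetric] ennreal_numeral[symmetric] del: ennreal_plus ennreal_numeral)
    finally show ?thesis .
  qed
  have "AE x in lebesgue. x \<in> ball 0 (real n) \<longrightarrow> g x = h x" for n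
  proof -
    have "(\<integral>\<^sup>+x\<in>ball 0 (real n). ennreal ((g x - h x)\<^sup>2) \<partial>lebesgue) \<le> 0"
    proof (rule ennreal_le_epsilon)
      show "(\<integral>\<^sup>+x\<in>ball 0 (real n). ennreal ((g x - h x)\<^sup>2) \<partial>lebesgue) \<le> 0 + ennreal e" if "0 < e" for e
        unfolding add_0 by (rule small[OF that])
    qed
    then have "(\<integral>\<^sup>+x\<in>ball 0 (real n). ennreal ((g x - h x)\<^sup>2) \<partial>lebesgue) = 0" by (rule le_zero_eq[THEN iffD1])
    moreover have "(\<lambda>x. ennreal ((g x - h x)\<^sup>2) * indicator (ball 0 (real n)) x) \<in> borel_measurable lebesgue"
      by (intro borel_measurable_times_ennreal borel_measurable_indicator) auto
    ultimately have "AE x in lebesgue. ennreal ((g x - h x)\<^sup>2) * indicator (ball 0 (real n)) x = 0"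
      by (subst (asm) nn_integral_0_iff_AE)
    then show ?thesis by eventually_elim (auto split: split_indicator_asm)
  qed
  then have "AE x in lebesgue. \<forall>n. x \<in> ball 0 (real n) \<longrightarrow> g x = h x"
    unfolding AE_all_countable by (rule allI)
  then show ?thesis
  proof eventually_elim
    fix x assume *: "\<forall>n. x \<in> ball 0 (real n) \<longrightarrow> g x = h x"
    obtain n where "norm x < real n" using reals_Archimedean2 by blast
    then show "g x = h x" using * by auto
  qed
qed

lemma has_trace0_diff:
  assumes g: "has_trace0 U g" and h: "has_trace0 V h" and "measurable_slices U" "measurable_slices V"
  shows "has_trace0 (\<lambda>z. U z - V z) (\<lambda>x. g x - h x)"
  unfolding has_trace0_def
proof (intro conjI allI impI)
  note [measurable] = has_trace0_measurable[OF g] has_trace0_measurable[OF h]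
  show "(\<lambda>x. g x - h x) \<in> borel_measurable lebesgue" by measurable
  fix R \<epsilon> :: real assume "0 < \<epsilon>"
  obtain Y1 Y2 where Y: "Y1 > 0" "AE y in lborel. 0 < y \<and> y < Y1 \<longrightarrow> (\<lambda>x. U (x, y)) \<in> borel_measurable lebesgue"
     "Y2 > 0" "AE y in lborel. 0 < y \<and> y < Y2 \<longrightarrow> (\<lambda>x. V (x, y)) \<in> borel_measurable lebesgue"
    using assms(3,4) by (auto simp: measurable_slices_def)
  have "0 < \<epsilon> / 4" using \<open>0 < \<epsilon>\<close> by simp
  then obtain \<delta>1 \<delta>2 where \<delta>: "\<delta>1 > 0" "\<delta>2 > 0"
      "AE y in lborel. 0 < y \<and> y < \<delta>1 \<longrightarrow> (\<integral>\<^sup>+x\<in>ball 0 R. ennreal ((U (x, y) - g x)\<^sup>2) \<partial>lebesgue) < ennreal (\<epsilon> / 4)"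
      "AE y in lborel. 0 < y \<and> y < \<delta>2 \<longrightarrow> (\<integral>\<^sup>+x\<in>ball 0 R. ennreal ((V (x, y) - h x)\<^sup>2) \<partial>lebesgue) < ennreal (\<epsilon> / 4)"
    using has_trace0D[OF g, of "\<epsilon> / 4" R] has_trace0D[OF h, of "\<epsilon> / 4" R] by blast
  let ?d = "min (min Y1 Y2) (min \<delta>1 \<delta>2)"
  have "AE y in lborel. 0 < y \<and> y < ?d \<longrightarrow> (\<integral>\<^sup>+x\<in>ball 0 R. ennreal (((U (x, y) - V (x, y)) - (g x - h x))\<^sup>2) \<partial>lebesgue) < ennreal \<epsilon>"
    using Y(2,4) \<delta>(3,4)
  proof eventually_elim
    case (elim y)
    show ?case
    proof
      assume y: "0 < y \<and> y < ?d"
      have [measurable]: "(\<lambda>x. U (x, y)) \<in> borel_measurable lebesgue" "(\<lambda>x. V (x, y)) \<in> borel_measurable lebesgue"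
        using elim y by auto
      have "(\<integral>\<^sup>+x\<in>ball 0 R. ennreal (((U (x, y) - V (x, y)) - (g x - h x))\<^sup>2) \<partial>lebesgue)
          = (\<integral>\<^sup>+x\<in>ball 0 R. ennreal (((U (x, y) - g x) - (V (x, y) - h x))\<^sup>2) \<partial>lebesgue)"
        by (simp add: algebra_simps)
      also have "\<dots> \<le> 2 * (\<integral>\<^sup>+x\<in>ball 0 R. ennreal ((U (x, y) - g x)\<^sup>2) \<partial>lebesgue) + 2 * (\<integral>\<^sup>+x\<in>ball 0 R. ennreal ((V (x, y) - h x)\<^sup>2) \<partial>lebesgue)"
        by (rule nn_integral_square_diff_le) auto
      also have "\<dots> < 2 * ennreal (\<epsilon> / 4) + 2 * ennreal (\<epsilon> / 4)"
      proof -
        have "2 * a < 2 * ennreal (\<epsilon> / 4)" if "a < ennreal (\<epsilon> / 4)" for a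
          using that by (intro ennreal_mult_strict_left_mono) auto
        then show ?thesis using elim y by (intro add_strict_mono) auto
      qed
      also have "\<dots> = ennreal \<epsilon>" using \<open>0 < \<epsilon>\<close>
        by (simp add: ennreal_plus[symmetric] ennreal_mult'[symmetric] ennreal_numeral[symmetric] del: ennreal_plus ennreal_numeral)
      finally show "(\<integral>\<^sup>+x\<in>ball 0 R. ennreal (((U (x, y) - V (x, y)) - (g x - h x))\<^sup>2) \<partial>lebesgue) < ennreal \<epsilon>" .
    qed
  qed
  from AE_completion[OF this]
  show "\<exists>\<delta>>0. AE y in lebesgue. 0 < y \<and> y < \<delta> \<longrightarrow>
      (\<integral>\<^sup>+x\<in>ball 0 R. ennreal ((U (x, y) - V (x, y) - (g x - h x))\<^sup>2) \<partial>lebesgue) < ennreal \<epsilon>"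
    using Y(1,3) \<delta>(1,2) by (intro exI[of _ ?d] conjI) simp_all
qed

lemma has_trace0_cutoff:
  assumes g: "has_trace0 U g" and "0 < y0" and \<eta>: "\<And>x y. 0 < y \<Longrightarrow> y < y0 \<Longrightarrow> \<eta> (x, y) = \<eta>0 x"
    and \<eta>0: "\<eta>0 \<in> borel_measurable borel" "\<And>x. \<bar>\<eta>0 x\<bar> \<le> 1"
  shows "has_trace0 (\<lambda>z. \<eta> z * U z) (\<lambda>x. \<eta>0 x * g x)"
  unfolding has_trace0_def
proof (intro conjI allI impI)
  note [measurable] = has_trace0_measurable[OF g] borel_imp_lebesgue[OF \<eta>0(1)]
  show "(\<lambda>x. \<eta>0 x * g x) \<in> borel_measurable lebesgue" by measurable
  fix R \<epsilon> :: real assume "0 < \<epsilon>"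
  then obtain \<delta> where \<delta>: "\<delta> > 0"
      "AE y in lborel. 0 < y \<and> y < \<delta> \<longrightarrow> (\<integral>\<^sup>+x\<in>ball 0 R. ennreal ((U (x, y) - g x)\<^sup>2) \<partial>lebesgue) < ennreal \<epsilon>"
    using has_trace0D[OF g, of \<epsilon> R] by blast
  have "AE y in lborel. 0 < y \<and> y < min \<delta> y0 \<longrightarrow> (\<integral>\<^sup>+x\<in>ball 0 R. ennreal ((\<eta> (x, y) * U (x, y) - \<eta>0 x * g x)\<^sup>2) \<partial>lebesgue) < ennreal \<epsilon>"
    using \<delta>(2)
  proof eventually_elim
    case (elim y)
    show ?case
    proof
      assume y: "0 < y \<and> y < min \<delta> y0"
      have "(\<integral>\<^sup>+x\<in>ball 0 R. ennreal ((\<eta> (x, y) * U (x, y) - \<eta>0 x * g x)\<^sup>2) \<partial>lebesgue)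
          \<le> (\<integral>\<^sup>+x\<in>ball 0 R. ennreal ((U (x, y) - g x)\<^sup>2) \<partial>lebesgue)"
      proof (intro nn_integral_mono mult_right_mono ennreal_leI)
        fix x
        have "(\<eta> (x, y) * U (x, y) - \<eta>0 x * g x)\<^sup>2 = (\<eta>0 x)\<^sup>2 * (U (x, y) - g x)\<^sup>2"
          using y \<eta>[of y x] by (simp add: power_mult_distrib[symmetric] right_diff_distrib)
        also have "\<dots> \<le> 1 * (U (x, y) - g x)\<^sup>2"
          using \<eta>0(2)[of x] by (intro mult_right_mono) (auto simp: abs_square_le_1)
        finally show "(\<eta> (x, y) * U (x, y) - \<eta>0 x * g x)\<^sup>2 \<le> (U (x, y) - g x)\<^sup>2" by simp
      qed simp
      also have "\<dots> < ennreal \<epsilon>" using elim y by auto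
      finally show "(\<integral>\<^sup>+x\<in>ball 0 R. ennreal ((\<eta> (x, y) * U (x, y) - \<eta>0 x * g x)\<^sup>2) \<partial>lebesgue) < ennreal \<epsilon>" .
    qed
  qed
  from AE_completion[OF this]
  show "\<exists>\<delta>>0. AE y in lebesgue. 0 < y \<and> y < \<delta> \<longrightarrow>
      (\<integral>\<^sup>+x\<in>ball 0 R. ennreal ((\<eta> (x, y) * U (x, y) - \<eta>0 x * g x)\<^sup>2) \<partial>lebesgue) < ennreal \<epsilon>"
    using \<delta>(1) \<open>0 < y0\<close> by (intro exI[of _ "min \<delta> y0"] conjI) simp_all
qed

lemma has_trace0_tr0: "has_trace0 U g \<Longrightarrow> has_trace0 U (tr0 U)"
  unfolding tr0_def by (rule someI[of "has_trace0 U"])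

section \<open>A Hardy inequality with trace term\<close>

lemma nn_integral_powr_inf:
  assumes "e < -1" "0 < t"
  shows "(\<integral>\<^sup>+y. ennreal (indicator {t..} y * y powr e) \<partial>lborel) = ennreal (t powr (e + 1) / (- 1 - e))"
proof -
  have "((\<lambda>y. y powr e) has_integral (t powr (e + 1) / (- 1 - e))) {t..}"
  proof -
    have "- 1 - e = - (e + 1)" by simp
    then have "- (t powr (e + 1)) / (e + 1) = t powr (e + 1) / (- 1 - e)"
      by (simp only: minus_divide_right[symmetric] minus_divide_left)
    then show ?thesis using has_integral_powr_to_inf[OF assms] by (simp only:)
  qed
  then have "((\<lambda>y. indicator {t..} y * y powr e) has_integral (t powr (e + 1) / (- 1 - e))) UNIV"
    unfolding has_integral_restrict_UNIV[symmetric, of "\<lambda>t. t powr e" _ "{t..}"]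
    by (rule has_integral_eq[rotated]) (auto split: split_indicator)
  then show ?thesis by (intro nn_integral_has_integral_lborel) auto
qed

text \<open>
  Hardy's inequality on a vertical line: Cauchy-Schwarz with the weight \<open>t\<^sup>\<gamma>\<close> for some \<open>\<gamma>\<close> between \<open>\<alpha>\<close> and 1,
  followed by an exchange of the two integrations.
\<close>

lemma weighted_Hardy:
  fixes p :: "'a::euclidean_space \<times> real \<Rightarrow> real"
  assumes [measurable]: "p \<in> borel_measurable borel" and \<alpha>: "\<alpha> < 1"
  shows "(\<integral>\<^sup>+y. ennreal (indicator {0<..<Y} y * (y powr (\<alpha> - 2) * (vertical_integral p (x, y))\<^sup>2)) \<partial>lborel)
    \<le> ennreal (4 / (1 - \<alpha>)\<^sup>2) * (\<integral>\<^sup>+t. ennreal (indicator {0<..<Y} t * (t powr \<alpha> * (p (x, t))\<^sup>2)) \<partial>lborel)"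
proof -
  \<comment> \<open>Any exponent strictly between \<open>\<alpha>\<close> and 1 gives a finite constant; the midpoint minimises it.\<close>
  define \<gamma> where "\<gamma> = (\<alpha> + 1) / 2"
  have \<gamma>: "\<gamma> < 1" "1 - \<gamma> = (1 - \<alpha>) / 2" "\<gamma> - \<alpha> = (1 - \<alpha>) / 2" using \<alpha> by (auto simp: \<gamma>_def field_simps)
  let ?k = "\<lambda>y t. ennreal (indicator {0<..<Y} t * (t powr \<gamma> * (p (x, t))\<^sup>2)) * ennreal (indicator {t..} y * (y powr (\<alpha> - \<gamma> - 1) / (1 - \<gamma>)))"
  have "(\<integral>\<^sup>+y. ennreal (indicator {0<..<Y} y * (y powr (\<alpha> - 2) * (vertical_integral p (x, y))\<^sup>2)) \<partial>lborel)
      \<le> (\<integral>\<^sup>+y. \<integral>\<^sup>+t. ?k y t \<partial>lborel \<partial>lborel)"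
  proof (rule nn_integral_mono)
    fix y :: real
    show "ennreal (indicator {0<..<Y} y * (y powr (\<alpha> - 2) * (vertical_integral p (x, y))\<^sup>2)) \<le> (\<integral>\<^sup>+t. ?k y t \<partial>lborel)"
    proof (cases "0 < y \<and> y < Y")
      case True
      have "ennreal (y powr (\<alpha> - 2) * (vertical_integral p (x, y))\<^sup>2)
        \<le> ennreal (y powr (\<alpha> - 2)) * (ennreal (y powr (1 - \<gamma>) / (1 - \<gamma>)) * (\<integral>\<^sup>+t. ennreal (indicator {0<..<y} t * (t powr \<gamma> * (p (x, t))\<^sup>2)) \<partial>lborel))"
        unfolding ennreal_mult[OF powr_ge_zero zero_le_power2]
        by (intro mult_left_mono vertical_integral_square_le) (use \<gamma> True in auto)
      also have "\<dots> = ennreal (y powr (\<alpha> - 2) * (y powr (1 - \<gamma>) / (1 - \<gamma>))) * (\<integral>\<^sup>+t. ennreal (indicator {0<..<y} t * (t powr \<gamma> * (p (x, t))\<^sup>2)) \<partial>lborel)"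
        unfolding mult.assoc[symmetric] by (subst ennreal_mult) (use \<gamma>(1) in \<open>auto simp: mult.assoc\<close>)
      also have "y powr (\<alpha> - 2) * (y powr (1 - \<gamma>) / (1 - \<gamma>)) = y powr (\<alpha> - \<gamma> - 1) / (1 - \<gamma>)"
        using powr_add[of y "\<alpha> - 2" "1 - \<gamma>"] by (simp add: algebra_simps)
      also have "ennreal (y powr (\<alpha> - \<gamma> - 1) / (1 - \<gamma>)) * (\<integral>\<^sup>+t. ennreal (indicator {0<..<y} t * (t powr \<gamma> * (p (x, t))\<^sup>2)) \<partial>lborel)
          = (\<integral>\<^sup>+t. ennreal (y powr (\<alpha> - \<gamma> - 1) / (1 - \<gamma>)) * ennreal (indicator {0<..<y} t * (t powr \<gamma> * (p (x, t))\<^sup>2)) \<partial>lborel)"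
        by (rule nn_integral_cmult[symmetric]) measurable
      also have "(\<integral>\<^sup>+t. ennreal (y powr (\<alpha> - \<gamma> - 1) / (1 - \<gamma>)) * ennreal (indicator {0<..<y} t * (t powr \<gamma> * (p (x, t))\<^sup>2)) \<partial>lborel)
          \<le> (\<integral>\<^sup>+t. ?k y t \<partial>lborel)"
        by (intro nn_integral_mono) (use True in \<open>auto split: split_indicator simp: mult.commute\<close>)
      finally show ?thesis using True by simp
    qed auto
  qed
  also have "\<dots> = (\<integral>\<^sup>+t. \<integral>\<^sup>+y. ?k y t \<partial>lborel \<partial>lborel)"
  proof (rule lborel_pair.Fubini')
    have "(\<lambda>(t, y). ennreal (indicator {0<..<Y} t * (t powr \<gamma> * (p (x, t))\<^sup>2)) * ennreal ((if t \<le> y then 1 else 0) * (y powr (\<alpha> - \<gamma> - 1) / (1 - \<gamma>))))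
      \<in> borel_measurable (lborel \<Otimes>\<^sub>M lborel)" by measurable
    then show "(\<lambda>(t, y). ?k y t) \<in> borel_measurable (lborel \<Otimes>\<^sub>M lborel)"
      by (simp add: indicator_def of_bool_def)
  qed
  also have "\<dots> = (\<integral>\<^sup>+t. ennreal (4 / (1 - \<alpha>)\<^sup>2) * ennreal (indicator {0<..<Y} t * (t powr \<alpha> * (p (x, t))\<^sup>2)) \<partial>lborel)"
  proof (rule nn_integral_cong)
    fix t :: real
    have "(\<integral>\<^sup>+y. ?k y t \<partial>lborel) = ennreal (indicator {0<..<Y} t * (t powr \<gamma> * (p (x, t))\<^sup>2)) * (\<integral>\<^sup>+y. ennreal (indicator {t..} y * (y powr (\<alpha> - \<gamma> - 1) / (1 - \<gamma>))) \<partial>lborel)"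
      by (rule nn_integral_cmult) measurable
    also have "\<dots> = ennreal (4 / (1 - \<alpha>)\<^sup>2) * ennreal (indicator {0<..<Y} t * (t powr \<alpha> * (p (x, t))\<^sup>2))"
    proof (cases "0 < t \<and> t < Y")
      case True
      have "(\<integral>\<^sup>+y. ennreal (indicator {t..} y * (y powr (\<alpha> - \<gamma> - 1) / (1 - \<gamma>))) \<partial>lborel)
        = (\<integral>\<^sup>+y. ennreal (1 / (1 - \<gamma>)) * ennreal (indicator {t..} y * y powr (\<alpha> - \<gamma> - 1)) \<partial>lborel)"
        using \<gamma>(1) by (intro nn_integral_cong) (simp add: ennreal_mult'[symmetric])
      also have "\<dots> = ennreal (1 / (1 - \<gamma>)) * (\<integral>\<^sup>+y. ennreal (indicator {t..} y * y powr (\<alpha> - \<gamma> - 1)) \<partial>lborel)"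
        by (rule nn_integral_cmult) measurable
      also have "(\<integral>\<^sup>+y. ennreal (indicator {t..} y * y powr (\<alpha> - \<gamma> - 1)) \<partial>lborel) = ennreal (t powr (\<alpha> - \<gamma>) / (\<gamma> - \<alpha>))"
      proof -
        have e: "\<alpha> - \<gamma> - 1 + 1 = \<alpha> - \<gamma>" "- 1 - (\<alpha> - \<gamma> - 1) = \<gamma> - \<alpha>" "\<alpha> - \<gamma> - 1 < - 1"
          using \<gamma>(3) \<alpha> by auto
        show ?thesis using nn_integral_powr_inf[OF e(3), of t] True unfolding e(1,2) by blast
      qed
      finally have I: "(\<integral>\<^sup>+y. ennreal (indicator {t..} y * (y powr (\<alpha> - \<gamma> - 1) / (1 - \<gamma>))) \<partial>lborel)
          = ennreal (1 / (1 - \<gamma>)) * ennreal (t powr (\<alpha> - \<gamma>) / (\<gamma> - \<alpha>))" .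
      have real: "t powr \<gamma> * P * (1 / (1 - \<gamma>) * (t powr (\<alpha> - \<gamma>) / (\<gamma> - \<alpha>))) = 4 / (1 - \<alpha>)\<^sup>2 * (t powr \<alpha> * P)" for P
      proof -
        have "t powr \<alpha> = t powr \<gamma> * t powr (\<alpha> - \<gamma>)" by (simp add: powr_add[symmetric])
        then show ?thesis using \<alpha> unfolding \<gamma>(2,3) by (simp add: power2_eq_square field_simps)
      qed
      have "ennreal (t powr \<gamma> * (p (x, t))\<^sup>2) * (ennreal (1 / (1 - \<gamma>)) * ennreal (t powr (\<alpha> - \<gamma>) / (\<gamma> - \<alpha>)))
         = ennreal (t powr \<gamma> * (p (x, t))\<^sup>2 * (1 / (1 - \<gamma>) * (t powr (\<alpha> - \<gamma>) / (\<gamma> - \<alpha>))))"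
      proof -
        have "0 \<le> 1 / (1 - \<gamma>)" "0 \<le> t powr \<gamma> * (p (x, t))\<^sup>2" using \<gamma>(1) by auto
        then show ?thesis by (simp only: ennreal_mult'[of "1 / (1 - \<gamma>)"] ennreal_mult'[of "t powr \<gamma> * (p (x, t))\<^sup>2"])
      qed
      then show ?thesis
        using True \<alpha> unfolding I real by (simp add: ennreal_mult'[symmetric])
    qed auto
    finally show "(\<integral>\<^sup>+y. ?k y t \<partial>lborel) = ennreal (4 / (1 - \<alpha>)\<^sup>2) * ennreal (indicator {0<..<Y} t * (t powr \<alpha> * (p (x, t))\<^sup>2))" .
  qed
  also have "\<dots> = ennreal (4 / (1 - \<alpha>)\<^sup>2) * (\<integral>\<^sup>+t. ennreal (indicator {0<..<Y} t * (t powr \<alpha> * (p (x, t))\<^sup>2)) \<partial>lborel)"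
    by (rule nn_integral_cmult) measurable
  finally show ?thesis .
qed

lemma nn_integral_powr_decay:
  assumes "-1 < \<alpha>" "\<alpha> < 1"
  shows "(\<integral>\<^sup>+y. ennreal (indicator {0<..} y * (y powr \<alpha> * inverse (1 + y\<^sup>2))) \<partial>lborel) \<le> ennreal (1 / (1 + \<alpha>) + 1 / (1 - \<alpha>))"
proof -
  have "(\<integral>\<^sup>+y. ennreal (indicator {0<..} y * (y powr \<alpha> * inverse (1 + y\<^sup>2))) \<partial>lborel)
    \<le> (\<integral>\<^sup>+y. ennreal (indicator {0<..<1} y * y powr (- (- \<alpha>))) + ennreal (indicator {1..} y * y powr (\<alpha> - 2)) \<partial>lborel)"
  proof (rule nn_integral_mono)
    fix y :: real
    have "y powr \<alpha> * inverse (1 + y\<^sup>2) \<le> y powr \<alpha> * 1" if "0 < y"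
      using that by (intro mult_left_mono) (auto simp: field_simps add_pos_nonneg)
    moreover have "y powr \<alpha> * inverse (1 + y\<^sup>2) \<le> y powr (\<alpha> - 2)" if "1 \<le> y"
    proof -
      have "y powr (\<alpha> - 2) = y powr \<alpha> * inverse (y\<^sup>2)"
        using that by (simp add: powr_diff powr_numeral divide_inverse)
      then show ?thesis using that by (auto intro!: mult_left_mono le_imp_inverse_le)
    qed
    ultimately show "ennreal (indicator {0<..} y * (y powr \<alpha> * inverse (1 + y\<^sup>2)))
      \<le> ennreal (indicator {0<..<1} y * y powr (- (- \<alpha>))) + ennreal (indicator {1..} y * y powr (\<alpha> - 2))"
      by (auto split: split_indicator intro!: ennreal_leI)
  qed
  also have "\<dots> = ennreal (1 / (1 + \<alpha>)) + ennreal (1 / (1 - \<alpha>))"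
    using nn_integral_powr_0[of "-\<alpha>" 1] nn_integral_powr_inf[of "\<alpha> - 2" 1] assms
    by (subst nn_integral_add) auto
  also have "\<dots> = ennreal (1 / (1 + \<alpha>) + 1 / (1 - \<alpha>))"
    using assms by (intro ennreal_plus[symmetric]) auto
  finally show ?thesis .
qed

text \<open>
  The function is its trace plus a vertical primitive.  The trace contributes the integral of
  \<open>y\<^sup>\<alpha> / (1 + y\<^sup>2)\<close> over all heights, which is finite since \<open>-1 < \<alpha> < 1\<close>, and the primitive is covered by the
  one-dimensional inequality.  Neither bound involves the height of the slab.
\<close>

lemma trace_Hardy:
  fixes U :: "'a::euclidean_space \<times> real \<Rightarrow> real"
  assumes m[measurable]: "u \<in> borel_measurable borel" "p \<in> borel_measurable borel" "c \<in> borel_measurable borel"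
    and uU: "AE z in lborel. z \<in> slab Y \<longrightarrow> u z = U z"
    and rep: "AE z in lborel. z \<in> slab Y \<longrightarrow> u z = c (fst z) + vertical_integral p z"
    and \<alpha>: "-1 < \<alpha>" "\<alpha> < 1"
  shows "(\<integral>\<^sup>+z. ennreal (indicator (slab Y) z * (snd z powr \<alpha> * (inverse ((rho z)\<^sup>2) * (U z)\<^sup>2))) \<partial>lborel)
    \<le> ennreal (2 * (1 / (1 + \<alpha>) + 1 / (1 - \<alpha>))) * (\<integral>\<^sup>+x. ennreal ((c x)\<^sup>2) \<partial>lborel)
     + ennreal (8 / (1 - \<alpha>)\<^sup>2) * (\<integral>\<^sup>+z. ennreal (indicator (slab Y) z * (snd z powr \<alpha> * (p z)\<^sup>2)) \<partial>lborel)"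
proof -
  let ?f = "\<lambda>z::'a \<times> real. ennreal (2 * (c (fst z))\<^sup>2) * ennreal (indicator {0<..} (snd z) * (snd z powr \<alpha> * inverse (1 + (snd z)\<^sup>2)))"
  let ?g = "\<lambda>z. 2 * ennreal (indicator {0<..<Y} (snd z) * (snd z powr (\<alpha> - 2) * (vertical_integral p z)\<^sup>2))"
  have "(\<integral>\<^sup>+z. ennreal (indicator (slab Y) z * (snd z powr \<alpha> * (inverse ((rho z)\<^sup>2) * (U z)\<^sup>2))) \<partial>lborel)
      \<le> (\<integral>\<^sup>+z. ?f z + ?g z \<partial>lborel)"
  proof (rule nn_integral_mono_AE)
    show "AE z in lborel. ennreal (indicator (slab Y) z * (snd z powr \<alpha> * (inverse ((rho z)\<^sup>2) * (U z)\<^sup>2))) \<le> ?f z + ?g z"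
      using uU rep
    proof eventually_elim
      fix z assume z: "z \<in> slab Y \<longrightarrow> u z = U z" "z \<in> slab Y \<longrightarrow> u z = c (fst z) + vertical_integral p z"
      show "ennreal (indicator (slab Y) z * (snd z powr \<alpha> * (inverse ((rho z)\<^sup>2) * (U z)\<^sup>2))) \<le> ?f z + ?g z"
      proof (cases "z \<in> slab Y")
        case True
        then have y: "0 < snd z" "snd z < Y" by (auto simp: slab_iff)
        let ?c = "c (fst z)" and ?v = "vertical_integral p z"
        have U2: "(U z)\<^sup>2 \<le> 2 * ?c\<^sup>2 + 2 * ?v\<^sup>2"
          using square_diff_le[of ?c "- ?v"] z True by simp
        have r1: "inverse ((rho z)\<^sup>2) \<le> inverse (1 + (snd z)\<^sup>2)"
          unfolding rho_square by (intro le_imp_inverse_le) (auto intro: add_pos_nonneg)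
        have r2: "inverse ((rho z)\<^sup>2) \<le> inverse ((snd z)\<^sup>2)"
          unfolding rho_square using y by (intro le_imp_inverse_le) auto
        have "inverse ((rho z)\<^sup>2) * (U z)\<^sup>2 \<le> inverse ((rho z)\<^sup>2) * (2 * ?c\<^sup>2 + 2 * ?v\<^sup>2)"
          by (intro mult_left_mono U2) simp
        also have "\<dots> \<le> inverse (1 + (snd z)\<^sup>2) * (2 * ?c\<^sup>2) + inverse ((snd z)\<^sup>2) * (2 * ?v\<^sup>2)"
          unfolding distrib_left by (intro add_mono mult_right_mono r1 r2) auto
        finally have "snd z powr \<alpha> * (inverse ((rho z)\<^sup>2) * (U z)\<^sup>2)
            \<le> snd z powr \<alpha> * (inverse (1 + (snd z)\<^sup>2) * (2 * ?c\<^sup>2) + inverse ((snd z)\<^sup>2) * (2 * ?v\<^sup>2))"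
          by (rule mult_left_mono) simp
        also have "\<dots> = 2 * ?c\<^sup>2 * (snd z powr \<alpha> * inverse (1 + (snd z)\<^sup>2)) + 2 * (snd z powr (\<alpha> - 2) * ?v\<^sup>2)"
        proof -
          have "snd z powr (\<alpha> - 2) = snd z powr \<alpha> * inverse ((snd z)\<^sup>2)"
            using y by (simp add: powr_diff powr_numeral divide_inverse)
          then show ?thesis by (simp add: algebra_simps)
        qed
        finally have "ennreal (snd z powr \<alpha> * (inverse ((rho z)\<^sup>2) * (U z)\<^sup>2))
            \<le> ennreal (2 * ?c\<^sup>2 * (snd z powr \<alpha> * inverse (1 + (snd z)\<^sup>2)) + 2 * (snd z powr (\<alpha> - 2) * ?v\<^sup>2))"
          by (rule ennreal_leI)
        also have "\<dots> = ennreal (2 * ?c\<^sup>2 * (snd z powr \<alpha> * inverse (1 + (snd z)\<^sup>2))) + ennreal (2 * (snd z powr (\<alpha> - 2) * ?v\<^sup>2))"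
          by (rule ennreal_plus) auto
        also have "ennreal (2 * ?c\<^sup>2 * (snd z powr \<alpha> * inverse (1 + (snd z)\<^sup>2))) = ?f z"
          using y by (subst ennreal_mult') auto
        also have "ennreal (2 * (snd z powr (\<alpha> - 2) * ?v\<^sup>2)) = ?g z"
          using y by (subst ennreal_mult') auto
        finally show ?thesis using True by simp
      qed simp
    qed
  qed
  also have "\<dots> = (\<integral>\<^sup>+z. ?f z \<partial>lborel) + (\<integral>\<^sup>+z. ?g z \<partial>lborel)"
    by (rule nn_integral_add) measurable
  also have "\<dots> \<le> ennreal (2 * (1 / (1 + \<alpha>) + 1 / (1 - \<alpha>))) * (\<integral>\<^sup>+x. ennreal ((c x)\<^sup>2) \<partial>lborel)
     + ennreal (8 / (1 - \<alpha>)\<^sup>2) * (\<integral>\<^sup>+z. ennreal (indicator (slab Y) z * (snd z powr \<alpha> * (p z)\<^sup>2)) \<partial>lborel)"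
  proof (rule add_mono)
    let ?I = "\<integral>\<^sup>+y. ennreal (indicator {0<..} y * (y powr \<alpha> * inverse (1 + y\<^sup>2))) \<partial>lborel"
    have "(\<integral>\<^sup>+z. ?f z \<partial>lborel) = (\<integral>\<^sup>+x. \<integral>\<^sup>+y. ?f (x, y) \<partial>lborel \<partial>lborel)"
      by (rule nn_integral_lborel_prod_iterated[symmetric]) measurable
    also have "\<dots> = (\<integral>\<^sup>+x. ennreal (2 * (c x)\<^sup>2) * ?I \<partial>lborel)"
      unfolding fst_conv snd_conv by (intro nn_integral_cong nn_integral_cmult) measurable
    also have "\<dots> \<le> (\<integral>\<^sup>+x. ennreal (2 * (c x)\<^sup>2) * ennreal (1 / (1 + \<alpha>) + 1 / (1 - \<alpha>)) \<partial>lborel)"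
      by (intro nn_integral_mono mult_left_mono nn_integral_powr_decay \<alpha>) auto
    also have "\<dots> = (\<integral>\<^sup>+x. ennreal (2 * (1 / (1 + \<alpha>) + 1 / (1 - \<alpha>))) * ennreal ((c x)\<^sup>2) \<partial>lborel)"
    proof (rule nn_integral_cong)
      fix x
      have k: "0 \<le> 1 / (1 + \<alpha>) + 1 / (1 - \<alpha>)" using \<alpha> by simp
      show "ennreal (2 * (c x)\<^sup>2) * ennreal (1 / (1 + \<alpha>) + 1 / (1 - \<alpha>)) = ennreal (2 * (1 / (1 + \<alpha>) + 1 / (1 - \<alpha>))) * ennreal ((c x)\<^sup>2)"
        using k by (subst (1 2) ennreal_mult[symmetric]) (auto simp: mult_ac)
    qed
    also have "\<dots> = ennreal (2 * (1 / (1 + \<alpha>) + 1 / (1 - \<alpha>))) * (\<integral>\<^sup>+x. ennreal ((c x)\<^sup>2) \<partial>lborel)"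
      by (rule nn_integral_cmult) measurable
    finally show "(\<integral>\<^sup>+z. ?f z \<partial>lborel) \<le> ennreal (2 * (1 / (1 + \<alpha>) + 1 / (1 - \<alpha>))) * (\<integral>\<^sup>+x. ennreal ((c x)\<^sup>2) \<partial>lborel)" .
    have "(\<integral>\<^sup>+z. ?g z \<partial>lborel) = (\<integral>\<^sup>+x. \<integral>\<^sup>+y. ?g (x, y) \<partial>lborel \<partial>lborel)"
      by (rule nn_integral_lborel_prod_iterated[symmetric]) measurable
    also have "\<dots> = (\<integral>\<^sup>+x. 2 * (\<integral>\<^sup>+y. ennreal (indicator {0<..<Y} y * (y powr (\<alpha> - 2) * (vertical_integral p (x, y))\<^sup>2)) \<partial>lborel) \<partial>lborel)"
      unfolding fst_conv snd_conv by (intro nn_integral_cong nn_integral_cmult) measurable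
    also have "\<dots> \<le> (\<integral>\<^sup>+x. 2 * (ennreal (4 / (1 - \<alpha>)\<^sup>2) * (\<integral>\<^sup>+t. ennreal (indicator {0<..<Y} t * (t powr \<alpha> * (p (x, t))\<^sup>2)) \<partial>lborel)) \<partial>lborel)"
      by (intro nn_integral_mono mult_left_mono weighted_Hardy m \<alpha>) auto
    also have "\<dots> = (\<integral>\<^sup>+x. ennreal (8 / (1 - \<alpha>)\<^sup>2) * (\<integral>\<^sup>+t. ennreal (indicator {0<..<Y} t * (t powr \<alpha> * (p (x, t))\<^sup>2)) \<partial>lborel) \<partial>lborel)"
    proof -
      have "2 * ennreal (4 / (1 - \<alpha>)\<^sup>2) = ennreal 2 * ennreal (4 / (1 - \<alpha>)\<^sup>2)" by simp
      also have "\<dots> = ennreal (2 * (4 / (1 - \<alpha>)\<^sup>2))" by (rule ennreal_mult[symmetric]) auto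
      finally show ?thesis unfolding mult.assoc[symmetric] by simp
    qed
    also have "\<dots> = ennreal (8 / (1 - \<alpha>)\<^sup>2) * (\<integral>\<^sup>+x. \<integral>\<^sup>+t. ennreal (indicator {0<..<Y} t * (t powr \<alpha> * (p (x, t))\<^sup>2)) \<partial>lborel \<partial>lborel)"
      by (rule nn_integral_cmult) measurable
    also have "(\<integral>\<^sup>+x. \<integral>\<^sup>+t. ennreal (indicator {0<..<Y} t * (t powr \<alpha> * (p (x, t))\<^sup>2)) \<partial>lborel \<partial>lborel)
        = (\<integral>\<^sup>+z. ennreal (indicator (slab Y) z * (snd z powr \<alpha> * (p z)\<^sup>2)) \<partial>lborel)"
      by (subst nn_integral_lborel_prod_iterated[symmetric])
        (auto intro!: nn_integral_cong simp: slab_Pair_iff split: split_indicator)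
    finally show "(\<integral>\<^sup>+z. ?g z \<partial>lborel) \<le> ennreal (8 / (1 - \<alpha>)\<^sup>2) * (\<integral>\<^sup>+z. ennreal (indicator (slab Y) z * (snd z powr \<alpha> * (p z)\<^sup>2)) \<partial>lborel)" .
  qed
  finally show ?thesis .
qed

section \<open>A Hardy inequality without trace term in at least three horizontal dimensions\<close>

definition strip_weight :: "real \<Rightarrow> real \<Rightarrow> 'a::euclidean_space \<times> real \<Rightarrow> real" where
  "strip_weight \<alpha> Y z = indicator (slab Y) z * snd z powr \<alpha>"

lemma strip_weight_nonneg [simp]: "0 \<le> strip_weight \<alpha> Y z"
  by (simp add: strip_weight_def)

lemma measurable_strip_weight [measurable]: "strip_weight \<alpha> Y \<in> borel_measurable borel"
  unfolding strip_weight_def[abs_def] by measurable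

lemma strip_weight_translate: "strip_weight \<alpha> Y (z + t *\<^sub>R (v, 0)) = strip_weight \<alpha> Y z"
  by (auto simp: strip_weight_def slab_iff split: split_indicator)

text \<open>
  By Jensen's inequality the squared difference quotient is at most the average of the squared
  derivative over the segment; the weight depends on the height only, hence horizontal translations
  preserve the weighted integral.
\<close>

lemma horizontal_difference_quotient_le:
  fixes u g :: "'a::euclidean_space \<times> real \<Rightarrow> real"
  assumes [measurable]: "u \<in> borel_measurable borel" "g \<in> borel_measurable borel" and h: "0 < h"
    and diff: "AE z in lborel. z \<in> slab Y \<longrightarrow> u (z + h *\<^sub>R (v, 0)) - u z = (LINT t:{0..h}|lborel. g (z + t *\<^sub>R (v, 0)))"
  shows "(\<integral>\<^sup>+z. ennreal (strip_weight \<alpha> Y z * ((u (z + h *\<^sub>R (v, 0)) - u z) / h)\<^sup>2) \<partial>lborel)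
    \<le> (\<integral>\<^sup>+z. ennreal (strip_weight \<alpha> Y z * (g z)\<^sup>2) \<partial>lborel)"
proof -
  let ?v = "(v, 0 :: real)"
  let ?k = "\<lambda>z t. ennreal (1 / h * indicator {0<..<h} t) * ennreal (strip_weight \<alpha> Y z * (g (z + t *\<^sub>R ?v))\<^sup>2)"
  have "(\<integral>\<^sup>+z. ennreal (strip_weight \<alpha> Y z * ((u (z + h *\<^sub>R ?v) - u z) / h)\<^sup>2) \<partial>lborel)
      \<le> (\<integral>\<^sup>+z. \<integral>\<^sup>+t. ?k z t \<partial>lborel \<partial>lborel)"
  proof (rule nn_integral_mono_AE)
    show "AE z in lborel. ennreal (strip_weight \<alpha> Y z * ((u (z + h *\<^sub>R ?v) - u z) / h)\<^sup>2) \<le> (\<integral>\<^sup>+t. ?k z t \<partial>lborel)"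
      using diff
    proof eventually_elim
      fix z assume z: "z \<in> slab Y \<longrightarrow> u (z + h *\<^sub>R ?v) - u z = (LINT t:{0..h}|lborel. g (z + t *\<^sub>R ?v))"
      show "ennreal (strip_weight \<alpha> Y z * ((u (z + h *\<^sub>R ?v) - u z) / h)\<^sup>2) \<le> (\<integral>\<^sup>+t. ?k z t \<partial>lborel)"
      proof (cases "z \<in> slab Y")
        case True
        let ?g = "\<lambda>t. g (z + t *\<^sub>R ?v)"
        let ?D = "u (z + h *\<^sub>R ?v) - u z"
        have D: "?D = (LINT t|lborel. indicator {0..h} t * ?g t)"
          using z True by (simp add: set_lebesgue_integral_def)
        have "ennreal \<bar>?D\<bar> \<le> (\<integral>\<^sup>+t. ennreal \<bar>indicator {0..h} t * ?g t\<bar> \<partial>lborel)"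
        proof (cases "integrable lborel (\<lambda>t. indicator {0..h} t * ?g t)")
          case True
          from integral_norm_bound_ennreal[OF True] show ?thesis unfolding D real_norm_def .
        next
          case False
          then show ?thesis unfolding D by (simp add: not_integrable_integral_eq)
        qed
        also have "\<dots> = (\<integral>\<^sup>+t. ennreal (indicator {0<..<h} t * \<bar>?g t\<bar>) \<partial>lborel)"
        proof (rule nn_integral_cong_AE)
          show "AE t in lborel. ennreal \<bar>indicator {0..h} t * ?g t\<bar> = ennreal (indicator {0<..<h} t * \<bar>?g t\<bar>)"
            using AE_lborel_singleton[of "0::real"] AE_lborel_singleton[of h]
            by eventually_elim (auto split: split_indicator)
        qed
        finally have "(ennreal \<bar>?D\<bar>)\<^sup>2 \<le> (\<integral>\<^sup>+t. ennreal (indicator {0<..<h} t * \<bar>?g t\<bar>) \<partial>lborel)\<^sup>2"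
          by (rule power_mono) simp
        also have "\<dots> \<le> ennreal (h powr (1 - 0) / (1 - 0)) * (\<integral>\<^sup>+t. ennreal (indicator {0<..<h} t * (t powr 0 * (?g t)\<^sup>2)) \<partial>lborel)"
          by (rule weighted_Cauchy_Schwarz) (use h in auto)
        also have "(\<integral>\<^sup>+t. ennreal (indicator {0<..<h} t * (t powr 0 * (?g t)\<^sup>2)) \<partial>lborel) = (\<integral>\<^sup>+t. ennreal (indicator {0<..<h} t * (?g t)\<^sup>2) \<partial>lborel)"
          by (intro nn_integral_cong) (auto split: split_indicator)
        finally have sq: "ennreal (?D\<^sup>2) \<le> ennreal h * (\<integral>\<^sup>+t. ennreal (indicator {0<..<h} t * (?g t)\<^sup>2) \<partial>lborel)"
          using h by (simp add: ennreal_power)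
        let ?w = "strip_weight \<alpha> Y z"
        have "ennreal (?w * (?D / h)\<^sup>2) = ennreal (?w / h\<^sup>2) * ennreal (?D\<^sup>2)"
          by (simp add: power_divide ennreal_mult'[symmetric])
        also have "\<dots> \<le> ennreal (?w / h\<^sup>2) * (ennreal h * (\<integral>\<^sup>+t. ennreal (indicator {0<..<h} t * (?g t)\<^sup>2) \<partial>lborel))"
          by (intro mult_left_mono sq) simp
        also have "\<dots> = ennreal (?w / h) * (\<integral>\<^sup>+t. ennreal (indicator {0<..<h} t * (?g t)\<^sup>2) \<partial>lborel)"
        proof -
          have "ennreal (?w / h\<^sup>2) * ennreal h = ennreal (?w / h\<^sup>2 * h)" using h by (intro ennreal_mult[symmetric]) auto
          then show ?thesis using h by (simp add: mult.assoc[symmetric] power2_eq_square)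
        qed
        also have "\<dots> = (\<integral>\<^sup>+t. ennreal (?w / h) * ennreal (indicator {0<..<h} t * (?g t)\<^sup>2) \<partial>lborel)"
          by (rule nn_integral_cmult[symmetric]) measurable
        also have "\<dots> = (\<integral>\<^sup>+t. ?k z t \<partial>lborel)"
          by (rule nn_integral_cong) (use h in \<open>auto simp: ennreal_mult[symmetric] split: split_indicator\<close>)
        finally show ?thesis .
      qed (simp add: strip_weight_def)
    qed
  qed
  also have "\<dots> = (\<integral>\<^sup>+t. \<integral>\<^sup>+z. ?k z t \<partial>lborel \<partial>lborel)"
    by (rule lborel_pair.Fubini'[symmetric]) measurable
  also have "\<dots> = (\<integral>\<^sup>+t. ennreal (1 / h * indicator {0<..<h} t) * (\<integral>\<^sup>+z. ennreal (strip_weight \<alpha> Y z * (g z)\<^sup>2) \<partial>lborel) \<partial>lborel)"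
  proof (rule nn_integral_cong)
    fix t :: real
    have "(\<integral>\<^sup>+z. ?k z t \<partial>lborel) = ennreal (1 / h * indicator {0<..<h} t) * (\<integral>\<^sup>+z. ennreal (strip_weight \<alpha> Y z * (g (z + t *\<^sub>R ?v))\<^sup>2) \<partial>lborel)"
      by (rule nn_integral_cmult) measurable
    also have "(\<integral>\<^sup>+z. ennreal (strip_weight \<alpha> Y z * (g (z + t *\<^sub>R ?v))\<^sup>2) \<partial>lborel)
        = (\<integral>\<^sup>+z. ennreal (strip_weight \<alpha> Y (z + t *\<^sub>R ?v) * (g (z + t *\<^sub>R ?v))\<^sup>2) \<partial>lborel)"
      by (simp add: strip_weight_translate del: scaleR_Pair)
    also have "\<dots> = (\<integral>\<^sup>+z. ennreal (strip_weight \<alpha> Y z * (g z)\<^sup>2) \<partial>lborel)"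
      by (rule nn_integral_lborel_translate) measurable
    finally show "(\<integral>\<^sup>+z. ?k z t \<partial>lborel) = ennreal (1 / h * indicator {0<..<h} t) * (\<integral>\<^sup>+z. ennreal (strip_weight \<alpha> Y z * (g z)\<^sup>2) \<partial>lborel)" .
  qed
  also have "\<dots> = (\<integral>\<^sup>+t. ennreal (1 / h * indicator {0<..<h} t) \<partial>lborel) * (\<integral>\<^sup>+z. ennreal (strip_weight \<alpha> Y z * (g z)\<^sup>2) \<partial>lborel)"
    by (rule nn_integral_multc) measurable
  also have "(\<integral>\<^sup>+t. ennreal (1 / h * indicator {0<..<h} t) \<partial>lborel) = 1"
  proof -
    have "(\<integral>\<^sup>+t. ennreal (1 / h * indicator {0<..<h} t) \<partial>lborel) = (\<integral>\<^sup>+t. ennreal (1 / h) * indicator {0<..<h} t \<partial>lborel)"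
      by (intro nn_integral_cong) (auto split: split_indicator)
    also have "\<dots> = ennreal (1 / h) * ennreal h" using h by (simp add: nn_integral_cmult)
    also have "\<dots> = 1" using h by (simp add: ennreal_mult[symmetric])
    finally show ?thesis .
  qed
  finally show ?thesis by simp
qed

text \<open>
  Discrete integration by parts, \<open>\<integral> u\<^sup>2 (W - W(\<cdot> - h v)) = - \<integral> (u(\<cdot> + h v)\<^sup>2 - u\<^sup>2) W\<close>, followed by Young's inequality;
  the derivative of \<open>W\<close> appears as \<open>h\<close> tends to zero.
\<close>

lemma horizontal_Young_inequality:
  fixes u g :: "'a::euclidean_space \<times> real \<Rightarrow> real" and W :: "'a \<Rightarrow> real"
  assumes m[measurable]: "u \<in> borel_measurable borel" "g \<in> borel_measurable borel" and W: "test_function UNIV W"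
    and diff: "\<And>h. 0 < h \<Longrightarrow> AE z in lborel. z \<in> slab Y \<longrightarrow> u (z + h *\<^sub>R (v, 0)) - u z = (LINT t:{0..h}|lborel. g (z + t *\<^sub>R (v, 0)))"
    and ug: "\<And>R. integrable lborel (\<lambda>z. strip_weight \<alpha> Y z * (u z)\<^sup>2 * indicator (cball 0 R) (fst z))"
    and gg: "integrable lborel (\<lambda>z. strip_weight \<alpha> Y z * (g z)\<^sup>2)"
  shows "(LINT z|lborel. strip_weight \<alpha> Y z * (u z)\<^sup>2 * frechet_derivative W (at (fst z)) v)
    \<le> 2 * (LINT z|lborel. strip_weight \<alpha> Y z * (g z)\<^sup>2) + 1/2 * (LINT z|lborel. strip_weight \<alpha> Y z * (u z)\<^sup>2 * (W (fst z))\<^sup>2)"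
proof -
  let ?w = "strip_weight \<alpha> Y :: 'a \<times> real \<Rightarrow> real"
  let ?v = "(v, 0 :: real)"
  obtain K where K: "smooth W" "compact K" "\<And>z. z \<notin> K \<Longrightarrow> W z = 0"
    using W by (elim test_functionE) blast
  obtain C where C: "0 \<le> C" "\<forall>z. \<bar>W z\<bar> \<le> C" "\<forall>z w. \<bar>W w - W z\<bar> \<le> C * norm (w - z)"
    using test_function_bounds[OF W] by blast
  note C = C(1) C(2)[rule_format] C(3)[rule_format]
  obtain R0 where R0: "\<And>x. x \<in> K \<Longrightarrow> norm x \<le> R0" using compact_imp_bounded[OF K(2)] by (auto simp: bounded_iff)
  define R where "R = R0 + norm v"
  have W0: "W (x - h *\<^sub>R v) = 0" if "x \<notin> cball 0 R" "0 \<le> h" "h \<le> 1" for x h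
  proof (rule K(3), rule notI)
    assume "x - h *\<^sub>R v \<in> K"
    then have "norm (x - h *\<^sub>R v) \<le> R0" by (rule R0)
    moreover have "norm x \<le> norm (x - h *\<^sub>R v) + norm (h *\<^sub>R v)" using norm_triangle_ineq[of "x - h *\<^sub>R v" "h *\<^sub>R v"] by simp
    moreover have "norm (h *\<^sub>R v) \<le> norm v" using that by (simp add: mult_left_le_one_le)
    ultimately show False using that by (simp add: R_def)
  qed
  have [measurable]: "W \<in> borel_measurable borel" "(\<lambda>x. frechet_derivative W (at x) v) \<in> borel_measurable borel"
    using K(1) by (auto intro: smooth_borel smooth_frechet)
  define m0 where "m0 z = ?w z * (u z)\<^sup>2 * indicator (cball 0 R) (fst z)" for z
  have m0: "integrable lborel m0" unfolding m0_def[abs_def] by (rule ug)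
  have m0_nonneg: "0 \<le> m0 z" for z by (simp add: m0_def)
  have dom: "integrable lborel (\<lambda>z. ?w z * (u z)\<^sup>2 * \<psi> (fst z)) \<and> (\<forall>z. \<bar>?w z * (u z)\<^sup>2 * \<psi> (fst z)\<bar> \<le> B * m0 z)"
    if "\<psi> \<in> borel_measurable borel" "\<And>x. \<bar>\<psi> x\<bar> \<le> B" "\<And>x. x \<notin> cball 0 R \<Longrightarrow> \<psi> x = 0" for \<psi> :: "'a \<Rightarrow> real" and B
  proof
    have [measurable]: "\<psi> \<in> borel_measurable borel" by fact
    have le: "\<bar>?w z * (u z)\<^sup>2 * \<psi> (fst z)\<bar> \<le> B * m0 z" for z
      using mult_left_mono[OF that(2)[of "fst z"], of "?w z * (u z)\<^sup>2"] that(3)[of "fst z"]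
      by (auto simp: m0_def abs_mult mult.commute split: split_indicator)
    then show "\<forall>z. \<bar>?w z * (u z)\<^sup>2 * \<psi> (fst z)\<bar> \<le> B * m0 z" by simp
    show "integrable lborel (\<lambda>z. ?w z * (u z)\<^sup>2 * \<psi> (fst z))"
    proof (rule Bochner_Integration.integrable_bound)
      show "integrable lborel (\<lambda>z. B * m0 z)" using m0 by simp
      show "AE z in lborel. norm (?w z * (u z)\<^sup>2 * \<psi> (fst z)) \<le> norm (B * m0 z)"
        using le by (intro AE_I2) (auto intro: order_trans[OF _ abs_ge_self])
    qed measurable
  qed
  define A where "A h z = ?w z * (u z)\<^sup>2 * ((W (fst z) - W (fst z - h *\<^sub>R v)) / h)" for h z
  define S where "S h z = ?w z * (u z)\<^sup>2 * ((W (fst z - h *\<^sub>R v))\<^sup>2 + (W (fst z))\<^sup>2)" for h z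
  have qb: "\<bar>(W x - W (x - h *\<^sub>R v)) / h\<bar> \<le> C * norm v" "(W x - W (x - h *\<^sub>R v)) / h = 0 \<or> x \<in> cball 0 R" if "0 < h" "h \<le> 1" for x h
  proof -
    have "\<bar>W x - W (x - h *\<^sub>R v)\<bar> \<le> C * norm (h *\<^sub>R v)" using C(3)[of x "x - h *\<^sub>R v"] by simp
    then show "\<bar>(W x - W (x - h *\<^sub>R v)) / h\<bar> \<le> C * norm v" using that by (simp add: divide_le_eq mult.commute mult.left_commute)
    show "(W x - W (x - h *\<^sub>R v)) / h = 0 \<or> x \<in> cball 0 R" using W0[of x 0] W0[of x h] that by auto
  qed
  have sb: "\<bar>(W (x - h *\<^sub>R v))\<^sup>2 + (W x)\<^sup>2\<bar> \<le> 2 * C\<^sup>2" for x h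
  proof -
    have "(W y)\<^sup>2 \<le> C\<^sup>2" for y using C(2)[of y] C(1) by (simp add: abs_le_square_iff[symmetric])
    from add_mono[OF this[of "x - h *\<^sub>R v"] this[of x]] show ?thesis by simp
  qed
  have domA: "integrable lborel (A h) \<and> (\<forall>z. \<bar>A h z\<bar> \<le> C * norm v * m0 z)" if "0 < h" "h \<le> 1" for h
    unfolding A_def using qb[OF that] by (intro dom[of "\<lambda>x. (W x - W (x - h *\<^sub>R v)) / h"]) (auto simp: mult.assoc)
  have domS: "integrable lborel (S h) \<and> (\<forall>z. \<bar>S h z\<bar> \<le> 2 * C\<^sup>2 * m0 z)" if "0 < h" "h \<le> 1" for h
    unfolding S_def using sb W0[of _ 0] W0[of _ h] that
    by (intro dom[of "\<lambda>x. (W (x - h *\<^sub>R v))\<^sup>2 + (W x)\<^sup>2"]) auto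
  have step: "(LINT z|lborel. A h z) \<le> 2 * (LINT z|lborel. ?w z * (g z)\<^sup>2) + 1/4 * (LINT z|lborel. S h z)" if h: "0 < h" "h \<le> 1" for h
  proof -
    define q where "q z = (u (z + h *\<^sub>R ?v) - u z) / h" for z
    have [measurable]: "q \<in> borel_measurable borel" unfolding q_def[abs_def] by measurable
    have "(\<integral>\<^sup>+z. ennreal (?w z * (q z)\<^sup>2) \<partial>lborel) \<le> (\<integral>\<^sup>+z. ennreal (?w z * (g z)\<^sup>2) \<partial>lborel)"
      unfolding q_def by (rule horizontal_difference_quotient_le[OF m h(1) diff[OF h(1)]])
    also have "\<dots> = ennreal (LINT z|lborel. ?w z * (g z)\<^sup>2)"
      by (rule nn_integral_eq_integral[OF gg]) auto
    finally have nq: "(\<integral>\<^sup>+z. ennreal (?w z * (q z)\<^sup>2) \<partial>lborel) \<le> ennreal (LINT z|lborel. ?w z * (g z)\<^sup>2)" .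
    have iq: "integrable lborel (\<lambda>z. ?w z * (q z)\<^sup>2)"
      using le_less_trans[OF nq] by (intro integrableI_bounded) auto
    have "ennreal (LINT z|lborel. ?w z * (q z)\<^sup>2) \<le> ennreal (LINT z|lborel. ?w z * (g z)\<^sup>2)"
      using nq by (subst nn_integral_eq_integral[OF iq, symmetric]) auto
    then have q_le: "(LINT z|lborel. ?w z * (q z)\<^sup>2) \<le> (LINT z|lborel. ?w z * (g z)\<^sup>2)"
      by (subst (asm) ennreal_le_iff) (auto intro!: integral_nonneg_AE)
    have shift: "integrable lborel (\<lambda>z. ?w z * (u (z + h *\<^sub>R ?v))\<^sup>2 * \<psi> (fst z)) \<and>
        (LINT z|lborel. ?w z * (u (z + h *\<^sub>R ?v))\<^sup>2 * \<psi> (fst z)) = (LINT z|lborel. ?w z * (u z)\<^sup>2 * \<psi> (fst z - h *\<^sub>R v))"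
      if "\<psi> \<in> borel_measurable borel" "integrable lborel (\<lambda>z. ?w z * (u z)\<^sup>2 * \<psi> (fst z - h *\<^sub>R v))" for \<psi> :: "'a \<Rightarrow> real"
    proof -
      have [measurable]: "\<psi> \<in> borel_measurable borel" by fact
      have eq: "?w z * (u (z + h *\<^sub>R ?v))\<^sup>2 * \<psi> (fst z) = ?w (z + h *\<^sub>R ?v) * (u (z + h *\<^sub>R ?v))\<^sup>2 * \<psi> (fst (z + h *\<^sub>R ?v) - h *\<^sub>R v)" for z
        unfolding strip_weight_translate by simp
      have mf: "(\<lambda>z. ?w z * (u z)\<^sup>2 * \<psi> (fst z - h *\<^sub>R v)) \<in> borel_measurable borel" by measurable
      show ?thesis
        unfolding eq using integral_lborel_translate[OF mf, of "h *\<^sub>R ?v"] integrable_lborel_translate[OF mf, of "h *\<^sub>R ?v"] that(2)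
        by (simp only:) 
    qed
    have iW: "integrable lborel (\<lambda>z. ?w z * (u z)\<^sup>2 * W (fst z - h' *\<^sub>R v))" "integrable lborel (\<lambda>z. ?w z * (u z)\<^sup>2 * (W (fst z - h' *\<^sub>R v))\<^sup>2)"
      if "0 \<le> h'" "h' \<le> 1" for h'
    proof -
      have "(W y)\<^sup>2 \<le> C\<^sup>2" for y using C(2)[of y] C(1) by (simp add: abs_le_square_iff[symmetric])
      then show "integrable lborel (\<lambda>z. ?w z * (u z)\<^sup>2 * (W (fst z - h' *\<^sub>R v))\<^sup>2)"
        using dom[of "\<lambda>x. (W (x - h' *\<^sub>R v))\<^sup>2" "C\<^sup>2"] W0[OF _ that] by simp
      show "integrable lborel (\<lambda>z. ?w z * (u z)\<^sup>2 * W (fst z - h' *\<^sub>R v))"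
        using dom[of "\<lambda>x. W (x - h' *\<^sub>R v)" C] C(2) W0[OF _ that] by simp
    qed
    have iWh: "integrable lborel (\<lambda>z. ?w z * (u z)\<^sup>2 * W (fst z - h *\<^sub>R v))" "integrable lborel (\<lambda>z. ?w z * (u z)\<^sup>2 * (W (fst z - h *\<^sub>R v))\<^sup>2)"
      using iW[of h] h by auto
    have iW0: "integrable lborel (\<lambda>z. ?w z * (u z)\<^sup>2 * W (fst z))" "integrable lborel (\<lambda>z. ?w z * (u z)\<^sup>2 * (W (fst z))\<^sup>2)"
      using iW[of 0] by auto
    note s1 = shift[OF _ iWh(1)] and s2 = shift[of "\<lambda>x. (W x)\<^sup>2", OF _ iWh(2)]
    have "(LINT z|lborel. A h z) = ((LINT z|lborel. ?w z * (u z)\<^sup>2 * W (fst z)) - (LINT z|lborel. ?w z * (u z)\<^sup>2 * W (fst z - h *\<^sub>R v))) / h"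
    proof -
      have "A h = (\<lambda>z. (?w z * (u z)\<^sup>2 * W (fst z) - ?w z * (u z)\<^sup>2 * W (fst z - h *\<^sub>R v)) / h)"
        by (auto simp: A_def fun_eq_iff right_diff_distrib)
      then show ?thesis using iW0(1) iWh(1) by simp
    qed
    also have "\<dots> = ((LINT z|lborel. ?w z * (u z)\<^sup>2 * W (fst z)) - (LINT z|lborel. ?w z * (u (z + h *\<^sub>R ?v))\<^sup>2 * W (fst z))) / h"
      using s1 by simp
    also have "\<dots> = (LINT z|lborel. (?w z * (u z)\<^sup>2 * W (fst z) - ?w z * (u (z + h *\<^sub>R ?v))\<^sup>2 * W (fst z)) / h)"
      using s1 iW0(1) by simp
    also have "\<dots> \<le> (LINT z|lborel. 2 * (?w z * (q z)\<^sup>2) + 1/4 * (?w z * (u (z + h *\<^sub>R ?v))\<^sup>2 * (W (fst z))\<^sup>2 + ?w z * (u z)\<^sup>2 * (W (fst z))\<^sup>2))"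
    proof (rule integral_mono)
      show "integrable lborel (\<lambda>z. (?w z * (u z)\<^sup>2 * W (fst z) - ?w z * (u (z + h *\<^sub>R ?v))\<^sup>2 * W (fst z)) / h)"
        using s1 iW0(1) by simp
      show "integrable lborel (\<lambda>z. 2 * (?w z * (q z)\<^sup>2) + 1/4 * (?w z * (u (z + h *\<^sub>R ?v))\<^sup>2 * (W (fst z))\<^sup>2 + ?w z * (u z)\<^sup>2 * (W (fst z))\<^sup>2))"
        using iq s2 iW0(2) by (intro Bochner_Integration.integrable_add integrable_mult_right) auto
      fix z
      let ?a = "u z" and ?b = "u (z + h *\<^sub>R ?v)" and ?W = "W (fst z)"
      have b: "?b - ?a = h * q z" using h by (simp add: q_def)
      have "(?w z * ?a\<^sup>2 * ?W - ?w z * ?b\<^sup>2 * ?W) / h = ?w z * (- (q z) * ((?b + ?a) * ?W))"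
      proof -
        have "?a\<^sup>2 - ?b\<^sup>2 = - (h * q z) * (?b + ?a)" unfolding b[symmetric] by (simp add: power2_eq_square algebra_simps)
        then have "?w z * ?a\<^sup>2 * ?W - ?w z * ?b\<^sup>2 * ?W = ?w z * (- (h * q z) * (?b + ?a)) * ?W"
          by (simp only: right_diff_distrib[symmetric] left_diff_distrib[symmetric])
        then show ?thesis using h by simp
      qed
      also have "\<dots> \<le> ?w z * (2 * (q z)\<^sup>2 + 1/4 * (?b\<^sup>2 * ?W\<^sup>2 + ?a\<^sup>2 * ?W\<^sup>2))"
      proof (rule mult_left_mono)
        have y: "- x * y \<le> 2 * x\<^sup>2 + y\<^sup>2 / 8" for x y :: real
          using zero_le_power2[of "4 * x + y"] by (simp add: power2_eq_square algebra_simps)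
        have "((?b + ?a) * ?W)\<^sup>2 / 8 \<le> (2 * ?b\<^sup>2 + 2 * ?a\<^sup>2) * ?W\<^sup>2 / 8"
          using square_diff_le[of ?b "- ?a"] by (simp add: power_mult_distrib mult_right_mono)
        also have "\<dots> = 1/4 * (?b\<^sup>2 * ?W\<^sup>2 + ?a\<^sup>2 * ?W\<^sup>2)" by (simp add: algebra_simps)
        finally show "- (q z) * ((?b + ?a) * ?W) \<le> 2 * (q z)\<^sup>2 + 1/4 * (?b\<^sup>2 * ?W\<^sup>2 + ?a\<^sup>2 * ?W\<^sup>2)"
          using y[of "q z" "(?b + ?a) * ?W"] by linarith
      qed simp
      finally show "(?w z * ?a\<^sup>2 * ?W - ?w z * ?b\<^sup>2 * ?W) / h \<le> 2 * (?w z * (q z)\<^sup>2) + 1/4 * (?w z * ?b\<^sup>2 * ?W\<^sup>2 + ?w z * ?a\<^sup>2 * ?W\<^sup>2)"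
        by (simp add: algebra_simps)
    qed
    also have "\<dots> = 2 * (LINT z|lborel. ?w z * (q z)\<^sup>2) + 1/4 * ((LINT z|lborel. ?w z * (u z)\<^sup>2 * (W (fst z - h *\<^sub>R v))\<^sup>2) + (LINT z|lborel. ?w z * (u z)\<^sup>2 * (W (fst z))\<^sup>2))"
      using iq s2 iW0(2) by simp
    also have "(LINT z|lborel. ?w z * (u z)\<^sup>2 * (W (fst z - h *\<^sub>R v))\<^sup>2) + (LINT z|lborel. ?w z * (u z)\<^sup>2 * (W (fst z))\<^sup>2) = (LINT z|lborel. S h z)"
      unfolding S_def using iWh(2) iW0(2) by (simp add: distrib_left)
    finally show ?thesis using q_le by linarith
  qed
  define h where "h n = inverse (real (Suc n))" for n
  have h: "0 < h n" "h n \<le> 1" for n by (auto simp: h_def inverse_le_1_iff)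
  have h0: "h \<longlonglongrightarrow> 0" unfolding h_def[abs_def] by (rule LIMSEQ_inverse_real_of_nat)
  have limA: "(\<lambda>n. LINT z|lborel. A (h n) z) \<longlonglongrightarrow> (LINT z|lborel. ?w z * (u z)\<^sup>2 * frechet_derivative W (at (fst z)) v)"
  proof (rule integral_dominated_convergence)
    show "integrable lborel (\<lambda>z. C * norm v * m0 z)" using m0 by simp
    show "AE z in lborel. norm (A (h n) z) \<le> C * norm v * m0 z" for n using domA[OF h] by auto
    show "A (h n) \<in> borel_measurable lborel" for n
      by (rule borel_measurable_integrable[OF conjunct1[OF domA[OF h]]])
    have "(\<lambda>n. (W x - W (x - h n *\<^sub>R v)) / h n) \<longlonglongrightarrow> frechet_derivative W (at x) v" for x
    proof -
      have "((\<lambda>t. x + t *\<^sub>R v) has_derivative (\<lambda>r. r *\<^sub>R v)) (at 0)" by (auto intro!: derivative_eq_intros)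
      then have "((\<lambda>t. W (x + t *\<^sub>R v)) has_derivative (\<lambda>r. frechet_derivative W (at (x + 0 *\<^sub>R v)) (r *\<^sub>R v))) (at 0)"
        by (rule has_derivative_compose[OF _ smooth_has_derivative[OF K(1)]])
      moreover have "frechet_derivative W (at x) (r *\<^sub>R v) = frechet_derivative W (at x) v * r" for r
        using linear_cmul[OF has_derivative_linear[OF smooth_has_derivative[OF K(1)]]] by simp
      ultimately have "((\<lambda>t. W (x + t *\<^sub>R v)) has_real_derivative frechet_derivative W (at x) v) (at 0)"
        by (simp add: has_field_derivative_def)
      then have "((\<lambda>t. (W (x + t *\<^sub>R v) - W x) / t) \<longlongrightarrow> frechet_derivative W (at x) v) (at 0)"
        by (simp add: has_field_derivative_iff)
      moreover have "filterlim (\<lambda>n. - h n) (at 0) sequentially"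
      proof -
        have "h n \<noteq> 0" for n using h(1)[of n] by simp
        then show ?thesis using tendsto_minus[OF h0] by (simp add: filterlim_at)
      qed
      ultimately have "(\<lambda>n. (W (x + (- h n) *\<^sub>R v) - W x) / (- h n)) \<longlonglongrightarrow> frechet_derivative W (at x) v"
        by (rule filterlim_compose)
      moreover have "(W (x + (- h n) *\<^sub>R v) - W x) / (- h n) = (W x - W (x - h n *\<^sub>R v)) / h n" for n
        using minus_divide_divide[of "W x - W (x - h n *\<^sub>R v)" "h n"] by simp
      ultimately show ?thesis by simp
    qed
    then show "AE z in lborel. (\<lambda>n. A (h n) z) \<longlonglongrightarrow> ?w z * (u z)\<^sup>2 * frechet_derivative W (at (fst z)) v"
      unfolding A_def by (intro AE_I2 tendsto_mult tendsto_const)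
  qed measurable
  have limS: "(\<lambda>n. LINT z|lborel. S (h n) z) \<longlonglongrightarrow> (LINT z|lborel. ?w z * (u z)\<^sup>2 * ((W (fst z))\<^sup>2 + (W (fst z))\<^sup>2))"
  proof (rule integral_dominated_convergence)
    show "integrable lborel (\<lambda>z. 2 * C\<^sup>2 * m0 z)" using m0 by simp
    show "AE z in lborel. norm (S (h n) z) \<le> 2 * C\<^sup>2 * m0 z" for n using domS[OF h] by auto
    show "S (h n) \<in> borel_measurable lborel" for n
      by (rule borel_measurable_integrable[OF conjunct1[OF domS[OF h]]])
    have "(\<lambda>n. W (x - h n *\<^sub>R v)) \<longlonglongrightarrow> W (x - 0 *\<^sub>R v)" for x
      using smooth_continuous[OF K(1), of UNIV] h0
      by (intro isCont_tendsto_compose[of _ W] tendsto_intros) (auto simp: continuous_on_eq_continuous_at)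
    then show "AE z in lborel. (\<lambda>n. S (h n) z) \<longlonglongrightarrow> ?w z * (u z)\<^sup>2 * ((W (fst z))\<^sup>2 + (W (fst z))\<^sup>2)"
      unfolding S_def by (intro AE_I2 tendsto_intros) auto
  qed measurable
  have "(LINT z|lborel. ?w z * (u z)\<^sup>2 * frechet_derivative W (at (fst z)) v)
    \<le> 2 * (LINT z|lborel. ?w z * (g z)\<^sup>2) + 1/4 * (LINT z|lborel. ?w z * (u z)\<^sup>2 * ((W (fst z))\<^sup>2 + (W (fst z))\<^sup>2))"
    by (rule LIMSEQ_le[OF limA tendsto_add[OF tendsto_const tendsto_mult[OF tendsto_const limS]]])
      (use step[OF h] in blast)
  also have "(LINT z|lborel. ?w z * (u z)\<^sup>2 * ((W (fst z))\<^sup>2 + (W (fst z))\<^sup>2)) = 2 * (LINT z|lborel. ?w z * (u z)\<^sup>2 * (W (fst z))\<^sup>2)"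
    unfolding integral_mult_right_zero[symmetric] by (intro Bochner_Integration.integral_cong refl) simp
  finally show ?thesis by simp
qed

lemma sobolev_density_parts:
  assumes U: "has_weak_gradient_on U G (slab Y)"
    and fin: "set_integrable lebesgue (slab Y) (sobolev_density \<alpha> U G)"
  shows "integrable lebesgue (\<lambda>z. strip_weight \<alpha> Y z * (norm (G z))\<^sup>2)"
    and "integrable lebesgue (\<lambda>z. strip_weight \<alpha> Y z * (inverse ((rho z)\<^sup>2) * (U z)\<^sup>2))"
    and "(LINT z:slab Y|lebesgue. sobolev_density \<alpha> U G z)
      = (LINT z|lebesgue. strip_weight \<alpha> Y z * (norm (G z))\<^sup>2) + (LINT z|lebesgue. strip_weight \<alpha> Y z * (inverse ((rho z)\<^sup>2) * (U z)\<^sup>2))"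
proof -
  note [measurable] = has_weak_gradient_measurable[OF open_slab U] borel_imp_lebesgue[OF measurable_rho] borel_imp_lebesgue[OF measurable_snd_powr]
  have I: "integrable lebesgue (\<lambda>z. indicator (slab Y) z *\<^sub>R sobolev_density \<alpha> U G z)"
    using fin by (simp add: set_integrable_def)
  have e1: "strip_weight \<alpha> Y z * (norm (G z))\<^sup>2 = snd z powr \<alpha> * (norm (indicator (slab Y) z *\<^sub>R G z))\<^sup>2" for z
    by (auto simp: strip_weight_def split: split_indicator)
  have e2: "strip_weight \<alpha> Y z * (inverse ((rho z)\<^sup>2) * (U z)\<^sup>2) = snd z powr \<alpha> * (inverse ((rho z)\<^sup>2) * (indicator (slab Y) z *\<^sub>R U z)\<^sup>2)" for z
    by (auto simp: strip_weight_def split: split_indicator)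
  have split: "indicator (slab Y) z *\<^sub>R sobolev_density \<alpha> U G z
      = strip_weight \<alpha> Y z * (norm (G z))\<^sup>2 + strip_weight \<alpha> Y z * (inverse ((rho z)\<^sup>2) * (U z)\<^sup>2)" for z
    by (simp add: sobolev_density_def strip_weight_def algebra_simps)
  show i1: "integrable lebesgue (\<lambda>z. strip_weight \<alpha> Y z * (norm (G z))\<^sup>2)"
  proof (rule Bochner_Integration.integrable_bound[OF I])
    show "(\<lambda>z. strip_weight \<alpha> Y z * (norm (G z))\<^sup>2) \<in> borel_measurable lebesgue" unfolding e1 by measurable
  qed (unfold split, auto intro!: AE_I2)
  show i2: "integrable lebesgue (\<lambda>z. strip_weight \<alpha> Y z * (inverse ((rho z)\<^sup>2) * (U z)\<^sup>2))"
  proof (rule Bochner_Integration.integrable_bound[OF I])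
    show "(\<lambda>z. strip_weight \<alpha> Y z * (inverse ((rho z)\<^sup>2) * (U z)\<^sup>2)) \<in> borel_measurable lebesgue" unfolding e2 by measurable
  qed (unfold split, auto intro!: AE_I2)
  show "(LINT z:slab Y|lebesgue. sobolev_density \<alpha> U G z)
      = (LINT z|lebesgue. strip_weight \<alpha> Y z * (norm (G z))\<^sup>2) + (LINT z|lebesgue. strip_weight \<alpha> Y z * (inverse ((rho z)\<^sup>2) * (U z)\<^sup>2))"
    unfolding set_lebesgue_integral_def split using i1 i2 by simp
qed

text \<open>
  The scalar factor of the Hardy vector field \<open>x / (1 + \<bar>x\<bar>\<^sup>2)\<close>, cut off at distance of order \<open>R\<close> so that
  the components of the field are test functions.
\<close>

definition hardy_kernel :: "real \<Rightarrow> 'a::euclidean_space \<Rightarrow> real" where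
  "hardy_kernel R x = inverse (1 + (norm x)\<^sup>2) * cutoff ((norm x)\<^sup>2 / R\<^sup>2)"

lemma one_plus_norm_square_pos: "0 < 1 + (norm x)\<^sup>2"
  by (simp add: add_pos_nonneg)

lemma cutoff_derivative_eq_0:
  assumes "4 < t"
  shows "frechet_derivative cutoff (at t) v = 0"
proof -
  have "(cutoff has_derivative (\<lambda>_. 0)) (at t)"
    by (rule has_derivative_transform_within_open[of "\<lambda>_. 0" _ _ _ "{4<..}"]) (use assms in \<open>auto simp: cutoff_eq_0\<close>)
  then show ?thesis using frechet_derivative_at by metis
qed

lemma smooth_hardy_kernel: "smooth (hardy_kernel R :: 'a::euclidean_space \<Rightarrow> real)"
proof -
  have "smooth (\<lambda>x::'a. inverse (1 + (norm x)\<^sup>2) * cutoff ((norm x)\<^sup>2 * inverse (R\<^sup>2)))"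
    by (intro smooth_mult smooth_inverse smooth_add smooth_const smooth_norm_square smooth_compose[OF smooth_cutoff])
      (use one_plus_norm_square_pos less_irrefl in metis)
  then show ?thesis unfolding hardy_kernel_def[abs_def] divide_inverse .
qed

lemma test_function_hardy:
  fixes i :: "'a::euclidean_space"
  assumes "0 < R"
  shows "test_function UNIV (\<lambda>x. (x \<bullet> i) * hardy_kernel R x)"
proof (rule test_functionI[of _ "cball 0 (2 * R)"])
  show "smooth (\<lambda>x. (x \<bullet> i) * hardy_kernel R x)" by (intro smooth_mult smooth_inner smooth_hardy_kernel)
  fix z :: 'a assume "z \<notin> cball 0 (2 * R)"
  then have "(2 * R)\<^sup>2 \<le> (norm z)\<^sup>2" using assms by (intro power_mono) auto
  then have "4 \<le> (norm z)\<^sup>2 / R\<^sup>2" using assms by (simp add: field_simps)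
  then show "(z \<bullet> i) * hardy_kernel R z = 0" by (simp add: hardy_kernel_def cutoff_eq_0)
qed auto

text \<open>
  In dimension \<open>d\<close> the divergence of \<open>x / (1 + \<bar>x\<bar>\<^sup>2)\<close> is at least \<open>(d - 2) / (1 + \<bar>x\<bar>\<^sup>2)\<close>.  The cutoff adds a
  term supported in \<open>R \<le> \<bar>x\<bar> \<le> 2 R\<close>, which is again of order \<open>1 / (1 + \<bar>x\<bar>\<^sup>2)\<close>.
\<close>

lemma hardy_divergence_lower_bound:
  fixes x :: "'a::euclidean_space"
  assumes "0 < R" "3 \<le> DIM('a)" and C: "0 \<le> C" "\<And>t v. \<bar>frechet_derivative cutoff (at t) v\<bar> \<le> C * \<bar>v\<bar>"
    "\<And>t v. t < 1 \<Longrightarrow> frechet_derivative cutoff (at t) v = 0"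
  shows "hardy_kernel R x - 8 * C * (inverse (1 + (norm x)\<^sup>2) * (if R \<le> norm x then 1 else 0))
     \<le> (\<Sum>i\<in>Basis. frechet_derivative (\<lambda>x. (x \<bullet> i) * hardy_kernel R x) (at x) i)"
proof -
  define s where "s = (norm x)\<^sup>2"
  have s0: "0 \<le> s" by (simp add: s_def)
  define c' where "c' = frechet_derivative cutoff (at (s / R\<^sup>2)) 1"
  define \<psi>' where "\<psi>' = - (inverse (1 + s))\<^sup>2 * cutoff (s / R\<^sup>2) + inverse (1 + s) * (c' / R\<^sup>2)"
  have dc: "(cutoff has_real_derivative c') (at (s / R\<^sup>2))"
  proof -
    have "frechet_derivative cutoff (at (s / R\<^sup>2)) r = c' * r" for r
      using linear_cmul[OF has_derivative_linear[OF smooth_has_derivative[OF smooth_cutoff]], of "s / R\<^sup>2" r 1] by (simp add: c'_def)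
    then have "frechet_derivative cutoff (at (s / R\<^sup>2)) = (*) c'" by (rule ext)
    then show ?thesis using smooth_has_derivative[OF smooth_cutoff, of "s / R\<^sup>2"] by (simp add: has_field_derivative_def)
  qed
  have d\<psi>: "((\<lambda>s. inverse (1 + s) * cutoff (s / R\<^sup>2)) has_real_derivative \<psi>') (at s)"
  proof -
    have "((\<lambda>s. inverse (1 + s)) has_real_derivative - (inverse (1 + s))\<^sup>2) (at s)"
      using s0 by (auto intro!: derivative_eq_intros simp: power2_eq_square divide_inverse)
    moreover have "((\<lambda>s. cutoff (s / R\<^sup>2)) has_real_derivative c' * (1 / R\<^sup>2)) (at s)"
      by (rule DERIV_chain2[where f = cutoff and g = "\<lambda>s. s / R\<^sup>2" and x = s, OF dc DERIV_cdivide[OF DERIV_ident]])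
    ultimately show ?thesis
      unfolding \<psi>'_def by (rule DERIV_mult[THEN DERIV_cong]) (simp add: mult.commute)
  qed
  have dn: "((\<lambda>x. (norm x)\<^sup>2) has_derivative (\<lambda>v. 2 * (x \<bullet> v))) (at x)"
    unfolding power2_norm_eq_inner by (auto intro!: derivative_eq_intros simp: inner_commute)
  have dk: "(hardy_kernel R has_derivative (\<lambda>v. \<psi>' * (2 * (x \<bullet> v)))) (at x)"
  proof -
    have "((\<lambda>s. inverse (1 + s) * cutoff (s / R\<^sup>2)) has_derivative (\<lambda>r. \<psi>' * r)) (at ((norm x)\<^sup>2))"
      using d\<psi> by (simp add: has_field_derivative_def s_def)
    from has_derivative_compose[OF dn this] show ?thesis by (simp add: hardy_kernel_def[abs_def])
  qed
  have fd: "frechet_derivative (\<lambda>x. (x \<bullet> i) * hardy_kernel R x) (at x) i = hardy_kernel R x + 2 * \<psi>' * (x \<bullet> i)\<^sup>2"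
    if "i \<in> Basis" for i
  proof -
    have "((\<lambda>x. (x \<bullet> i) * hardy_kernel R x) has_derivative (\<lambda>v. (x \<bullet> i) * (\<psi>' * (2 * (x \<bullet> v))) + (v \<bullet> i) * hardy_kernel R x)) (at x)"
      by (intro has_derivative_mult dk bounded_linear_imp_has_derivative bounded_linear_inner_left)
    from frechet_derivative_at[OF this, symmetric] show ?thesis
      using that by (simp add: power2_eq_square algebra_simps)
  qed
  have sq: "(\<Sum>i\<in>Basis. (x \<bullet> i)\<^sup>2) = s"
    unfolding s_def power2_norm_eq_inner euclidean_inner[of x x] by (simp add: power2_eq_square)
  have sum: "(\<Sum>i\<in>Basis. frechet_derivative (\<lambda>x. (x \<bullet> i) * hardy_kernel R x) (at x) i) = DIM('a) * hardy_kernel R x + 2 * \<psi>' * s"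
    using fd by (simp add: sum.distrib sum_distrib_left[symmetric] sq)
  have k0: "0 \<le> hardy_kernel R x" using one_plus_norm_square_pos[of x] by (simp add: hardy_kernel_def cutoff_nonneg)
  have "3 * hardy_kernel R x \<le> DIM('a) * hardy_kernel R x" using assms(2) k0 by (intro mult_right_mono) auto
  moreover have "- (2 * hardy_kernel R x) - 8 * C * (inverse (1 + s) * (if R \<le> norm x then 1 else 0)) \<le> 2 * \<psi>' * s"
  proof -
    have a: "(inverse (1 + s))\<^sup>2 * cutoff (s / R\<^sup>2) * s \<le> hardy_kernel R x"
    proof -
      have "inverse (1 + s) * s \<le> 1" using s0 by (simp add: field_simps)
      from mult_right_mono[OF this k0] show ?thesis
        by (simp add: hardy_kernel_def s_def power2_eq_square mult_ac)
    qed
    have b: "\<bar>c' * (s / R\<^sup>2)\<bar> \<le> 4 * C * (if R \<le> norm x then 1 else 0)"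
    proof (cases "s / R\<^sup>2 < 1 \<or> 4 < s / R\<^sup>2")
      case True
      then have "c' = 0" using C(3) cutoff_derivative_eq_0 by (auto simp: c'_def)
      then show ?thesis using C(1) by simp
    next
      case False
      then have "1 \<le> s / R\<^sup>2" "s / R\<^sup>2 \<le> 4" by auto
      then have "R\<^sup>2 \<le> (norm x)\<^sup>2" using assms(1) by (simp add: s_def field_simps)
      then have R: "R \<le> norm x" using power2_le_imp_le[of R "norm x"] by simp
      have "\<bar>c'\<bar> * \<bar>s / R\<^sup>2\<bar> \<le> C * 4"
        using C(2)[of "s / R\<^sup>2" 1] \<open>s / R\<^sup>2 \<le> 4\<close> \<open>1 \<le> s / R\<^sup>2\<close> C(1) by (intro mult_mono) (auto simp: c'_def)
      then show ?thesis using R by (simp add: abs_mult)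
    qed
    have "2 * \<psi>' * s = - 2 * ((inverse (1 + s))\<^sup>2 * cutoff (s / R\<^sup>2) * s) + 2 * (inverse (1 + s) * (c' * (s / R\<^sup>2)))"
      by (simp add: \<psi>'_def algebra_simps)
    moreover have "- (inverse (1 + s) * (4 * C * (if R \<le> norm x then 1 else 0))) \<le> inverse (1 + s) * (c' * (s / R\<^sup>2))"
    proof -
      have "- (4 * C * (if R \<le> norm x then 1 else 0)) \<le> c' * (s / R\<^sup>2)" using abs_le_D2[OF b] by linarith
      from mult_left_mono[OF this, of "inverse (1 + s)"] s0 show ?thesis by simp
    qed
    moreover have "8 * C * (inverse (1 + s) * (if R \<le> norm x then 1 else 0)) = 2 * (inverse (1 + s) * (4 * C * (if R \<le> norm x then 1 else 0)))"
      by simp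
    ultimately show ?thesis using a by linarith
  qed
  ultimately show ?thesis unfolding sum by (simp add: s_def)
qed

lemma hardy_square_sum_le:
  fixes x :: "'a::euclidean_space"
  shows "(\<Sum>i\<in>Basis. ((x \<bullet> i) * hardy_kernel R x)\<^sup>2) \<le> hardy_kernel R x"
proof -
  define s where "s = (norm x)\<^sup>2"
  have s0: "0 \<le> s" by (simp add: s_def)
  have sq: "(\<Sum>i\<in>Basis. (x \<bullet> i)\<^sup>2) = s"
    unfolding s_def power2_norm_eq_inner euclidean_inner[of x x] by (simp add: power2_eq_square)
  have k0: "0 \<le> hardy_kernel R x" using one_plus_norm_square_pos[of x] by (simp add: hardy_kernel_def cutoff_nonneg)
  have "(\<Sum>i\<in>Basis. ((x \<bullet> i) * hardy_kernel R x)\<^sup>2) = (s * hardy_kernel R x) * hardy_kernel R x"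
    by (simp add: power_mult_distrib sum_distrib_right[symmetric] sq) (simp add: power2_eq_square mult.assoc)
  also have "\<dots> \<le> 1 * hardy_kernel R x"
  proof (rule mult_right_mono[OF _ k0])
    have "s * hardy_kernel R x = (s * inverse (1 + s)) * cutoff (s / R\<^sup>2)" by (simp add: hardy_kernel_def s_def)
    also have "\<dots> \<le> 1 * 1"
      using s0 cutoff_le_1 cutoff_nonneg by (intro mult_mono) (auto simp: field_simps)
    finally show "s * hardy_kernel R x \<le> 1" by simp
  qed
  finally show ?thesis by simp
qed

text \<open>
  The directional inequalities are added for the components of the cut-off Hardy field.  The sum of
  the squares of the components is at most the main term of the divergence, so that half of the
  left-hand side reappears on the right and is absorbed.  As \<open>R\<close> tends to infinity, the error of the cutoff
  vanishes, because \<open>U\<^sup>2 / (1 + \<bar>x\<bar>\<^sup>2)\<close> is integrable on a slab.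
\<close>

lemma horizontal_Hardy:
  fixes U :: "'a::euclidean_space \<times> real \<Rightarrow> real"
  assumes dim: "3 \<le> DIM('a)" and U: "has_weak_gradient_on U G (slab Y)" and "0 < Y"
    and fin: "set_integrable lebesgue (slab Y) (sobolev_density \<alpha> U G)"
  shows "(LINT z|lebesgue. strip_weight \<alpha> Y z * (inverse ((rho z)\<^sup>2) * (U z)\<^sup>2)) \<le> 4 * (LINT z|lebesgue. strip_weight \<alpha> Y z * (norm (G z))\<^sup>2)"
proof -
  let ?w = "strip_weight \<alpha> Y :: 'a \<times> real \<Rightarrow> real"
  note parts = sobolev_density_parts[OF U fin]
  note meas[measurable] = has_weak_gradient_measurable[OF open_slab U] borel_imp_lebesgue[OF measurable_strip_weight]
  define m where "m z = ?w z * (U z)\<^sup>2 * inverse (1 + (norm (fst z))\<^sup>2)" for z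
  have m_nonneg: "0 \<le> m z" for z using one_plus_norm_square_pos[of "fst z"] by (simp add: m_def)
  have mL: "(\<lambda>z. ?w z * (U z)\<^sup>2 * \<psi> (fst z)) \<in> borel_measurable lebesgue" if "\<psi> \<in> borel_measurable borel" for \<psi> :: "'a \<Rightarrow> real"
  proof -
    have [measurable]: "(\<lambda>z::'a \<times> real. \<psi> (fst z)) \<in> borel_measurable lebesgue"
      by (rule borel_imp_lebesgue) (use that in measurable)
    have "(\<lambda>z. ?w z * (U z)\<^sup>2 * \<psi> (fst z)) = (\<lambda>z. ?w z * (indicator (slab Y) z *\<^sub>R U z)\<^sup>2 * \<psi> (fst z))"
      by (auto simp: strip_weight_def fun_eq_iff split: split_indicator)
    also have "\<dots> \<in> borel_measurable lebesgue" by measurable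
    finally show ?thesis .
  qed
  have im: "integrable lebesgue m"
  proof (rule Bochner_Integration.integrable_bound)
    show "integrable lebesgue (\<lambda>z. (1 + Y\<^sup>2) * (?w z * (inverse ((rho z)\<^sup>2) * (U z)\<^sup>2)))" using parts(2) by simp
    show "m \<in> borel_measurable lebesgue" unfolding m_def[abs_def] by (rule mL) simp
    have "m z \<le> (1 + Y\<^sup>2) * (?w z * (inverse ((rho z)\<^sup>2) * (U z)\<^sup>2))" for z
    proof (cases "z \<in> slab Y")
      case True
      then have "(snd z)\<^sup>2 \<le> Y\<^sup>2" by (intro power_mono) (auto simp: slab_iff)
      moreover have "0 \<le> Y\<^sup>2 * (norm (fst z))\<^sup>2" by simp
      ultimately have "(rho z)\<^sup>2 \<le> (1 + Y\<^sup>2) * (1 + (norm (fst z))\<^sup>2)"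
        unfolding rho_square distrib_left distrib_right by linarith
      then have "inverse (1 + (norm (fst z))\<^sup>2) \<le> (1 + Y\<^sup>2) * inverse ((rho z)\<^sup>2)"
        using one_plus_norm_square_pos[of "fst z"] rho_pos[of z] by (simp add: field_simps)
      from mult_left_mono[OF this, of "?w z * (U z)\<^sup>2"] show ?thesis by (simp add: m_def mult_ac)
    qed (simp add: m_def strip_weight_def)
    then show "AE z in lebesgue. norm (m z) \<le> norm ((1 + Y\<^sup>2) * (?w z * (inverse ((rho z)\<^sup>2) * (U z)\<^sup>2)))"
      using m_nonneg by (intro AE_I2) (auto intro: order_trans[OF _ abs_ge_self])
  qed
  have int\<psi>: "integrable lebesgue (\<lambda>z. ?w z * (U z)\<^sup>2 * \<psi> (fst z))"
    if "\<psi> \<in> borel_measurable borel" "\<And>x. \<bar>\<psi> x\<bar> \<le> B * inverse (1 + (norm x)\<^sup>2)" for \<psi> :: "'a \<Rightarrow> real" and B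
  proof (rule Bochner_Integration.integrable_bound)
    show "integrable lebesgue (\<lambda>z. B * m z)" using im by simp
    show "(\<lambda>z. ?w z * (U z)\<^sup>2 * \<psi> (fst z)) \<in> borel_measurable lebesgue" by (rule mL) fact
    have "\<bar>?w z * (U z)\<^sup>2 * \<psi> (fst z)\<bar> \<le> B * m z" for z
      using mult_left_mono[OF that(2)[of "fst z"], of "?w z * (U z)\<^sup>2"] by (simp add: m_def abs_mult mult_ac)
    then show "AE z in lebesgue. norm (?w z * (U z)\<^sup>2 * \<psi> (fst z)) \<le> norm (B * m z)"
      by (intro AE_I2) (auto intro: order_trans[OF _ abs_ge_self])
  qed
  have intK: "integrable lebesgue (\<lambda>z. ?w z * (U z)\<^sup>2 * \<psi> (fst z))"
    if \<psi>: "\<psi> \<in> borel_measurable borel" "\<And>x. \<bar>\<psi> x\<bar> \<le> B" "\<And>x. x \<notin> cball 0 R \<Longrightarrow> \<psi> x = 0" "0 \<le> B" for \<psi> :: "'a \<Rightarrow> real" and B R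
  proof (rule int\<psi>[OF \<psi>(1), of "B * (1 + R\<^sup>2)"])
    fix x :: 'a
    show "\<bar>\<psi> x\<bar> \<le> B * (1 + R\<^sup>2) * inverse (1 + (norm x)\<^sup>2)"
    proof (cases "x \<in> cball 0 R")
      case True
      then have "(norm x)\<^sup>2 \<le> R\<^sup>2" by (intro power_mono) auto
      then have "1 \<le> (1 + R\<^sup>2) * inverse (1 + (norm x)\<^sup>2)" using one_plus_norm_square_pos[of x] by (simp add: field_simps)
      from mult_left_mono[OF this \<open>0 \<le> B\<close>] show ?thesis using \<psi>(2)[of x] by (simp add: mult.assoc)
    next
      case False
      then show ?thesis using \<psi>(3,4) one_plus_norm_square_pos[of x] by simp
    qed
  qed
  have mG: "(\<lambda>z. ?w z * (G z \<bullet> v)\<^sup>2) \<in> borel_measurable lebesgue" for v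
  proof -
    have "(\<lambda>z. ?w z * (G z \<bullet> v)\<^sup>2) = (\<lambda>z. ?w z * ((indicator (slab Y) z *\<^sub>R G z) \<bullet> v)\<^sup>2)"
      by (auto simp: strip_weight_def fun_eq_iff split: split_indicator)
    also have "\<dots> \<in> borel_measurable lebesgue" by measurable
    finally show ?thesis .
  qed
  have iG: "integrable lebesgue (\<lambda>z. ?w z * (G z \<bullet> (i, 0))\<^sup>2)" if "i \<in> Basis" for i
  proof (rule Bochner_Integration.integrable_bound[OF parts(1) mG])
    have "(G z \<bullet> (i, 0))\<^sup>2 \<le> (norm (G z))\<^sup>2" for z
      using Cauchy_Schwarz_ineq2[of "G z" "(i, 0)"] that by (simp add: norm_Pair abs_le_square_iff[symmetric])
    then show "AE z in lebesgue. norm (?w z * (G z \<bullet> (i, 0))\<^sup>2) \<le> norm (?w z * (norm (G z))\<^sup>2)"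
      by (intro AE_I2) (auto simp: abs_mult intro!: mult_left_mono)
  qed
  have dir: "(LINT z|lebesgue. ?w z * (U z)\<^sup>2 * frechet_derivative W (at (fst z)) i)
      \<le> 2 * (LINT z|lebesgue. ?w z * (G z \<bullet> (i, 0))\<^sup>2) + 1/2 * (LINT z|lebesgue. ?w z * (U z)\<^sup>2 * (W (fst z))\<^sup>2)"
    if i: "i \<in> Basis" and W: "test_function UNIV W" for i W
  proof -
    obtain u g where ug[measurable]: "u \<in> borel_measurable borel" "g \<in> borel_measurable borel"
      and uU: "AE z in lborel. z \<in> slab Y \<longrightarrow> u z = U z" and gG: "AE z in lborel. z \<in> slab Y \<longrightarrow> g z = G z \<bullet> (i, 0)"
      using has_weak_gradient_borelE[OF open_slab U, of "(i, 0)"] by blast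
    have [measurable]: "W \<in> borel_measurable borel" "(\<lambda>x. frechet_derivative W (at x) i) \<in> borel_measurable borel"
      using W by (auto simp: test_function_def intro: smooth_borel smooth_frechet)
    have tr: "integrable lborel (\<lambda>z. ?w z * (u z)\<^sup>2 * \<psi> (fst z)) = integrable lebesgue (\<lambda>z. ?w z * (U z)\<^sup>2 * \<psi> (fst z)) \<and>
        (LINT z|lborel. ?w z * (u z)\<^sup>2 * \<psi> (fst z)) = (LINT z|lebesgue. ?w z * (U z)\<^sup>2 * \<psi> (fst z))"
      if "\<psi> \<in> borel_measurable borel" for \<psi> :: "'a \<Rightarrow> real"
    proof -
      have [measurable]: "\<psi> \<in> borel_measurable borel" by fact
      have b: "(\<lambda>z. ?w z * (u z)\<^sup>2 * \<psi> (fst z)) \<in> borel_measurable borel" by measurable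
      have ae: "AE z in lebesgue. ?w z * (u z)\<^sup>2 * \<psi> (fst z) = ?w z * (U z)\<^sup>2 * \<psi> (fst z)"
        using AE_completion[OF uU] by eventually_elim (auto simp: strip_weight_def split: split_indicator)
      show ?thesis
        using integrable_cong_AE[OF borel_imp_lebesgue[OF b] mL[OF that] ae] integral_cong_AE[OF borel_imp_lebesgue[OF b] mL[OF that] ae] b
        by (simp add: integrable_completion integral_completion)
    qed
    have trg: "integrable lborel (\<lambda>z. ?w z * (g z)\<^sup>2) \<and> (LINT z|lborel. ?w z * (g z)\<^sup>2) = (LINT z|lebesgue. ?w z * (G z \<bullet> (i, 0))\<^sup>2)"
    proof -
      have b: "(\<lambda>z. ?w z * (g z)\<^sup>2) \<in> borel_measurable borel" by measurable
      have ae: "AE z in lebesgue. ?w z * (g z)\<^sup>2 = ?w z * (G z \<bullet> (i, 0))\<^sup>2"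
        using AE_completion[OF gG] by eventually_elim (auto simp: strip_weight_def split: split_indicator)
      show ?thesis
        using integrable_cong_AE[OF borel_imp_lebesgue[OF b] mG ae] integral_cong_AE[OF borel_imp_lebesgue[OF b] mG ae] b iG[OF i]
        by (simp add: integrable_completion integral_completion)
    qed
    have "(LINT z|lborel. ?w z * (u z)\<^sup>2 * frechet_derivative W (at (fst z)) i)
      \<le> 2 * (LINT z|lborel. ?w z * (g z)\<^sup>2) + 1/2 * (LINT z|lborel. ?w z * (u z)\<^sup>2 * (W (fst z))\<^sup>2)"
    proof (rule horizontal_Young_inequality[OF ug W])
      show "AE z in lborel. z \<in> slab Y \<longrightarrow> u (z + h *\<^sub>R (i, 0)) - u z = (LINT t:{0..h}|lborel. g (z + t *\<^sub>R (i, 0)))" if "0 < h" for h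
        by (rule weak_difference_formula[OF open_slab U ug uU gG open_slab]) (use that in \<open>auto simp: slab_iff\<close>)
      have "integrable lebesgue (\<lambda>z. ?w z * (U z)\<^sup>2 * indicator (cball 0 R) (fst z))" for R
        by (rule intK[of "indicator (cball 0 R)" 1 R]) (auto intro!: borel_measurable_indicator split: split_indicator)
      then show "integrable lborel (\<lambda>z. ?w z * (u z)\<^sup>2 * indicator (cball 0 R) (fst z))" for R
        using tr[OF borel_measurable_indicator[of "cball 0 R" borel]] by simp
    qed (use trg in blast)
    then show ?thesis
      using tr[of "\<lambda>x. frechet_derivative W (at x) i"] tr[of "\<lambda>x. (W x)\<^sup>2"] trg by simp
  qed
  obtain C where C: "0 \<le> C" "\<And>t v. \<bar>frechet_derivative cutoff (at t) v\<bar> \<le> C * \<bar>v\<bar>"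
    "\<And>t v. t < 1 \<Longrightarrow> frechet_derivative cutoff (at t) v = 0"
    using cutoff_derivative_bound by metis
  define ind where "ind R z = m z * (if R \<le> norm (fst z) then 1 else 0)" for R :: real and z
  define cut where "cut R z = m z * cutoff ((norm (fst z))\<^sup>2 / R\<^sup>2)" for R z
  have cut_eq: "cut R z = ?w z * (U z)\<^sup>2 * hardy_kernel R (fst z)" for R z
    by (simp add: cut_def m_def hardy_kernel_def)
  have [measurable]: "m \<in> borel_measurable lebesgue" using im by auto
  have fstL: "(\<lambda>z::'a \<times> real. \<psi> (fst z)) \<in> borel_measurable lebesgue" if "\<psi> \<in> borel_measurable borel" for \<psi> :: "'a \<Rightarrow> real"
    by (rule borel_imp_lebesgue) (use that in measurable)
  have cut_meas: "cut R \<in> borel_measurable lebesgue" for R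
    unfolding cut_def[abs_def]
    by (intro borel_measurable_times fstL[of "\<lambda>x. cutoff ((norm x)\<^sup>2 / R\<^sup>2)"] measurable_compose[OF _ smooth_borel[OF smooth_cutoff]]) auto
  have ind_meas: "ind R \<in> borel_measurable lebesgue" for R
    unfolding ind_def[abs_def]
    by (intro borel_measurable_times fstL[of "\<lambda>x. if R \<le> norm x then 1 else 0"]) auto
  have cut_le: "\<bar>cut R z\<bar> \<le> m z" and ind_le: "\<bar>ind R z\<bar> \<le> m z" for R z
    using m_nonneg[of z] cutoff_nonneg cutoff_le_1 by (auto simp: cut_def ind_def abs_mult mult_left_le)
  have icut: "integrable lebesgue (cut R)" and iind: "integrable lebesgue (ind R)" for R
    by (rule Bochner_Integration.integrable_bound[OF im], use cut_meas ind_meas cut_le ind_le m_nonneg in \<open>auto intro!: AE_I2\<close>)+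
  have main: "(LINT z|lebesgue. cut R z) - 8 * C * (LINT z|lebesgue. ind R z)
      \<le> 2 * (LINT z|lebesgue. ?w z * (norm (G z))\<^sup>2) + 1/2 * (LINT z|lebesgue. cut R z)" if "0 < R" for R
  proof -
    let ?W = "\<lambda>i x::'a. (x \<bullet> i) * hardy_kernel R x"
    note t = test_function_hardy[OF that]
    have bdd: "\<exists>B\<ge>0. \<forall>x. \<bar>frechet_derivative (?W i) (at x) i\<bar> \<le> B \<and> \<bar>(?W i x)\<^sup>2\<bar> \<le> B" for i
    proof -
      obtain B where B: "0 \<le> B" "\<forall>x. \<bar>?W i x\<bar> \<le> B" "\<forall>z v. \<bar>frechet_derivative (?W i) (at z) v\<bar> \<le> B * norm v"
        using test_function_bounds[OF t[of i]] by blast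
      have "(?W i x)\<^sup>2 \<le> B\<^sup>2" for x using B(1) B(2)[rule_format, of x] by (simp add: abs_le_square_iff[symmetric])
      then show ?thesis using B by (intro exI[of _ "max (B * norm i) (B\<^sup>2)"]) (auto simp: le_max_iff_disj)
    qed
    have supp: "frechet_derivative (?W i) (at x) i = 0" "(?W i x)\<^sup>2 = 0" if "x \<notin> cball 0 (2 * R)" for i x
    proof -
      have out: "?W i y = 0" if "y \<notin> cball 0 (2 * R)" for y
      proof -
        have "(2 * R)\<^sup>2 \<le> (norm y)\<^sup>2" using that \<open>0 < R\<close> by (intro power_mono) auto
        then have "4 \<le> (norm y)\<^sup>2 / R\<^sup>2" using \<open>0 < R\<close> by (simp add: field_simps)
        then show ?thesis by (simp add: hardy_kernel_def cutoff_eq_0)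
      qed
      then show "(?W i x)\<^sup>2 = 0" using that by simp
      have "(?W i has_derivative (\<lambda>_. 0)) (at x)"
        by (rule has_derivative_transform_within_open[of "\<lambda>_. 0" _ _ _ "- cball 0 (2 * R)"]) (use that out in auto)
      then show "frechet_derivative (?W i) (at x) i = 0" using frechet_derivative_at by metis
    qed
    have [measurable]: "?W i \<in> borel_measurable borel" "(\<lambda>x. frechet_derivative (?W i) (at x) i) \<in> borel_measurable borel" for i
      using t[of i] by (auto simp: test_function_def intro: smooth_borel smooth_frechet)
    have iD: "integrable lebesgue (\<lambda>z. ?w z * (U z)\<^sup>2 * frechet_derivative (?W i) (at (fst z)) i)" for i
    proof -
      obtain B where "B \<ge> 0" "\<forall>x. \<bar>frechet_derivative (?W i) (at x) i\<bar> \<le> B \<and> \<bar>(?W i x)\<^sup>2\<bar> \<le> B" using bdd by blast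
      then show ?thesis by (intro intK[of "\<lambda>x. frechet_derivative (?W i) (at x) i" B "2 * R"]) (use supp in auto)
    qed
    have iS: "integrable lebesgue (\<lambda>z. ?w z * (U z)\<^sup>2 * (?W i (fst z))\<^sup>2)" for i
    proof -
      obtain B where "B \<ge> 0" "\<forall>x. \<bar>frechet_derivative (?W i) (at x) i\<bar> \<le> B \<and> \<bar>(?W i x)\<^sup>2\<bar> \<le> B" using bdd by blast
      then show ?thesis by (intro intK[of "\<lambda>x. (?W i x)\<^sup>2" B "2 * R"]) (use supp in auto)
    qed
    have "(LINT z|lebesgue. cut R z) - 8 * C * (LINT z|lebesgue. ind R z) = (LINT z|lebesgue. cut R z - 8 * C * ind R z)"
      using icut iind by simp
    also have "\<dots> \<le> (LINT z|lebesgue. (\<Sum>i\<in>Basis. ?w z * (U z)\<^sup>2 * frechet_derivative (?W i) (at (fst z)) i))"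
    proof (rule integral_mono)
      show "integrable lebesgue (\<lambda>z. cut R z - 8 * C * ind R z)" using icut iind by simp
      show "integrable lebesgue (\<lambda>z. \<Sum>i\<in>Basis. ?w z * (U z)\<^sup>2 * frechet_derivative (?W i) (at (fst z)) i)"
        using iD by (intro Bochner_Integration.integrable_sum)
      fix z
      have "?w z * (U z)\<^sup>2 * (hardy_kernel R (fst z) - 8 * C * (inverse (1 + (norm (fst z))\<^sup>2) * (if R \<le> norm (fst z) then 1 else 0)))
        \<le> ?w z * (U z)\<^sup>2 * (\<Sum>i\<in>Basis. frechet_derivative (?W i) (at (fst z)) i)"
        by (intro mult_left_mono hardy_divergence_lower_bound[OF that dim C]) auto
      then show "cut R z - 8 * C * ind R z \<le> (\<Sum>i\<in>Basis. ?w z * (U z)\<^sup>2 * frechet_derivative (?W i) (at (fst z)) i)"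
        unfolding sum_distrib_left[symmetric] cut_eq ind_def m_def by (simp add: right_diff_distrib mult_ac)
    qed
    also have "\<dots> = (\<Sum>i\<in>Basis. (LINT z|lebesgue. ?w z * (U z)\<^sup>2 * frechet_derivative (?W i) (at (fst z)) i))"
      using iD by (intro Bochner_Integration.integral_sum)
    also have "\<dots> \<le> (\<Sum>i\<in>Basis. 2 * (LINT z|lebesgue. ?w z * (G z \<bullet> (i, 0))\<^sup>2) + 1/2 * (LINT z|lebesgue. ?w z * (U z)\<^sup>2 * (?W i (fst z))\<^sup>2))"
      by (intro sum_mono dir t)
    also have "\<dots> = 2 * (LINT z|lebesgue. (\<Sum>i\<in>Basis. ?w z * (G z \<bullet> (i, 0))\<^sup>2)) + 1/2 * (LINT z|lebesgue. (\<Sum>i\<in>Basis. ?w z * (U z)\<^sup>2 * (?W i (fst z))\<^sup>2))"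
    proof -
      have "(LINT z|lebesgue. (\<Sum>i\<in>Basis. ?w z * (G z \<bullet> (i, 0))\<^sup>2)) = (\<Sum>i\<in>Basis. (LINT z|lebesgue. ?w z * (G z \<bullet> (i, 0))\<^sup>2))"
        using iG by (intro Bochner_Integration.integral_sum)
      moreover have "(LINT z|lebesgue. (\<Sum>i\<in>Basis. ?w z * (U z)\<^sup>2 * (?W i (fst z))\<^sup>2)) = (\<Sum>i\<in>Basis. (LINT z|lebesgue. ?w z * (U z)\<^sup>2 * (?W i (fst z))\<^sup>2))"
        using iS by (intro Bochner_Integration.integral_sum)
      ultimately show ?thesis by (simp only: sum.distrib sum_distrib_left)
    qed
    also have "\<dots> \<le> 2 * (LINT z|lebesgue. ?w z * (norm (G z))\<^sup>2) + 1/2 * (LINT z|lebesgue. cut R z)"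
    proof (intro add_mono mult_left_mono)
      show "(LINT z|lebesgue. (\<Sum>i\<in>Basis. ?w z * (G z \<bullet> (i, 0))\<^sup>2)) \<le> (LINT z|lebesgue. ?w z * (norm (G z))\<^sup>2)"
      proof (rule integral_mono)
        show "integrable lebesgue (\<lambda>z. \<Sum>i\<in>Basis. ?w z * (G z \<bullet> (i, 0))\<^sup>2)" using iG by (intro Bochner_Integration.integrable_sum)
        fix z
        have "(\<Sum>i\<in>Basis. (G z \<bullet> (i, 0))\<^sup>2) = (norm (fst (G z)))\<^sup>2"
          unfolding power2_norm_eq_inner euclidean_inner[of "fst (G z)" "fst (G z)"]
          by (cases "G z") (simp add: power2_eq_square)
        also have "\<dots> \<le> (norm (G z))\<^sup>2" using norm_fst_le[of "fst (G z)" "snd (G z)"] by (intro power_mono) auto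
        finally show "(\<Sum>i\<in>Basis. ?w z * (G z \<bullet> (i, 0))\<^sup>2) \<le> ?w z * (norm (G z))\<^sup>2"
          unfolding sum_distrib_left[symmetric] by (rule mult_left_mono) simp
      qed (rule parts)
      show "(LINT z|lebesgue. (\<Sum>i\<in>Basis. ?w z * (U z)\<^sup>2 * (?W i (fst z))\<^sup>2)) \<le> (LINT z|lebesgue. cut R z)"
      proof (rule integral_mono)
        show "integrable lebesgue (\<lambda>z. \<Sum>i\<in>Basis. ?w z * (U z)\<^sup>2 * (?W i (fst z))\<^sup>2)" using iS by (intro Bochner_Integration.integrable_sum)
        fix z
        show "(\<Sum>i\<in>Basis. ?w z * (U z)\<^sup>2 * (?W i (fst z))\<^sup>2) \<le> cut R z"
          unfolding sum_distrib_left[symmetric] cut_eq by (intro mult_left_mono hardy_square_sum_le) simp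
      qed (rule icut)
    qed auto
    finally show ?thesis .
  qed
  have l1: "(\<lambda>n. LINT z|lebesgue. cut (real (Suc n)) z) \<longlonglongrightarrow> (LINT z|lebesgue. m z)"
  proof (rule integral_dominated_convergence[OF _ cut_meas im])
    show "AE z in lebesgue. (\<lambda>n. cut (real (Suc n)) z) \<longlonglongrightarrow> m z"
    proof (rule AE_I2)
      fix z :: "'a \<times> real"
      obtain N where "norm (fst z) < real N" using reals_Archimedean2 by blast
      then have "cut (real (Suc n)) z = m z" if "N \<le> n" for n
      proof -
        have "norm (fst z) \<le> real (Suc n)" using that \<open>norm (fst z) < real N\<close> by simp
        then have "(norm (fst z))\<^sup>2 \<le> (real (Suc n))\<^sup>2" by (intro power_mono) auto
        then have "(norm (fst z))\<^sup>2 / (real (Suc n))\<^sup>2 \<le> 1" by (simp add: divide_le_eq)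
        then show ?thesis by (simp add: cut_def cutoff_eq_1 del: of_nat_Suc)
      qed
      then show "(\<lambda>n. cut (real (Suc n)) z) \<longlonglongrightarrow> m z"
        by (intro tendsto_eventually eventually_sequentiallyI[of N])
    qed
  qed (use cut_le im in auto)
  have l2: "(\<lambda>n. LINT z|lebesgue. ind (real (Suc n)) z) \<longlonglongrightarrow> (LINT z|(lebesgue :: ('a \<times> real) measure). (0::real))"
  proof (rule integral_dominated_convergence[OF _ ind_meas im])
    show "AE z in lebesgue. (\<lambda>n. ind (real (Suc n)) z) \<longlonglongrightarrow> 0"
    proof (rule AE_I2)
      fix z :: "'a \<times> real"
      obtain N where "norm (fst z) < real N" using reals_Archimedean2 by blast
      then have "ind (real (Suc n)) z = 0" if "N \<le> n" for n using that by (simp add: ind_def)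
      then show "(\<lambda>n. ind (real (Suc n)) z) \<longlonglongrightarrow> 0"
        by (intro tendsto_eventually eventually_sequentiallyI[of N])
    qed
  qed (use ind_le im in auto)
  have "(LINT z|lebesgue. m z) - 8 * C * 0 \<le> 2 * (LINT z|lebesgue. ?w z * (norm (G z))\<^sup>2) + 1/2 * (LINT z|lebesgue. m z)"
    by (rule LIMSEQ_le[OF tendsto_diff[OF l1 tendsto_mult[OF tendsto_const l2[unfolded Bochner_Integration.integral_zero]]]
          tendsto_add[OF tendsto_const tendsto_mult[OF tendsto_const l1]]])
      (use main[OF of_nat_0_less_iff[THEN iffD2, OF zero_less_Suc]] in blast)
  then have "(LINT z|lebesgue. m z) \<le> 4 * (LINT z|lebesgue. ?w z * (norm (G z))\<^sup>2)" by simp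
  moreover have "(LINT z|lebesgue. ?w z * (inverse ((rho z)\<^sup>2) * (U z)\<^sup>2)) \<le> (LINT z|lebesgue. m z)"
  proof (rule integral_mono[OF parts(2) im])
    fix z :: "'a \<times> real"
    have "inverse ((rho z)\<^sup>2) \<le> inverse (1 + (norm (fst z))\<^sup>2)"
      unfolding rho_square using one_plus_norm_square_pos[of "fst z"] by (intro le_imp_inverse_le) auto
    from mult_left_mono[OF this, of "?w z * (U z)\<^sup>2"]
    show "?w z * (inverse ((rho z)\<^sup>2) * (U z)\<^sup>2) \<le> m z" by (simp add: m_def mult_ac)
  qed
  ultimately show ?thesis by linarith
qed

section \<open>Traces and Hardy inequality in the weighted Sobolev space\<close>

lemma strip_weight_set_integrable:
  "set_integrable lebesgue (slab Y) (\<lambda>z. snd z powr \<alpha> * F z) \<longleftrightarrow> integrable lebesgue (\<lambda>z. strip_weight \<alpha> Y z * F z)"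
  by (simp add: set_integrable_def strip_weight_def mult.assoc)

lemma trace_representation:
  fixes U :: "'a::euclidean_space \<times> real \<Rightarrow> real"
  assumes U: "has_weak_gradient_on U G (slab Y)" and "0 < Y" "\<alpha> < 1"
    and fin: "set_integrable lebesgue (slab Y) (sobolev_density \<alpha> U G)"
  shows "\<exists>u p c. u \<in> borel_measurable borel \<and> p \<in> borel_measurable borel \<and> c \<in> borel_measurable borel \<and>
    (AE z in lborel. z \<in> slab Y \<longrightarrow> u z = U z) \<and> (AE z in lborel. z \<in> slab Y \<longrightarrow> p z = G z \<bullet> (0, 1)) \<and>
    (AE z in lborel. z \<in> slab Y \<longrightarrow> u z = c (fst z) + vertical_integral p z) \<and> has_trace0 U c \<and> measurable_slices U"
proof -
  have fin': "set_integrable lebesgue (slab Y) (\<lambda>z. snd z powr \<alpha> * (norm (G z))\<^sup>2)"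
    using sobolev_density_parts(1)[OF U fin] by (simp add: strip_weight_set_integrable)
  obtain u p c where r: "u \<in> borel_measurable borel" "p \<in> borel_measurable borel" "c \<in> borel_measurable borel"
    "AE z in lborel. z \<in> slab Y \<longrightarrow> u z = U z" "AE z in lborel. z \<in> slab Y \<longrightarrow> p z = G z \<bullet> (0, 1)"
    "AE z in lborel. z \<in> slab Y \<longrightarrow> u z = c (fst z) + vertical_integral p z"
    using vertical_representation[OF U assms(2,3) fin'] by blast
  have "(\<integral>\<^sup>+z. ennreal (indicator (slab Y) z * (snd z powr \<alpha> * (norm (G z))\<^sup>2)) \<partial>lebesgue)
      = ennreal (LINT z|lebesgue. strip_weight \<alpha> Y z * (norm (G z))\<^sup>2)"
    using nn_integral_eq_integral[OF sobolev_density_parts(1)[OF U fin]] by (simp add: strip_weight_def mult.assoc)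
  then have "(\<integral>\<^sup>+z. ennreal (indicator (slab Y) z * (snd z powr \<alpha> * (p z)\<^sup>2)) \<partial>lborel) < \<infinity>"
    using vertical_derivative_energy[OF r(5), of \<alpha>] by (simp add: le_less_trans)
  from has_trace0_representation[OF r(1,2,3,4,6) this assms(2,3)] measurable_slices_of_version[OF r(1,4) assms(2)] r
  show ?thesis by blast
qed

lemma slab_subset: "Y' \<le> Y \<Longrightarrow> slab Y' \<subseteq> slab Y" and slab_subset_halfspace: "slab Y \<subseteq> halfspace"
  by (auto simp: slab_def halfspace_def)

lemma H1rho_subset:
  assumes "U \<in> H1rho \<alpha> D" "open D" "open D'" "D' \<subseteq> D"
  shows "U \<in> H1rho \<alpha> D'"
proof -
  obtain G where G: "has_weak_gradient_on U G D" "set_integrable lebesgue D (sobolev_density \<alpha> U G)"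
    using assms(1) by (rule H1rhoE)
  have "set_integrable lebesgue D' (sobolev_density \<alpha> U G)"
    by (rule set_integrable_subset[OF G(2)]) (use assms in \<open>auto intro: borel_open\<close>)
  then show ?thesis using H1rho_iff[OF assms(3) has_weak_gradient_subset[OF G(1) assms(4)]] by simp
qed

lemma H1rho_trace:
  assumes "U \<in> H1rho \<alpha> D" "open D" "slab Y \<subseteq> D" "0 < Y" "\<alpha> < 1"
  shows "has_trace0 U (tr0 U)" "measurable_slices U"
proof -
  obtain G where "has_weak_gradient_on U G (slab Y)" "set_integrable lebesgue (slab Y) (sobolev_density \<alpha> U G)"
    using H1rho_subset[OF assms(1,2) open_slab assms(3)] by (rule H1rhoE)
  from trace_representation[OF this(1) assms(4,5) this(2)] show "has_trace0 U (tr0 U)" "measurable_slices U"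
    using has_trace0_tr0 by blast+
qed

lemma norm_add_square_le:
  fixes a b :: "'a::real_inner"
  shows "(norm (a + b))\<^sup>2 \<le> 2 * (norm a)\<^sup>2 + 2 * (norm b)\<^sup>2"
  using zero_le_power2[of "norm (a - b)"]
  by (simp add: power2_norm_eq_inner inner_add inner_diff inner_commute)

lemma sobolev_density_add_le:
  "sobolev_density \<alpha> (\<lambda>z. U z + V z) (\<lambda>z. G z + H z) z \<le> 2 * sobolev_density \<alpha> U G z + 2 * sobolev_density \<alpha> V H z"
proof -
  have "(norm (G z + H z))\<^sup>2 + inverse ((rho z)\<^sup>2) * (U z + V z)\<^sup>2
    \<le> (2 * (norm (G z))\<^sup>2 + 2 * (norm (H z))\<^sup>2) + inverse ((rho z)\<^sup>2) * (2 * (U z)\<^sup>2 + 2 * (V z)\<^sup>2)"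
    using norm_add_square_le[of "G z" "H z"] square_diff_le[of "U z" "- V z"]
    by (intro add_mono mult_left_mono) auto
  from mult_left_mono[OF this, of "snd z powr \<alpha>"] show ?thesis
    by (simp add: sobolev_density_def algebra_simps)
qed

lemma set_integrable_sobolev_bound:
  assumes "open D" "has_weak_gradient_on V H D" "set_integrable lebesgue D F"
    and le: "\<And>z. z \<in> D \<Longrightarrow> sobolev_density \<alpha> V H z \<le> F z"
  shows "set_integrable lebesgue D (sobolev_density \<alpha> V H)"
  unfolding set_integrable_def
proof (rule Bochner_Integration.integrable_bound)
  show "integrable lebesgue (\<lambda>z. indicator D z *\<^sub>R F z)" using assms(3) by (simp add: set_integrable_def)
  show "(\<lambda>z. indicator D z *\<^sub>R sobolev_density \<alpha> V H z) \<in> borel_measurable lebesgue"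
    by (rule sobolev_density_measurable[OF assms(1,2)])
  show "AE z in lebesgue. norm (indicator D z *\<^sub>R sobolev_density \<alpha> V H z) \<le> norm (indicator D z *\<^sub>R F z)"
    using le sobolev_density_nonneg[of \<alpha> V H] by (intro AE_I2) (auto split: split_indicator intro: order_trans[OF _ abs_ge_self])
qed

lemma sobolev_density_diff_integrable:
  assumes "open D" "has_weak_gradient_on U G D" "has_weak_gradient_on V H D"
    "set_integrable lebesgue D (sobolev_density \<alpha> U G)" "set_integrable lebesgue D (sobolev_density \<alpha> V H)"
  shows "set_integrable lebesgue D (sobolev_density \<alpha> (\<lambda>z. U z - V z) (\<lambda>z. G z - H z))"
proof (rule set_integrable_sobolev_bound[OF assms(1) has_weak_gradient_diff[OF assms(2,3)]])
  show "set_integrable lebesgue D (\<lambda>z. 2 * sobolev_density \<alpha> U G z + 2 * sobolev_density \<alpha> V H z)"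
    using assms(4,5) by (intro set_integral_add set_integrable_mult_right) auto
  show "sobolev_density \<alpha> (\<lambda>z. U z - V z) (\<lambda>z. G z - H z) z \<le> 2 * sobolev_density \<alpha> U G z + 2 * sobolev_density \<alpha> V H z" for z
    using sobolev_density_add_le[of \<alpha> U "\<lambda>z. - V z" G "\<lambda>z. - H z" z] by (simp add: sobolev_density_def)
qed

lemma trace_Hardy_integral:
  fixes e :: "'a::euclidean_space \<times> real \<Rightarrow> real"
  assumes e: "has_weak_gradient_on e G (slab Y)" and "0 < Y" and \<alpha>: "-1 < \<alpha>" "\<alpha> < 1"
    and fin: "set_integrable lebesgue (slab Y) (sobolev_density \<alpha> e G)" and tr: "tr0 e \<in> L2"
  shows "(LINT z|lebesgue. strip_weight \<alpha> Y z * (inverse ((rho z)\<^sup>2) * (e z)\<^sup>2))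
    \<le> 2 * (1 / (1 + \<alpha>) + 1 / (1 - \<alpha>)) * (LINT x|lebesgue. (tr0 e x)\<^sup>2) + 8 / (1 - \<alpha>)\<^sup>2 * (LINT z|lebesgue. strip_weight \<alpha> Y z * (norm (G z))\<^sup>2)"
proof -
  obtain u p c where r: "u \<in> borel_measurable borel" "p \<in> borel_measurable borel" "c \<in> borel_measurable borel"
    "AE z in lborel. z \<in> slab Y \<longrightarrow> u z = e z" "AE z in lborel. z \<in> slab Y \<longrightarrow> p z = G z \<bullet> (0, 1)"
    "AE z in lborel. z \<in> slab Y \<longrightarrow> u z = c (fst z) + vertical_integral p z" "has_trace0 e c" "measurable_slices e"
    using trace_representation[OF e \<open>0 < Y\<close> \<alpha>(2) fin] by blast
  have c: "AE x in lebesgue. c x = tr0 e x"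
    by (rule has_trace0_unique[OF r(7) has_trace0_tr0[OF r(7)] r(8)])
  note parts = sobolev_density_parts[OF e fin]
  have k: "0 \<le> 2 * (1 / (1 + \<alpha>) + 1 / (1 - \<alpha>))" "0 \<le> 8 / (1 - \<alpha>)\<^sup>2" using \<alpha> by auto
  have "ennreal (LINT z|lebesgue. strip_weight \<alpha> Y z * (inverse ((rho z)\<^sup>2) * (e z)\<^sup>2))
      = (\<integral>\<^sup>+z. ennreal (indicator (slab Y) z * (snd z powr \<alpha> * (inverse ((rho z)\<^sup>2) * (e z)\<^sup>2))) \<partial>lborel)"
    using nn_integral_eq_integral[OF parts(2)] unfolding nn_integral_completion
    by (simp add: strip_weight_def mult.assoc)
  also have "\<dots> \<le> ennreal (2 * (1 / (1 + \<alpha>) + 1 / (1 - \<alpha>))) * (\<integral>\<^sup>+x. ennreal ((c x)\<^sup>2) \<partial>lborel)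
     + ennreal (8 / (1 - \<alpha>)\<^sup>2) * (\<integral>\<^sup>+z. ennreal (indicator (slab Y) z * (snd z powr \<alpha> * (p z)\<^sup>2)) \<partial>lborel)"
    by (rule trace_Hardy[OF r(1,2,3,4,6) \<alpha>])
  also have "\<dots> \<le> ennreal (2 * (1 / (1 + \<alpha>) + 1 / (1 - \<alpha>))) * ennreal (LINT x|lebesgue. (tr0 e x)\<^sup>2)
     + ennreal (8 / (1 - \<alpha>)\<^sup>2) * ennreal (LINT z|lebesgue. strip_weight \<alpha> Y z * (norm (G z))\<^sup>2)"
  proof (intro add_mono mult_left_mono)
    have "(\<integral>\<^sup>+x. ennreal ((c x)\<^sup>2) \<partial>lborel) = (\<integral>\<^sup>+x. ennreal ((c x)\<^sup>2) \<partial>lebesgue)"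
      by (rule nn_integral_completion[symmetric])
    also have "\<dots> = (\<integral>\<^sup>+x. ennreal ((tr0 e x)\<^sup>2) \<partial>lebesgue)"
      using c by (intro nn_integral_cong_AE) (auto elim: eventually_mono)
    also have "\<dots> = ennreal (LINT x|lebesgue. (tr0 e x)\<^sup>2)"
      using tr by (intro nn_integral_eq_integral) (auto simp: L2_def)
    finally show "(\<integral>\<^sup>+x. ennreal ((c x)\<^sup>2) \<partial>lborel) \<le> ennreal (LINT x|lebesgue. (tr0 e x)\<^sup>2)" by simp
    have "(\<integral>\<^sup>+z. ennreal (indicator (slab Y) z * (snd z powr \<alpha> * (norm (G z))\<^sup>2)) \<partial>lebesgue)
      = ennreal (LINT z|lebesgue. strip_weight \<alpha> Y z * (norm (G z))\<^sup>2)"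
      using nn_integral_eq_integral[OF parts(1)] by (simp add: strip_weight_def mult.assoc)
    with vertical_derivative_energy[OF r(5), of \<alpha>]
    show "(\<integral>\<^sup>+z. ennreal (indicator (slab Y) z * (snd z powr \<alpha> * (p z)\<^sup>2)) \<partial>lborel) \<le> ennreal (LINT z|lebesgue. strip_weight \<alpha> Y z * (norm (G z))\<^sup>2)"
      by simp
  qed auto
  also have "\<dots> = ennreal (2 * (1 / (1 + \<alpha>) + 1 / (1 - \<alpha>)) * (LINT x|lebesgue. (tr0 e x)\<^sup>2)
     + 8 / (1 - \<alpha>)\<^sup>2 * (LINT z|lebesgue. strip_weight \<alpha> Y z * (norm (G z))\<^sup>2))"
    using k by (simp only: ennreal_mult'[symmetric]) (intro ennreal_plus[symmetric] mult_nonneg_nonneg integral_nonneg_AE AE_I2; simp)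
  finally show ?thesis
    using k by (subst (asm) ennreal_le_iff) (auto intro!: add_nonneg_nonneg mult_nonneg_nonneg integral_nonneg_AE)
qed

section \<open>Cutoff functions\<close>

definition radial_cutoff :: "real \<Rightarrow> 'a::euclidean_space \<Rightarrow> real" where
  "radial_cutoff R x = cutoff ((norm x)\<^sup>2 / R\<^sup>2)"

lemma smooth_radial_cutoff: "smooth (radial_cutoff R)"
proof -
  have "smooth (\<lambda>x::'a. cutoff ((norm x)\<^sup>2 * inverse (R\<^sup>2)))"
    by (intro smooth_compose[OF smooth_cutoff] smooth_mult smooth_norm_square smooth_const)
  then show ?thesis unfolding radial_cutoff_def[abs_def] divide_inverse .
qed

lemma radial_cutoff_eq_1: "0 < R \<Longrightarrow> norm x \<le> R \<Longrightarrow> radial_cutoff R x = 1"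
  unfolding radial_cutoff_def by (intro cutoff_eq_1) (auto simp: divide_le_eq power_mono)

lemma radial_cutoff_eq_0: "0 < R \<Longrightarrow> 2 * R \<le> norm x \<Longrightarrow> radial_cutoff R x = 0"
proof -
  assume R: "0 < R" "2 * R \<le> norm x"
  then have "(2 * R)\<^sup>2 \<le> (norm x)\<^sup>2" by (intro power_mono) auto
  then show ?thesis using R unfolding radial_cutoff_def by (intro cutoff_eq_0) (simp add: field_simps)
qed

lemma radial_cutoff_bounds: "0 \<le> radial_cutoff R x" "radial_cutoff R x \<le> 1" "\<bar>radial_cutoff R x\<bar> \<le> 1"
  using cutoff_nonneg cutoff_le_1 by (auto simp: radial_cutoff_def abs_le_iff intro: order_trans[of _ 0])

lemma radial_cutoff_derivative:
  "\<exists>C\<ge>0. \<forall>R>0. \<forall>(x::'a::euclidean_space) v. \<bar>frechet_derivative (radial_cutoff R) (at x) v\<bar> \<le> C / R * norm v \<and>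
     (norm x < R \<or> 2 * R < norm x \<longrightarrow> frechet_derivative (radial_cutoff R) (at x) v = 0)"
proof -
  obtain C where C: "0 \<le> C" "\<And>t v. \<bar>frechet_derivative cutoff (at t) v\<bar> \<le> C * \<bar>v\<bar>"
    "\<And>t v. t < 1 \<Longrightarrow> frechet_derivative cutoff (at t) v = 0"
    using cutoff_derivative_bound by metis
  have "\<bar>frechet_derivative (radial_cutoff R) (at x) v\<bar> \<le> (4 * C) / R * norm v \<and>
     (norm x < R \<or> 2 * R < norm x \<longrightarrow> frechet_derivative (radial_cutoff R) (at x) v = 0)" if R: "0 < R" for R v and x :: 'a
  proof -
    let ?t = "(norm x)\<^sup>2 / R\<^sup>2"
    have "((\<lambda>x. (norm x)\<^sup>2 / R\<^sup>2) has_derivative (\<lambda>v. 2 * (x \<bullet> v) / R\<^sup>2)) (at x)"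
      unfolding power2_norm_eq_inner divide_inverse by (auto intro!: derivative_eq_intros simp: inner_commute)
    from has_derivative_compose[OF this smooth_has_derivative[OF smooth_cutoff]]
    have fd: "frechet_derivative (radial_cutoff R) (at x) v = frechet_derivative cutoff (at ?t) (2 * (x \<bullet> v) / R\<^sup>2)"
      unfolding radial_cutoff_def[abs_def] by (metis frechet_derivative_at)
    have zero: "frechet_derivative (radial_cutoff R) (at x) v = 0" if "norm x < R \<or> 2 * R < norm x"
      using that
    proof
      assume "norm x < R"
      then have "(norm x)\<^sup>2 < R\<^sup>2" by (intro power_strict_mono) auto
      then show ?thesis using R unfolding fd by (intro C(3)) simp
    next
      assume "2 * R < norm x"
      then have "(2 * R)\<^sup>2 < (norm x)\<^sup>2" using R by (intro power_strict_mono) auto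
      then show ?thesis using R unfolding fd by (intro cutoff_derivative_eq_0) (simp add: field_simps)
    qed
    moreover have "\<bar>frechet_derivative (radial_cutoff R) (at x) v\<bar> \<le> (4 * C) / R * norm v"
    proof (cases "2 * R < norm x")
      case True
      then show ?thesis using zero C(1) R by simp
    next
      case False
      have "\<bar>frechet_derivative (radial_cutoff R) (at x) v\<bar> \<le> C * \<bar>2 * (x \<bullet> v) / R\<^sup>2\<bar>"
        unfolding fd by (rule C(2))
      also have "\<dots> \<le> C * ((4 / R) * norm v)"
      proof (rule mult_left_mono[OF _ C(1)])
        have "\<bar>x \<bullet> v\<bar> \<le> (2 * R) * norm v"
          using Cauchy_Schwarz_ineq2[of x v] False by (meson linorder_not_less mult_right_mono norm_ge_zero order_trans)
        then show "\<bar>2 * (x \<bullet> v) / R\<^sup>2\<bar> \<le> 4 / R * norm v"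
          using R by (simp add: abs_mult divide_le_eq power2_eq_square)
      qed
      finally show ?thesis by (simp add: mult_ac)
    qed
    ultimately show ?thesis by blast
  qed
  then show ?thesis using C(1) by (intro exI[of _ "4 * C"]) auto
qed

text \<open>
  The cutoff function is a product, so that near \<open>y = 0\<close> it depends on \<open>x\<close> only and commutes with the trace.
\<close>

definition space_cutoff :: "real \<Rightarrow> 'a::euclidean_space \<times> real \<Rightarrow> real" where
  "space_cutoff R z = radial_cutoff R (fst z) * radial_cutoff R (snd z)"

lemma smooth_space_cutoff: "smooth (space_cutoff R)"
  unfolding space_cutoff_def[abs_def]
  by (intro smooth_mult smooth_compose_linear[OF smooth_radial_cutoff] bounded_linear_fst bounded_linear_snd)

lemma space_cutoff_bounds: "0 \<le> space_cutoff R z" "space_cutoff R z \<le> 1"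
  unfolding space_cutoff_def by (intro mult_nonneg_nonneg mult_le_one radial_cutoff_bounds)+

text \<open>
  The derivative of the cutoff has size \<open>1 / R\<close>, and \<open>\<rho>\<close> is at most of order \<open>R\<close> where the cutoff does not vanish.
\<close>

lemma space_cutoff_gradient:
  "\<exists>C\<ge>0. \<forall>R\<ge>1. \<forall>z::'a::euclidean_space \<times> real. norm (gradient (space_cutoff R) z) \<le> C * inverse (rho z) \<and>
     (norm (fst z) < R \<and> \<bar>snd z\<bar> < R \<longrightarrow> gradient (space_cutoff R) z = 0)"
proof -
  obtain C1 where C1: "C1 \<ge> 0" "\<forall>R>0. \<forall>(x::'a) v. \<bar>frechet_derivative (radial_cutoff R) (at x) v\<bar> \<le> C1 / R * norm v \<and>
     (norm x < R \<or> 2 * R < norm x \<longrightarrow> frechet_derivative (radial_cutoff R) (at x) v = 0)"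
    using radial_cutoff_derivative[where 'a='a] by (elim exE conjE)
  note C1 = C1(1) C1(2)[rule_format, THEN conjunct1] C1(2)[rule_format, THEN conjunct2, rule_format]
  obtain C2 where C2: "C2 \<ge> 0" "\<forall>R>0. \<forall>(x::real) v. \<bar>frechet_derivative (radial_cutoff R) (at x) v\<bar> \<le> C2 / R * norm v \<and>
     (norm x < R \<or> 2 * R < norm x \<longrightarrow> frechet_derivative (radial_cutoff R) (at x) v = 0)"
    using radial_cutoff_derivative[where 'a=real] by (elim exE conjE)
  note C2 = C2(1) C2(2)[rule_format, THEN conjunct1] C2(2)[rule_format, THEN conjunct2, rule_format]
  have "norm (gradient (space_cutoff R) z) \<le> 3 * (C1 + C2) * inverse (rho z) \<and>
     (norm (fst z) < R \<and> \<bar>snd z\<bar> < R \<longrightarrow> gradient (space_cutoff R) z = 0)" if R1: "R \<ge> 1" for R and z :: "'a \<times> real"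
  proof -
    have R: "R > 0" using R1 by simp
    define g where "g = gradient (space_cutoff R) z"
    let ?a = "\<lambda>v. frechet_derivative (radial_cutoff R) (at (fst z)) v" and ?b = "\<lambda>v. frechet_derivative (radial_cutoff R) (at (snd z)) v"
    have sd: "(space_cutoff R has_derivative (\<lambda>v. radial_cutoff R (fst z) * ?b (snd v) + ?a (fst v) * radial_cutoff R (snd z))) (at z)"
      unfolding space_cutoff_def[abs_def]
      by (intro has_derivative_mult has_derivative_compose[OF _ smooth_has_derivative[OF smooth_radial_cutoff]]
          bounded_linear_imp_has_derivative bounded_linear_fst bounded_linear_snd)
    have gv: "g \<bullet> v = radial_cutoff R (fst z) * ?b (snd v) + ?a (fst v) * radial_cutoff R (snd z)" for v
      unfolding g_def gradient_inner[OF smooth_space_cutoff] frechet_derivative_at[OF sd, symmetric] ..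
    have z0: "g = 0" if "norm (fst z) < R \<and> \<bar>snd z\<bar> < R \<or> 2 * R < norm (fst z) \<or> 2 * R < \<bar>snd z\<bar>"
    proof -
      have "g \<bullet> g = 0"
        using that C1(3)[OF R, of "fst z"] C2(3)[OF R, of "snd z"] radial_cutoff_eq_0[OF R, of "fst z"] radial_cutoff_eq_0[OF R, of "snd z"]
        unfolding gv by auto
      then show ?thesis by simp
    qed
    have gg: "g \<bullet> g \<le> (C1 + C2) / R * norm g"
    proof -
      have "radial_cutoff R (fst z) * ?b (snd g) \<le> 1 * (C2 / R * norm (snd g))"
      proof -
        have "radial_cutoff R (fst z) * ?b (snd g) \<le> radial_cutoff R (fst z) * \<bar>?b (snd g)\<bar>"
          by (intro mult_left_mono abs_ge_self radial_cutoff_bounds)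
        also have "\<dots> \<le> 1 * (C2 / R * norm (snd g))"
          by (intro mult_mono radial_cutoff_bounds C2(2)[OF R]) auto
        finally show ?thesis .
      qed
      also have "\<dots> \<le> C2 / R * norm g" using C2(1) R norm_snd_le[of "snd g" "fst g"] by (simp add: mult_left_mono divide_right_mono)
      finally have 1: "radial_cutoff R (fst z) * ?b (snd g) \<le> C2 / R * norm g" .
      have "?a (fst g) * radial_cutoff R (snd z) \<le> (C1 / R * norm (fst g)) * 1"
      proof -
        have "?a (fst g) * radial_cutoff R (snd z) \<le> \<bar>?a (fst g)\<bar> * radial_cutoff R (snd z)"
          by (intro mult_right_mono abs_ge_self radial_cutoff_bounds)
        also have "\<dots> \<le> (C1 / R * norm (fst g)) * 1"
          by (intro mult_mono radial_cutoff_bounds C1(2)[OF R]) (use C1(1) R in auto)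
        finally show ?thesis .
      qed
      also have "\<dots> \<le> C1 / R * norm g" using C1(1) R norm_fst_le[of "fst g" "snd g"] by (simp add: mult_left_mono divide_right_mono)
      finally show ?thesis using 1 unfolding gv by (simp add: add_divide_distrib distrib_right)
    qed
    have gR: "norm g \<le> (C1 + C2) / R"
    proof (cases "g = 0")
      case False
      have "norm g * norm g \<le> (C1 + C2) / R * norm g"
        using gg by (simp add: power2_norm_eq_inner[symmetric] power2_eq_square)
      then show ?thesis by (rule mult_right_le_imp_le) (use False in simp)
    qed (use C1(1) C2(1) R in simp)
    have "norm g \<le> 3 * (C1 + C2) * inverse (rho z)"
    proof (cases "2 * R < norm (fst z) \<or> 2 * R < \<bar>snd z\<bar>")
      case True
      then show ?thesis using z0 C1(1) C2(1) rho_pos[of z] by auto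
    next
      case False
      then have "(norm (fst z))\<^sup>2 \<le> (2 * R)\<^sup>2" by (intro power_mono) auto
      moreover have "(snd z)\<^sup>2 \<le> (2 * R)\<^sup>2"
        using False R1 by (intro abs_le_square_iff[THEN iffD1]) auto
      moreover have "1 \<le> R\<^sup>2" using R1 by (rule one_le_power)
      ultimately have "(rho z)\<^sup>2 \<le> (3 * R)\<^sup>2" unfolding rho_square by (simp add: power_mult_distrib)
      then have "rho z \<le> 3 * R" by (rule power2_le_imp_le) (use R in simp)
      then have "1 / R \<le> 3 * inverse (rho z)" using R rho_pos[of z] by (simp add: field_simps)
      from mult_left_mono[OF this, of "C1 + C2"] C1(1) C2(1) gR show ?thesis by (simp add: mult_ac)
    qed
    then show ?thesis using z0 by (auto simp: g_def)
  qed
  then show ?thesis using C1(1) C2(1) by (intro exI[of _ "3 * (C1 + C2)"]) auto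
qed

section \<open>The coefficient field\<close>

lemma norm_matrix_vector_mult_le: "norm (A *v x) \<le> norm A * norm (x :: real^'n)" for A :: "real^'n^'m"
proof -
  have "norm (A *v x) = L2_set (\<lambda>i. \<bar>(A $ i) \<bullet> x\<bar>) UNIV"
    by (simp add: norm_vec_def matrix_vector_mul_component)
  also have "\<dots> \<le> L2_set (\<lambda>i. norm (A $ i) * norm x) UNIV"
    by (intro L2_set_mono Cauchy_Schwarz_ineq2) auto
  also have "\<dots> = norm A * norm x" by (simp add: norm_vec_def[of A] L2_set_left_distrib)
  finally show ?thesis .
qed

lemma continuous_on_matrix_vector_mult:
  fixes f :: "'c::topological_space \<Rightarrow> real^'n^'m" and g :: "'c \<Rightarrow> real^'n"
  assumes "continuous_on S f" "continuous_on S g"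
  shows "continuous_on S (\<lambda>x. f x *v g x)"
  unfolding matrix_vector_mult_def using assms by (intro continuous_intros)

lemma block_mult_inner: "block_mult A a \<bullet> b = (A *v fst a) \<bullet> fst b + snd a * snd b"
  by (cases b) (simp add: block_mult_def inner_prod_def)

lemma block_mult_diff_left: "block_mult A (a - b) = block_mult A a - block_mult A b"
  by (simp add: block_mult_def matrix_vector_mult_diff_distrib prod_eq_iff)

lemma block_mult_inner_le: "\<bar>block_mult A a \<bullet> b\<bar> \<le> (norm A + 1) * (norm a * norm b)"
proof -
  have n: "norm (fst a) \<le> norm a" "norm (fst b) \<le> norm b" "\<bar>snd a\<bar> \<le> norm a" "\<bar>snd b\<bar> \<le> norm b"
    using norm_fst_le[of "fst a" "snd a"] norm_fst_le[of "fst b" "snd b"] norm_snd_le[of "snd a" "fst a"] norm_snd_le[of "snd b" "fst b"] by auto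
  have "\<bar>(A *v fst a) \<bullet> fst b\<bar> \<le> norm (A *v fst a) * norm (fst b)" by (rule Cauchy_Schwarz_ineq2)
  also have "\<dots> \<le> (norm A * norm a) * norm b"
  proof (intro mult_mono n)
    show "norm (A *v fst a) \<le> norm A * norm a"
      using norm_matrix_vector_mult_le[of A "fst a"] mult_left_mono[OF n(1), of "norm A"] by simp
  qed auto
  finally have 1: "\<bar>(A *v fst a) \<bullet> fst b\<bar> \<le> norm A * (norm a * norm b)" by (simp add: mult.assoc)
  have "\<bar>snd a * snd b\<bar> \<le> norm a * norm b" unfolding abs_mult by (intro mult_mono n) auto
  then show ?thesis using 1 unfolding block_mult_inner by (simp add: distrib_right)
qed

lemma block_mult_coercive:
  assumes "A0 * (norm (fst a))\<^sup>2 \<le> (A *v fst a) \<bullet> fst a"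
  shows "min A0 1 * (norm a)\<^sup>2 \<le> block_mult A a \<bullet> a"
proof -
  have "(norm a)\<^sup>2 = (norm (fst a))\<^sup>2 + (snd a)\<^sup>2"
    unfolding power2_norm_eq_inner by (cases a) (simp add: power2_eq_square)
  moreover have "min A0 1 * (norm (fst a))\<^sup>2 \<le> A0 * (norm (fst a))\<^sup>2" "min A0 1 * (snd a)\<^sup>2 \<le> 1 * (snd a)\<^sup>2"
    by (intro mult_right_mono; simp)+
  ultimately show ?thesis
    using assms unfolding block_mult_inner by (simp add: distrib_left power2_eq_square)
qed

lemma block_mult_inner_measurable:
  fixes \<AA> :: "real^'n \<Rightarrow> real^'n^'n"
  assumes "continuous_on UNIV \<AA>" and a: "a \<in> borel_measurable lebesgue" and b: "b \<in> borel_measurable lebesgue"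
  shows "(\<lambda>z. block_mult (\<AA> (fst z)) (a z) \<bullet> b z) \<in> borel_measurable (lebesgue :: ((real^'n) \<times> real) measure)"
proof -
  have A: "(\<lambda>z::(real^'n) \<times> real. \<AA> (fst z)) \<in> borel_measurable lebesgue"
    by (intro borel_imp_lebesgue borel_measurable_continuous_onI continuous_on_compose2[OF assms(1)] continuous_intros) auto
  have "(\<lambda>z. block_mult (\<AA> (fst z)) (a z)) \<in> borel_measurable lebesgue"
    by (rule borel_measurable_continuous_Pair[OF A a])
      (auto simp: block_mult_def intro!: continuous_intros continuous_on_matrix_vector_mult)
  then show ?thesis using b by (rule borel_measurable_inner)
qed

lemma coefficient_bounded:
  fixes \<AA> :: "real^'n \<Rightarrow> real^'n^'n"
  assumes "continuous_on UNIV \<AA>" "bounded \<Omega>" "\<And>x. x \<notin> closure \<Omega> \<Longrightarrow> \<AA> x = mat 1"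
  shows "\<exists>M. \<forall>x. norm (\<AA> x) \<le> M"
proof -
  have "compact (closure \<Omega>)" using assms(2) by simp
  then have "bounded (\<AA> ` closure \<Omega>)"
    using assms(1) continuous_on_subset by (intro compact_imp_bounded compact_continuous_image) blast
  then obtain M where "\<And>x. x \<in> closure \<Omega> \<Longrightarrow> norm (\<AA> x) \<le> M" by (auto simp: bounded_iff)
  then have "norm (\<AA> x) \<le> max M (norm (mat 1 :: real^'n^'n))" for x
    using assms(3)[of x] by (cases "x \<in> closure \<Omega>") (auto simp: le_max_iff_disj)
  then show ?thesis by blast
qed

text \<open>
  The complement of the essential support is covered by balls on which \<open>f\<close> vanishes almost everywhere;
  countably many of them suffice.
\<close>

lemma AE_zero_outside_ess_support: "AE x in lebesgue. x \<notin> ess_support f \<longrightarrow> f x = 0"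
proof -
  define F where "F = {ball x \<epsilon> | x \<epsilon>. 0 < \<epsilon> \<and> (AE y in lebesgue. y \<in> ball x \<epsilon> \<longrightarrow> f y = 0)}"
  have op: "open S" if "S \<in> F" for S
    using that unfolding F_def by (elim CollectE exE conjE) (simp only: open_ball)
  obtain F' where F': "F' \<subseteq> F" "countable F'" "\<Union>F' = \<Union>F"
    using Lindelof[OF op] by metis
  have "AE x in lebesgue. x \<in> S \<longrightarrow> f x = 0" if "S \<in> F'" for S
    using subsetD[OF F'(1) that] unfolding F_def by (elim CollectE exE conjE) (simp only:)
  then have "AE x in lebesgue. \<forall>S\<in>F'. x \<in> S \<longrightarrow> f x = 0"
    unfolding AE_ball_countable[OF F'(2)] by (rule ballI)
  then show ?thesis
  proof eventually_elim
    fix x assume *: "\<forall>S\<in>F'. x \<in> S \<longrightarrow> f x = 0"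
    show "x \<notin> ess_support f \<longrightarrow> f x = 0"
    proof
      assume "x \<notin> ess_support f"
      then obtain \<epsilon> where "0 < \<epsilon>" "AE y in lebesgue. y \<in> ball x \<epsilon> \<longrightarrow> f y = 0" by (auto simp: ess_support_def)
      then have "ball x \<epsilon> \<in> F" unfolding F_def by blast
      moreover have "x \<in> ball x \<epsilon>" using \<open>0 < \<epsilon>\<close> by simp
      ultimately have "x \<in> \<Union>F'" using F'(3) by blast
      then show "f x = 0" using * by blast
    qed
  qed
qed

lemma d_const_pos: "0 < \<beta> \<Longrightarrow> \<beta> < 1 \<Longrightarrow> 0 < d_const \<beta>"
  unfolding d_const_def by (intro divide_pos_pos mult_pos_pos Gamma_real_pos) auto

section \<open>Convergence of the truncated solutions\<close>

definition half_weight :: "real \<Rightarrow> 'a::euclidean_space \<times> real \<Rightarrow> real" where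
  "half_weight \<alpha> z = indicator halfspace z * snd z powr \<alpha>"

text \<open>
  The part of the energy of \<open>U\<close> that lies outside the cylinder \<open>\<bar>x\<bar> < R\<close>, \<open>y < R\<close> bounds the error of the
  truncation.
\<close>

definition energy_tail :: "real \<Rightarrow> real \<Rightarrow> ((real^'n) \<times> real \<Rightarrow> real) \<Rightarrow> real \<Rightarrow> real" where
  "energy_tail \<alpha> s U R =
     (LINT z|lebesgue. half_weight \<alpha> z * (norm (weak_gradient halfspace U z))\<^sup>2 * (if R \<le> norm (fst z) \<or> R \<le> snd z then 1 else 0))
     + s * (LINT x|lebesgue. (tr0 U x)\<^sup>2 * (if R \<le> norm x then 1 else 0))"

lemma Young_tail:
  fixes a b c :: real
  assumes "0 < \<mu>" "0 \<le> a" "0 \<le> b" "0 \<le> c"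
  shows "a * (b + c) \<le> a\<^sup>2 / (2 * \<mu>) + \<mu> * (b\<^sup>2 + c\<^sup>2)"
proof -
  have "2 * \<mu> * (a * (b + c)) \<le> a\<^sup>2 + (\<mu> * (b + c))\<^sup>2"
    using zero_le_power2[of "a - \<mu> * (b + c)"] by (simp add: power2_eq_square algebra_simps)
  also have "(\<mu> * (b + c))\<^sup>2 \<le> \<mu>\<^sup>2 * (2 * b\<^sup>2 + 2 * c\<^sup>2)"
    using square_diff_le[of b "- c"] by (simp add: power_mult_distrib mult_left_mono)
  finally have "2 * \<mu> * (a * (b + c)) \<le> 2 * \<mu> * (a\<^sup>2 / (2 * \<mu>) + \<mu> * (b\<^sup>2 + c\<^sup>2))"
    using assms(1) by (simp add: power2_eq_square algebra_simps)
  then show ?thesis using assms(1) by (simp only: mult_le_cancel_left_pos[of "2 * \<mu>"] mult_pos_pos zero_less_numeral)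
qed

lemma integrable_square_mult:
  fixes a b :: "'a \<Rightarrow> real"
  assumes "a \<in> borel_measurable M" "b \<in> borel_measurable M" "integrable M (\<lambda>x. (a x)\<^sup>2)" "integrable M (\<lambda>x. (b x)\<^sup>2)"
  shows "integrable M (\<lambda>x. a x * b x)"
proof (rule Bochner_Integration.integrable_bound)
  show "integrable M (\<lambda>x. (a x)\<^sup>2 + (b x)\<^sup>2)" using assms(3,4) by simp
  have "\<bar>p * q\<bar> \<le> p\<^sup>2 + q\<^sup>2" for p q :: real
    using zero_le_power2[of "\<bar>p\<bar> - \<bar>q\<bar>"] zero_le_power2[of p] zero_le_power2[of q] unfolding power2_diff abs_mult power2_abs
    by linarith
  then show "AE x in M. norm (a x * b x) \<le> norm ((a x)\<^sup>2 + (b x)\<^sup>2)"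
    by (intro AE_I2) (auto intro: order_trans[OF _ abs_ge_self])
qed (use assms in measurable)

lemma L2_diff:
  assumes "g \<in> L2" "h \<in> L2"
  shows "(\<lambda>x. g x - h x) \<in> L2"
proof -
  have m: "g \<in> borel_measurable lebesgue" "h \<in> borel_measurable lebesgue" using assms by (auto simp: L2_def)
  have "integrable lebesgue (\<lambda>x. (g x - h x)\<^sup>2)"
  proof (rule Bochner_Integration.integrable_bound)
    show "integrable lebesgue (\<lambda>x. 2 * (g x)\<^sup>2 + 2 * (h x)\<^sup>2)" using assms by (simp add: L2_def)
    show "AE x in lebesgue. norm ((g x - h x)\<^sup>2) \<le> norm (2 * (g x)\<^sup>2 + 2 * (h x)\<^sup>2)"
      using square_diff_le by (intro AE_I2) (auto intro: order_trans[OF _ abs_ge_self])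
  qed (use m in measurable)
  then show ?thesis using m by (simp add: L2_def)
qed

lemma L2_cong_AE:
  assumes "g \<in> L2" "h \<in> borel_measurable lebesgue" "AE x in lebesgue. h x = g x"
  shows "h \<in> L2"
proof -
  have [measurable]: "g \<in> borel_measurable lebesgue" using assms by (simp add: L2_def)
  note [measurable] = assms(2)
  have "integrable lebesgue (\<lambda>x. (h x)\<^sup>2) \<longleftrightarrow> integrable lebesgue (\<lambda>x. (g x)\<^sup>2)"
    using assms(3) by (intro integrable_cong_AE) (auto elim: eventually_mono)
  then show ?thesis using assms by (simp add: L2_def)
qed

text \<open>
  The gradient of the product is \<open>\<eta> \<nabla>e + e \<nabla>\<eta>\<close>, and the second summand is bounded by \<open>\<bar>e\<bar> / \<rho>\<close>, which is exactly
  what the weighted norm controls.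
\<close>

lemma cutoff_in_trial_space:
  fixes e :: "(real^'n) \<times> real \<Rightarrow> real"
  assumes \<beta>: "0 < \<beta>" "\<beta> < 1" and e: "e \<in> trial_space \<beta> s (slab Y)" "has_weak_gradient_on e H (slab Y)"
    and R: "1 \<le> R" "2 * R < Y"
  shows "(\<lambda>z. space_cutoff R z * e z) \<in> trial_space \<beta> s halfspace"
    and "has_weak_gradient_on (\<lambda>z. space_cutoff R z * e z) (\<lambda>z. space_cutoff R z *\<^sub>R H z + e z *\<^sub>R gradient (space_cutoff R) z) halfspace"
    and "AE x in lebesgue. tr0 (\<lambda>z. space_cutoff R z * e z) x = radial_cutoff R x * tr0 e x"
    and "tr0 (\<lambda>z. space_cutoff R z * e z) \<in> borel_measurable lebesgue"
proof -
  define \<alpha> where "\<alpha> = 1 - 2 * \<beta>"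
  have \<alpha>: "\<alpha> < 1" using \<beta> by (simp add: \<alpha>_def)
  let ?\<eta> = "space_cutoff R :: (real^'n) \<times> real \<Rightarrow> real"
  let ?K = "{z :: (real^'n) \<times> real. \<bar>snd z\<bar> \<le> 2 * R}"
  have out: "?\<eta> z = 0" if "z \<notin> ?K" for z
    using that R radial_cutoff_eq_0[of R "snd z"] by (simp add: space_cutoff_def)
  have eH: "e \<in> H1rho \<alpha> (slab Y)" using e by (simp add: trial_space_def \<alpha>_def)
  then have fin: "set_integrable lebesgue (slab Y) (sobolev_density \<alpha> e H)" using H1rho_iff[OF open_slab e(2)] by simp
  have closed: "closed ?K" by (intro closed_Collect_le continuous_intros)
  show wg: "has_weak_gradient_on (\<lambda>z. ?\<eta> z * e z) (\<lambda>z. ?\<eta> z *\<^sub>R H z + e z *\<^sub>R gradient ?\<eta> z) halfspace"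
    by (rule has_weak_gradient_cutoff[OF e(2) smooth_space_cutoff slab_subset_halfspace closed _ out])
      (use R in \<open>auto simp: halfspace_iff slab_iff\<close>)
  obtain C where C: "C \<ge> 0" "\<forall>R\<ge>1. \<forall>z::(real^'n) \<times> real. norm (gradient (space_cutoff R) z) \<le> C * inverse (rho z) \<and>
     (norm (fst z) < R \<and> \<bar>snd z\<bar> < R \<longrightarrow> gradient (space_cutoff R) z = 0)"
    using space_cutoff_gradient[where 'a = "real^'n"] by (elim exE conjE)
  have Cg: "norm (gradient ?\<eta> z) \<le> C * inverse (rho z)" for z using C(2) R(1) by blast
  have sq1: "(?\<eta> z)\<^sup>2 \<le> 1" for z
    using space_cutoff_bounds[of R z] by (simp add: power_le_one)
  have "set_integrable lebesgue halfspace (sobolev_density \<alpha> (\<lambda>z. ?\<eta> z * e z) (\<lambda>z. ?\<eta> z *\<^sub>R H z + e z *\<^sub>R gradient ?\<eta> z))"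
  proof (rule set_integrable_sobolev_bound[OF open_halfspace wg])
    have "integrable lebesgue (\<lambda>z. (2 + 2 * C\<^sup>2) * (indicator (slab Y) z *\<^sub>R sobolev_density \<alpha> e H z))"
      using fin by (intro integrable_mult_right) (simp add: set_integrable_def)
    then show "set_integrable lebesgue halfspace (\<lambda>z. (2 + 2 * C\<^sup>2) * (indicator (slab Y) z *\<^sub>R sobolev_density \<alpha> e H z))"
      unfolding set_integrable_def by (intro integrable_mult_indicator borel_open[THEN sets_completionI_sets] ) auto
    fix z :: "(real^'n) \<times> real" assume z: "z \<in> halfspace"
    show "sobolev_density \<alpha> (\<lambda>z. ?\<eta> z * e z) (\<lambda>z. ?\<eta> z *\<^sub>R H z + e z *\<^sub>R gradient ?\<eta> z) z
       \<le> (2 + 2 * C\<^sup>2) * (indicator (slab Y) z *\<^sub>R sobolev_density \<alpha> e H z)"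
    proof (cases "z \<in> slab Y")
      case True
      have "(norm (?\<eta> z *\<^sub>R H z + e z *\<^sub>R gradient ?\<eta> z))\<^sup>2 \<le> 2 * (norm (?\<eta> z *\<^sub>R H z))\<^sup>2 + 2 * (norm (e z *\<^sub>R gradient ?\<eta> z))\<^sup>2"
        by (rule norm_add_square_le)
      also have "\<dots> \<le> 2 * (1 * (norm (H z))\<^sup>2) + 2 * ((e z)\<^sup>2 * (C * inverse (rho z))\<^sup>2)"
        unfolding norm_scaleR power_mult_distrib[of "\<bar>_\<bar>"] power2_abs
        by (intro add_mono mult_left_mono mult_right_mono power_mono sq1 Cg) auto
      finally have "(norm (?\<eta> z *\<^sub>R H z + e z *\<^sub>R gradient ?\<eta> z))\<^sup>2 + inverse ((rho z)\<^sup>2) * (?\<eta> z * e z)\<^sup>2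
         \<le> 2 * (norm (H z))\<^sup>2 + 2 * C\<^sup>2 * (inverse ((rho z)\<^sup>2) * (e z)\<^sup>2) + inverse ((rho z)\<^sup>2) * (1 * (e z)\<^sup>2)"
        unfolding power_mult_distrib power_inverse
        by (intro add_mono mult_left_mono mult_right_mono sq1) (auto simp: mult_ac)
      also have "\<dots> \<le> (2 + 2 * C\<^sup>2) * ((norm (H z))\<^sup>2 + inverse ((rho z)\<^sup>2) * (e z)\<^sup>2)"
        by (simp add: algebra_simps)
      finally show ?thesis
        using True mult_left_mono[of _ _ "snd z powr \<alpha>"] by (simp add: sobolev_density_def mult.left_commute)
    next
      case False
      then have "z \<notin> ?K" using z R by (auto simp: halfspace_iff slab_iff)
      then have "?\<eta> z = 0" by (rule out)
      moreover have "gradient ?\<eta> z = 0"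
      proof -
        have "(?\<eta> has_derivative (\<lambda>_. 0)) (at z)"
          by (rule has_derivative_transform_within_open[of "\<lambda>_. 0" _ _ _ "- ?K"])
            (use \<open>z \<notin> ?K\<close> out closed in auto)
        then have "frechet_derivative ?\<eta> (at z) = (\<lambda>_. 0)" using frechet_derivative_at by metis
        then show ?thesis by (simp add: gradient_def)
      qed
      ultimately show ?thesis using False by (simp add: sobolev_density_def)
    qed
  qed
  then have V: "(\<lambda>z. ?\<eta> z * e z) \<in> H1rho \<alpha> halfspace" using H1rho_iff[OF open_halfspace wg] by simp
  have Y: "0 < Y" using R by simp
  note te = H1rho_trace[OF eH open_slab order_refl Y \<alpha>]
  note tV = H1rho_trace[OF V open_halfspace slab_subset_halfspace Y \<alpha>]
  have "has_trace0 (\<lambda>z. ?\<eta> z * e z) (\<lambda>x. radial_cutoff R x * tr0 e x)"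
  proof (rule has_trace0_cutoff[OF te(1), of R])
    show "?\<eta> (x, y) = radial_cutoff R x" if "0 < y" "y < R" for x y
      using that radial_cutoff_eq_1[of R y] by (simp add: space_cutoff_def)
  qed (use R radial_cutoff_bounds smooth_borel[OF smooth_radial_cutoff] in auto)
  from has_trace0_unique[OF tV(1) this tV(2)]
  show ae: "AE x in lebesgue. tr0 (\<lambda>z. ?\<eta> z * e z) x = radial_cutoff R x * tr0 e x" .
  show mV: "tr0 (\<lambda>z. ?\<eta> z * e z) \<in> borel_measurable lebesgue" by (rule has_trace0_measurable[OF tV(1)])
  have "tr0 (\<lambda>z. ?\<eta> z * e z) \<in> L2" if "s > 0"
  proof (rule L2_cong_AE[OF _ mV ae])
    have t: "tr0 e \<in> L2" using e that by (simp add: trial_space_def)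
    have [measurable]: "tr0 e \<in> borel_measurable lebesgue" "radial_cutoff R \<in> borel_measurable lebesgue"
      using t by (auto simp: L2_def intro: borel_imp_lebesgue smooth_borel smooth_radial_cutoff)
    have "integrable lebesgue (\<lambda>x. (radial_cutoff R x * tr0 e x)\<^sup>2)"
    proof (rule Bochner_Integration.integrable_bound)
      show "integrable lebesgue (\<lambda>x. (tr0 e x)\<^sup>2)" using t by (simp add: L2_def)
      show "AE x in lebesgue. norm ((radial_cutoff R x * tr0 e x)\<^sup>2) \<le> norm ((tr0 e x)\<^sup>2)"
      proof (rule AE_I2)
        fix x
        have "(radial_cutoff R x)\<^sup>2 * (tr0 e x)\<^sup>2 \<le> 1 * (tr0 e x)\<^sup>2"
          by (intro mult_right_mono power_le_one radial_cutoff_bounds) auto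
        then show "norm ((radial_cutoff R x * tr0 e x)\<^sup>2) \<le> norm ((tr0 e x)\<^sup>2)" by (simp add: power_mult_distrib)
      qed
    qed measurable
    then show "(\<lambda>x. radial_cutoff R x * tr0 e x) \<in> L2" by (simp add: L2_def)
  qed
  then show "(\<lambda>z. ?\<eta> z * e z) \<in> trial_space \<beta> s halfspace" using V by (simp add: trial_space_def \<alpha>_def)
qed

lemma half_energy_integrable:
  assumes "has_weak_gradient_on U G halfspace" "set_integrable lebesgue halfspace (sobolev_density \<alpha> U G)"
  shows "integrable lebesgue (\<lambda>z. half_weight \<alpha> z * (norm (G z))\<^sup>2)"
proof (rule Bochner_Integration.integrable_bound)
  show "integrable lebesgue (\<lambda>z. indicator halfspace z *\<^sub>R sobolev_density \<alpha> U G z)"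
    using assms(2) by (simp add: set_integrable_def)
  note [measurable] = has_weak_gradient_measurable[OF open_halfspace assms(1)] borel_imp_lebesgue[OF measurable_snd_powr]
  have "(\<lambda>z. half_weight \<alpha> z * (norm (G z))\<^sup>2) = (\<lambda>z. snd z powr \<alpha> * (norm (indicator halfspace z *\<^sub>R G z))\<^sup>2)"
    by (auto simp: half_weight_def fun_eq_iff split: split_indicator)
  also have "\<dots> \<in> borel_measurable lebesgue" by measurable
  finally show "(\<lambda>z. half_weight \<alpha> z * (norm (G z))\<^sup>2) \<in> borel_measurable lebesgue" .
  show "AE z in lebesgue. norm (half_weight \<alpha> z * (norm (G z))\<^sup>2) \<le> norm (indicator halfspace z *\<^sub>R sobolev_density \<alpha> U G z)"
    by (intro AE_I2) (auto simp: half_weight_def sobolev_density_def abs_mult split: split_indicator intro!: mult_left_mono)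
qed

lemma measurable_far [measurable]:
  "(\<lambda>z::'a::euclidean_space \<times> real. if R \<le> norm (fst z) \<or> R \<le> snd z then 1 else 0 :: real) \<in> borel_measurable lebesgue"
  by (rule borel_imp_lebesgue) measurable

text \<open>
  The identity for the energy of the difference is obtained from the two weak formulations.  The
  constant depends on the coefficients, on the Hardy constant and on the cutoff profile, but not on the
  height \<open>Y\<close>.
\<close>

lemma truncation_energy_estimate:
  fixes \<AA> :: "real^'n \<Rightarrow> real^'n^'n" and U :: "(real^'n) \<times> real \<Rightarrow> real"
  assumes \<beta>: "0 < \<beta>" "\<beta> < 1" and s: "0 \<le> s"
    and cont: "continuous_on UNIV \<AA>" and M: "\<And>x. norm (\<AA> x) \<le> M"
    and A0: "0 < A0" "\<And>x \<xi>. A0 * (norm \<xi>)\<^sup>2 \<le> (\<AA> x *v \<xi>) \<bullet> \<xi>"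
    and U: "solves_on \<beta> s \<AA> f halfspace U"
    and f: "f \<in> borel_measurable lebesgue" "AE x in lebesgue. R0 \<le> norm x \<longrightarrow> f x = 0"
    and CH: "0 \<le> CH" and Hardy: "\<forall>Y>0. \<forall>(e :: (real^'n) \<times> real \<Rightarrow> real) G. has_weak_gradient_on e G (slab Y) \<longrightarrow>
      set_integrable lebesgue (slab Y) (sobolev_density (1 - 2 * \<beta>) e G) \<longrightarrow> (s > 0 \<longrightarrow> tr0 e \<in> L2) \<longrightarrow>
      (LINT z|lebesgue. strip_weight (1 - 2 * \<beta>) Y z * (inverse ((rho z)\<^sup>2) * (e z)\<^sup>2))
        \<le> CH * ((LINT z|lebesgue. strip_weight (1 - 2 * \<beta>) Y z * (norm (G z))\<^sup>2) + s * (LINT x|lebesgue. (tr0 e x)\<^sup>2))"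
  shows "\<exists>K\<ge>0. \<forall>Y V. 3 \<le> Y \<and> 3 * R0 \<le> Y \<and> solves_on \<beta> s \<AA> f (slab Y) V \<longrightarrow>
     (H1rho_norm (1 - 2 * \<beta>) (slab Y) (\<lambda>z. V z - U z))\<^sup>2 + s * (LINT x|lebesgue. (tr0 V x - tr0 U x)\<^sup>2)
       \<le> K * energy_tail (1 - 2 * \<beta>) s U (Y / 3)"
proof -
  define \<alpha> where "\<alpha> = 1 - 2 * \<beta>"
  define d where "d = d_const \<beta>"
  have d: "0 < d" unfolding d_def using \<beta> by (rule d_const_pos)
  have \<alpha>1: "\<alpha> < 1" using \<beta> by (simp add: \<alpha>_def)
  define G where "G = weak_gradient halfspace U"
  have UH: "U \<in> H1rho \<alpha> halfspace" and Utr: "s > 0 \<Longrightarrow> tr0 U \<in> L2"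
    using U by (auto simp: solves_on_def trial_space_def \<alpha>_def)
  obtain G' where "has_weak_gradient_on U G' halfspace" "weak_gradient halfspace U = G'" "set_integrable lebesgue halfspace (sobolev_density \<alpha> U G')"
    using UH by (rule H1rhoE)
  then have UG: "has_weak_gradient_on U G halfspace" and Ufin: "set_integrable lebesgue halfspace (sobolev_density \<alpha> U G)"
    by (auto simp: G_def)
  have M0: "0 \<le> M" using M[of 0] norm_ge_zero order_trans by blast
  \<comment> \<open>The summand 1 accounts for the last diagonal entry of the block matrix.\<close>
  define M' where "M' = M + 1"
  have M': "0 < M'" using M0 by (simp add: M'_def)
  have Bbound: "\<bar>block_mult (\<AA> x) a \<bullet> b\<bar> \<le> M' * (norm a * norm b)" for x a b
    using block_mult_inner_le[of "\<AA> x" a b] mult_right_mono[of "norm (\<AA> x) + 1" M' "norm a * norm b"] M[of x]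
    by (simp add: M'_def)
  define m where "m = min A0 1"
  have m: "0 < m" using A0(1) by (simp add: m_def)
  have coercive: "m * (norm a)\<^sup>2 \<le> block_mult (\<AA> x) a \<bullet> a" for x a
    unfolding m_def by (rule block_mult_coercive[OF A0(2)])
  obtain C where C: "C \<ge> 0" "\<forall>R\<ge>1. \<forall>z::(real^'n) \<times> real. norm (gradient (space_cutoff R) z) \<le> C * inverse (rho z) \<and>
     (norm (fst z) < R \<and> \<bar>snd z\<bar> < R \<longrightarrow> gradient (space_cutoff R) z = 0)"
    using space_cutoff_gradient[where 'a = "real^'n"] by (elim exE conjE)
  define \<kappa> where "\<kappa> = min (m / 2) (d / 4)"
  define \<mu> where "\<mu> = \<kappa> / (1 + C\<^sup>2 * CH)"
  have \<kappa>: "0 < \<kappa>" "2 * \<kappa> \<le> m" "4 * \<kappa> \<le> d" using m d by (auto simp: \<kappa>_def min_def)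
  have den: "0 < 1 + C\<^sup>2 * CH" using CH by (intro add_pos_nonneg) auto
  have \<mu>: "0 < \<mu>" "\<mu> * (1 + C\<^sup>2 * CH) = \<kappa>" using \<kappa>(1) den by (auto simp: \<mu>_def)
  define P where "P = M'\<^sup>2 / (2 * \<mu>)"
  have P: "0 \<le> P" using \<mu> by (simp add: P_def)
  define K where "K = (1 + CH) * ((P + d / 2) / \<kappa>)"
  have K: "0 \<le> K" using CH P d \<kappa> by (simp add: K_def)
  have "(H1rho_norm \<alpha> (slab Y) (\<lambda>z. V z - U z))\<^sup>2 + s * (LINT x|lebesgue. (tr0 V x - tr0 U x)\<^sup>2) \<le> K * energy_tail \<alpha> s U (Y / 3)"
    if Y: "3 \<le> Y" "3 * R0 \<le> Y" and V: "solves_on \<beta> s \<AA> f (slab Y) V" for Y V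
  proof -
    define R where "R = Y / 3"
    have R: "1 \<le> R" "2 * R < Y" "R0 \<le> R" and Y0: "0 < Y" using Y by (auto simp: R_def)
    let ?w = "strip_weight \<alpha> Y :: (real^'n) \<times> real \<Rightarrow> real"
    let ?\<eta> = "space_cutoff R :: (real^'n) \<times> real \<Rightarrow> real"
    let ?far = "\<lambda>z::(real^'n) \<times> real. if R \<le> norm (fst z) \<or> R \<le> snd z then 1 else 0 :: real"
    define e where "e = (\<lambda>z. V z - U z)"
    have VH: "V \<in> H1rho \<alpha> (slab Y)" and Vtr: "s > 0 \<Longrightarrow> tr0 V \<in> L2"
      using V by (auto simp: solves_on_def trial_space_def \<alpha>_def)
    define GV where "GV = weak_gradient (slab Y) V"
    obtain G'' where "has_weak_gradient_on V G'' (slab Y)" "weak_gradient (slab Y) V = G''" "set_integrable lebesgue (slab Y) (sobolev_density \<alpha> V G'')"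
      using VH by (rule H1rhoE)
    then have VG: "has_weak_gradient_on V GV (slab Y)" and Vfin: "set_integrable lebesgue (slab Y) (sobolev_density \<alpha> V GV)"
      by (auto simp: GV_def)
    have UGs: "has_weak_gradient_on U G (slab Y)" by (rule has_weak_gradient_subset[OF UG slab_subset_halfspace])
    have UHs: "U \<in> H1rho \<alpha> (slab Y)" by (rule H1rho_subset[OF UH open_halfspace open_slab slab_subset_halfspace])
    then have Ufins: "set_integrable lebesgue (slab Y) (sobolev_density \<alpha> U G)" using H1rho_iff[OF open_slab UGs] by simp
    define H where "H = (\<lambda>z. GV z - G z)"
    have eG: "has_weak_gradient_on e H (slab Y)" unfolding e_def H_def by (rule has_weak_gradient_diff[OF VG UGs])
    have efin: "set_integrable lebesgue (slab Y) (sobolev_density \<alpha> e H)"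
      unfolding e_def H_def by (rule sobolev_density_diff_integrable[OF open_slab VG UGs Vfin Ufins])
    have eH: "e \<in> H1rho \<alpha> (slab Y)" using H1rho_iff[OF open_slab eG] efin by simp
    note tU = H1rho_trace[OF UH open_halfspace slab_subset_halfspace Y0 \<alpha>1]
    note tV = H1rho_trace[OF VH open_slab order_refl Y0 \<alpha>1]
    note te = H1rho_trace[OF eH open_slab order_refl Y0 \<alpha>1]
    note [measurable] = has_trace0_measurable[OF tU(1)] has_trace0_measurable[OF tV(1)] has_trace0_measurable[OF te(1)]
    have tr_e: "AE x in lebesgue. tr0 e x = tr0 V x - tr0 U x"
      by (rule has_trace0_unique[OF te(1) _ te(2)]) (unfold e_def, rule has_trace0_diff[OF tV(1) tU(1) tV(2) tU(2)])
    have etr: "tr0 e \<in> L2" if "s > 0"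
      by (rule L2_cong_AE[OF L2_diff[OF Vtr[OF that] Utr[OF that]] _ tr_e]) measurable
    have e_trial: "e \<in> trial_space \<beta> s (slab Y)" using eH etr by (simp add: trial_space_def \<alpha>_def)
    define W where "W = (\<lambda>z. ?\<eta> z * e z)"
    define X where "X = (\<lambda>z. ?\<eta> z *\<^sub>R H z + e z *\<^sub>R gradient ?\<eta> z)"
    note cut = cutoff_in_trial_space[OF \<beta> e_trial eG R(1,2), folded W_def X_def]
    note [measurable] = cut(4)
    have XG: "has_weak_gradient_on W X (slab Y)" by (rule has_weak_gradient_subset[OF cut(2) slab_subset_halfspace])
    have "W \<in> H1rho \<alpha> halfspace" using cut(1) by (simp add: trial_space_def \<alpha>_def)
    then have "W \<in> H1rho \<alpha> (slab Y)" by (rule H1rho_subset[OF _ open_halfspace open_slab slab_subset_halfspace])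
    then have Xfin: "set_integrable lebesgue (slab Y) (sobolev_density \<alpha> W X)" using H1rho_iff[OF open_slab XG] by simp
    note pU = sobolev_density_parts[OF UGs Ufins] and pV = sobolev_density_parts[OF VG Vfin]
      and pe = sobolev_density_parts[OF eG efin] and pX = sobolev_density_parts[OF XG Xfin]
    note mG = has_weak_gradient_measurable(2)[OF open_slab UGs] and mV = has_weak_gradient_measurable(2)[OF open_slab VG]
      and mH = has_weak_gradient_measurable(2)[OF open_slab eG] and mX = has_weak_gradient_measurable(2)[OF open_slab XG]
    define B where "B a b z = ?w z * (block_mult (\<AA> (fst z)) (a z) \<bullet> b z)" for a b z
    have Bm: "B a b \<in> borel_measurable lebesgue"
      if "(\<lambda>z. indicator (slab Y) z *\<^sub>R a z) \<in> borel_measurable lebesgue" "(\<lambda>z. indicator (slab Y) z *\<^sub>R b z) \<in> borel_measurable lebesgue" for a b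
    proof -
      note [measurable] = block_mult_inner_measurable[OF cont that] borel_imp_lebesgue[OF measurable_snd_powr]
      have "B a b z = snd z powr \<alpha> * (block_mult (\<AA> (fst z)) (indicator (slab Y) z *\<^sub>R a z) \<bullet> (indicator (slab Y) z *\<^sub>R b z))" for z
        by (auto simp: B_def strip_weight_def split: split_indicator)
      then have "B a b = (\<lambda>z. snd z powr \<alpha> * (block_mult (\<AA> (fst z)) (indicator (slab Y) z *\<^sub>R a z) \<bullet> (indicator (slab Y) z *\<^sub>R b z)))" by (rule ext)
      also have "\<dots> \<in> borel_measurable lebesgue" by measurable
      finally show ?thesis .
    qed
    have Bi: "integrable lebesgue (B a b)"
      if "(\<lambda>z. indicator (slab Y) z *\<^sub>R a z) \<in> borel_measurable lebesgue" "(\<lambda>z. indicator (slab Y) z *\<^sub>R b z) \<in> borel_measurable lebesgue"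
        "integrable lebesgue (\<lambda>z. ?w z * (norm (a z))\<^sup>2)" "integrable lebesgue (\<lambda>z. ?w z * (norm (b z))\<^sup>2)" for a b
    proof (rule Bochner_Integration.integrable_bound[OF _ Bm[OF that(1,2)]])
      show "integrable lebesgue (\<lambda>z. M' * (?w z * (norm (a z))\<^sup>2 + ?w z * (norm (b z))\<^sup>2))" using that(3,4) by simp
      have "\<bar>B a b z\<bar> \<le> M' * (?w z * (norm (a z))\<^sup>2 + ?w z * (norm (b z))\<^sup>2)" for z
      proof -
        have "norm (a z) * norm (b z) \<le> (norm (a z))\<^sup>2 + (norm (b z))\<^sup>2"
          using zero_le_power2[of "norm (a z) - norm (b z)"] zero_le_power2[of "norm (a z)"] zero_le_power2[of "norm (b z)"]
          unfolding power2_diff by linarith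
        then have "\<bar>block_mult (\<AA> (fst z)) (a z) \<bullet> b z\<bar> \<le> M' * ((norm (a z))\<^sup>2 + (norm (b z))\<^sup>2)"
          using Bbound[of "fst z" "a z" "b z"] M' by (meson mult_left_mono less_imp_le order_trans)
        from mult_left_mono[OF this, of "?w z"] show ?thesis by (simp add: B_def abs_mult algebra_simps)
      qed
      then show "AE z in lebesgue. norm (B a b z) \<le> norm (M' * (?w z * (norm (a z))\<^sup>2 + ?w z * (norm (b z))\<^sup>2))"
        by (intro AE_I2) (auto intro: order_trans[OF _ abs_ge_self])
    qed
    note iVH = Bi[OF mV mH pV(1) pe(1)] and iGH = Bi[OF mG mH pU(1) pe(1)] and iHH = Bi[OF mH mH pe(1) pe(1)] and iGX = Bi[OF mG mX pU(1) pX(1)]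
    define N1 where "N1 = (LINT z|lebesgue. ?w z * (norm (H z))\<^sup>2)"
    define N2 where "N2 = (LINT z|lebesgue. ?w z * (inverse ((rho z)\<^sup>2) * (e z)\<^sup>2))"
    define N3 where "N3 = s * (LINT x|lebesgue. (tr0 e x)\<^sup>2)"
    define t1 where "t1 = (LINT z|lebesgue. half_weight \<alpha> z * (norm (G z))\<^sup>2 * ?far z)"
    define t3 where "t3 = s * (LINT x|lebesgue. (tr0 U x)\<^sup>2 * (if R \<le> norm x then 1 else 0))"
    have nonneg: "0 \<le> N1" "0 \<le> N2" "0 \<le> N3" "0 \<le> t1" "0 \<le> t3"
      unfolding N1_def N2_def N3_def t1_def t3_def half_weight_def using s by (auto intro!: mult_nonneg_nonneg integral_nonneg_AE)
    have N2: "N2 \<le> CH * (N1 + N3)"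
      unfolding N1_def N2_def N3_def using Hardy[rule_format, OF Y0 eG efin[unfolded \<alpha>_def] etr] by (simp add: \<alpha>_def)

    \<comment> \<open>The truncated problem is tested with \<open>e\<close> and the full problem with \<open>W\<close>; the cutoff is 1 on the support of \<open>f\<close>.\<close>
    have form_V: "(LINT z|lebesgue. B GV H z) + s * d * (LINT x|lebesgue. tr0 V x * tr0 e x) = d * L2_inner f (tr0 e)"
    proof -
      have we: "has_weak_gradient_on e (weak_gradient (slab Y) e) (slab Y)" by (rule has_weak_gradient_weak_gradient[OF eG])
      have "(LINT z:slab Y|lebesgue. snd z powr \<alpha> * (block_mult (\<AA> (fst z)) (weak_gradient (slab Y) V z) \<bullet> weak_gradient (slab Y) e z))
          = (LINT z|lebesgue. B GV (weak_gradient (slab Y) e) z)"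
        by (simp add: set_lebesgue_integral_def B_def strip_weight_def GV_def mult.assoc)
      also have "\<dots> = (LINT z|lebesgue. B GV H z)"
      proof (rule integral_cong_AE[OF Bm[OF mV has_weak_gradient_measurable(2)[OF open_slab we]] Bm[OF mV mH]])
        show "AE z in lebesgue. B GV (weak_gradient (slab Y) e) z = B GV H z"
          using weak_gradient_eq_AE[OF open_slab eG] by eventually_elim (auto simp: B_def strip_weight_def split: split_indicator)
      qed
      finally have "(LINT z:slab Y|lebesgue. snd z powr \<alpha> * (block_mult (\<AA> (fst z)) (weak_gradient (slab Y) V z) \<bullet> weak_gradient (slab Y) e z))
          = (LINT z|lebesgue. B GV H z)" .
      moreover have "bilinear_form \<beta> s \<AA> (slab Y) V e = d_const \<beta> * L2_inner f (tr0 e)"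
        using V e_trial by (simp add: solves_on_def)
      ultimately show ?thesis unfolding bilinear_form_def \<alpha>_def d_def by simp
    qed
    have form_U: "(LINT z|lebesgue. B G X z) + s * d * (LINT x|lebesgue. tr0 U x * tr0 W x) = d * L2_inner f (tr0 W)"
    proof -
      have wW: "has_weak_gradient_on W (weak_gradient halfspace W) halfspace" by (rule has_weak_gradient_weak_gradient[OF cut(2)])
      have "(LINT z:halfspace|lebesgue. snd z powr \<alpha> * (block_mult (\<AA> (fst z)) (weak_gradient halfspace U z) \<bullet> weak_gradient halfspace W z))
          = (LINT z|lebesgue. B G X z)"
        unfolding set_lebesgue_integral_def
      proof (rule integral_cong_AE[OF _ Bm[OF mG mX]])
        note [measurable] = block_mult_inner_measurable[OF cont has_weak_gradient_measurable(2)[OF open_halfspace UG] has_weak_gradient_measurable(2)[OF open_halfspace wW]]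
          borel_imp_lebesgue[OF measurable_snd_powr]
        have "(\<lambda>z. indicator halfspace z *\<^sub>R (snd z powr \<alpha> * (block_mult (\<AA> (fst z)) (weak_gradient halfspace U z) \<bullet> weak_gradient halfspace W z)))
          = (\<lambda>z. snd z powr \<alpha> * (block_mult (\<AA> (fst z)) (indicator halfspace z *\<^sub>R G z) \<bullet> (indicator halfspace z *\<^sub>R weak_gradient halfspace W z)))"
          by (auto simp: fun_eq_iff G_def split: split_indicator)
        also have "\<dots> \<in> borel_measurable lebesgue" by measurable
        finally show "(\<lambda>z. indicator halfspace z *\<^sub>R (snd z powr \<alpha> * (block_mult (\<AA> (fst z)) (weak_gradient halfspace U z) \<bullet> weak_gradient halfspace W z))) \<in> borel_measurable lebesgue" .
        have out: "X z = 0" if "z \<in> halfspace" "z \<notin> slab Y" for z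
        proof -
          have 1: "?\<eta> z' = 0" if "2 * R \<le> snd z'" for z'
            using that R radial_cutoff_eq_0[of R "snd z'"] by (simp add: space_cutoff_def)
          have far: "2 * R < snd z" using that R by (auto simp: halfspace_iff slab_iff)
          have "(?\<eta> has_derivative (\<lambda>_. 0)) (at z)"
          proof (rule has_derivative_transform_within_open[of "\<lambda>_. 0" _ _ _ "{z. 2 * R < snd z}"])
            show "open {z :: (real^'n) \<times> real. 2 * R < snd z}" by (intro open_Collect_less continuous_intros)
          qed (use far 1 in auto)
          then have "frechet_derivative ?\<eta> (at z) = (\<lambda>_. 0)" using frechet_derivative_at by metis
          then show ?thesis using 1[of z] far by (simp add: X_def gradient_def)
        qed
        show "AE z in lebesgue. indicator halfspace z *\<^sub>R (snd z powr \<alpha> * (block_mult (\<AA> (fst z)) (weak_gradient halfspace U z) \<bullet> weak_gradient halfspace W z)) = B G X z"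
          using weak_gradient_eq_AE[OF open_halfspace cut(2)]
        proof eventually_elim
          fix z assume *: "z \<in> halfspace \<longrightarrow> weak_gradient halfspace W z = X z"
          show "indicator halfspace z *\<^sub>R (snd z powr \<alpha> * (block_mult (\<AA> (fst z)) (weak_gradient halfspace U z) \<bullet> weak_gradient halfspace W z)) = B G X z"
            using * out[of z] subsetD[OF slab_subset_halfspace, of z Y]
            by (cases "z \<in> halfspace"; cases "z \<in> slab Y") (auto simp: B_def strip_weight_def G_def)
        qed
      qed
      moreover have "bilinear_form \<beta> s \<AA> halfspace U W = d_const \<beta> * L2_inner f (tr0 W)"
        using U cut(1) by (simp add: solves_on_def)
      ultimately show ?thesis unfolding bilinear_form_def \<alpha>_def d_def by simp
    qed
    have same_rhs: "L2_inner f (tr0 W) = L2_inner f (tr0 e)"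
      unfolding L2_inner_def
    proof (rule integral_cong_AE)
      show "AE x in lebesgue. f x * tr0 W x = f x * tr0 e x"
        using f(2) cut(3)
      proof eventually_elim
        fix x assume x: "R0 \<le> norm x \<longrightarrow> f x = 0" "tr0 W x = radial_cutoff R x * tr0 e x"
        show "f x * tr0 W x = f x * tr0 e x"
        proof (cases "R0 \<le> norm x")
          case False
          then have "radial_cutoff R x = 1" using R by (intro radial_cutoff_eq_1) auto
          then show ?thesis using x by simp
        qed (use x in simp)
      qed
    qed (use f(1) in measurable)

    have coer: "m * N1 \<le> (LINT z|lebesgue. B GV H z) - (LINT z|lebesgue. B G H z)"
    proof -
      have "m * N1 = (LINT z|lebesgue. m * (?w z * (norm (H z))\<^sup>2))" by (simp add: N1_def)
      also have "\<dots> \<le> (LINT z|lebesgue. B H H z)"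
      proof (rule integral_mono[OF _ iHH])
        show "integrable lebesgue (\<lambda>z. m * (?w z * (norm (H z))\<^sup>2))" using pe(1) by simp
        show "m * (?w z * (norm (H z))\<^sup>2) \<le> B H H z" for z
          using mult_left_mono[OF coercive[of "H z" "fst z"], of "?w z"] by (simp add: B_def mult.left_commute)
      qed
      also have "\<dots> = (LINT z|lebesgue. B GV H z - B G H z)"
        by (rule arg_cong[where f="integral\<^sup>L lebesgue"]) (simp add: fun_eq_iff B_def H_def block_mult_diff_left inner_diff_left algebra_simps)
      also have "\<dots> = (LINT z|lebesgue. B GV H z) - (LINT z|lebesgue. B G H z)" using iVH iGH by simp
      finally show ?thesis .
    qed
    have iG: "integrable lebesgue (\<lambda>z. half_weight \<alpha> z * (norm (G z))\<^sup>2)" by (rule half_energy_integrable[OF UG Ufin])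
    have iGfar: "integrable lebesgue (\<lambda>z. half_weight \<alpha> z * (norm (G z))\<^sup>2 * ?far z)"
    proof (rule Bochner_Integration.integrable_bound[OF iG])
      show "(\<lambda>z. half_weight \<alpha> z * (norm (G z))\<^sup>2 * ?far z) \<in> borel_measurable lebesgue"
        by (intro borel_measurable_times[OF borel_measurable_integrable[OF iG]] measurable_far)
    qed auto
    \<comment> \<open>The gradients \<open>X\<close> and \<open>H\<close> agree where the cutoff is 1, so only the far part of \<open>G\<close> enters.\<close>
    have commutator: "(LINT z|lebesgue. B G X z) - (LINT z|lebesgue. B G H z) \<le> P * t1 + \<mu> * (N1 + C\<^sup>2 * N2)"
    proof -
      have "(LINT z|lebesgue. B G X z) - (LINT z|lebesgue. B G H z) = (LINT z|lebesgue. B G X z - B G H z)" using iGX iGH by simp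
      also have "\<dots> \<le> (LINT z|lebesgue. P * (half_weight \<alpha> z * (norm (G z))\<^sup>2 * ?far z)
          + \<mu> * (?w z * (norm (H z))\<^sup>2 + C\<^sup>2 * (?w z * (inverse ((rho z)\<^sup>2) * (e z)\<^sup>2))))"
      proof (rule integral_mono)
        show "integrable lebesgue (\<lambda>z. B G X z - B G H z)" using iGX iGH by simp
        show "integrable lebesgue (\<lambda>z. P * (half_weight \<alpha> z * (norm (G z))\<^sup>2 * ?far z)
          + \<mu> * (?w z * (norm (H z))\<^sup>2 + C\<^sup>2 * (?w z * (inverse ((rho z)\<^sup>2) * (e z)\<^sup>2))))"
          using iGfar pe(1,2) by (intro Bochner_Integration.integrable_add integrable_mult_right)
        fix z :: "(real^'n) \<times> real"
        show "B G X z - B G H z \<le> P * (half_weight \<alpha> z * (norm (G z))\<^sup>2 * ?far z)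
          + \<mu> * (?w z * (norm (H z))\<^sup>2 + C\<^sup>2 * (?w z * (inverse ((rho z)\<^sup>2) * (e z)\<^sup>2)))"
        proof (cases "z \<in> slab Y \<and> (R \<le> norm (fst z) \<or> R \<le> snd z)")
          case True
          then have hw: "half_weight \<alpha> z = ?w z"
            by (auto simp: half_weight_def strip_weight_def slab_iff halfspace_iff)
          have XH: "norm (X z - H z) \<le> norm (H z) + C * (inverse (rho z) * \<bar>e z\<bar>)"
          proof -
            have "X z - H z = (?\<eta> z - 1) *\<^sub>R H z + e z *\<^sub>R gradient ?\<eta> z" by (simp add: X_def algebra_simps)
            then have "norm (X z - H z) \<le> \<bar>?\<eta> z - 1\<bar> * norm (H z) + \<bar>e z\<bar> * norm (gradient ?\<eta> z)"
              by (metis norm_scaleR norm_triangle_ineq)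
            also have "\<dots> \<le> 1 * norm (H z) + \<bar>e z\<bar> * (C * inverse (rho z))"
            proof (intro add_mono mult_right_mono mult_left_mono)
              show "norm (gradient ?\<eta> z) \<le> C * inverse (rho z)" using C(2) R(1) by blast
            qed (use space_cutoff_bounds[of R z] in auto)
            finally show ?thesis by (simp add: mult_ac)
          qed
          have "block_mult (\<AA> (fst z)) (G z) \<bullet> (X z - H z) \<le> M' * (norm (G z) * norm (X z - H z))"
            using Bbound[of "fst z" "G z" "X z - H z"] by simp
          also have "\<dots> \<le> (M' * norm (G z)) * (norm (H z) + C * (inverse (rho z) * \<bar>e z\<bar>))"
            using XH M' by (simp add: mult.assoc mult_left_mono)
          also have "\<dots> \<le> (M' * norm (G z))\<^sup>2 / (2 * \<mu>) + \<mu> * ((norm (H z))\<^sup>2 + (C * (inverse (rho z) * \<bar>e z\<bar>))\<^sup>2)"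
            using \<mu>(1) M' C(1) rho_pos[of z] by (intro Young_tail) auto
          also have "\<dots> = P * (norm (G z))\<^sup>2 + \<mu> * ((norm (H z))\<^sup>2 + C\<^sup>2 * (inverse ((rho z)\<^sup>2) * (e z)\<^sup>2))"
            by (simp add: P_def power_mult_distrib power_inverse)
          finally have "?w z * (block_mult (\<AA> (fst z)) (G z) \<bullet> (X z - H z))
              \<le> ?w z * (P * (norm (G z))\<^sup>2 + \<mu> * ((norm (H z))\<^sup>2 + C\<^sup>2 * (inverse ((rho z)\<^sup>2) * (e z)\<^sup>2)))"
            by (rule mult_left_mono) simp
          then show ?thesis using True unfolding hw by (simp add: B_def inner_diff_right algebra_simps)
        next
          case False
          have "B G X z = B G H z"
          proof (cases "z \<in> slab Y")
            case True
            then have z: "norm (fst z) < R" "\<bar>snd z\<bar> < R" using False by (auto simp: slab_iff)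
            then have "?\<eta> z = 1" using R radial_cutoff_eq_1[of R "fst z"] radial_cutoff_eq_1[of R "snd z"] by (simp add: space_cutoff_def)
            moreover have "gradient ?\<eta> z = 0" using C(2) R(1) z by blast
            ultimately show ?thesis by (simp add: B_def X_def)
          qed (simp add: B_def strip_weight_def)
          then show ?thesis
            using P \<mu>(1) by (auto simp: half_weight_def intro!: add_nonneg_nonneg mult_nonneg_nonneg)
        qed
      qed
      also have "\<dots> = P * t1 + \<mu> * (N1 + C\<^sup>2 * N2)"
        using iGfar pe(1,2) by (simp add: t1_def N1_def N2_def)
      finally show ?thesis .
    qed

    \<comment> \<open>The traces of \<open>W\<close> and \<open>e\<close> agree for \<open>\<bar>x\<bar> \<le> R\<close>; Young's inequality costs half of the square of the trace of \<open>e\<close>.\<close>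
    have trace: "s * (LINT x|lebesgue. tr0 U x * tr0 W x) - s * (LINT x|lebesgue. tr0 V x * tr0 e x) \<le> t3 / 2 - N3 / 2"
    proof (cases "s = 0")
      case False
      then have "s > 0" using s by simp
      note L = Utr[OF this] Vtr[OF this] etr[OF this]
      have Wtr: "tr0 W \<in> L2" using cut(1) \<open>s > 0\<close> by (simp add: trial_space_def)
      have i1: "integrable lebesgue (\<lambda>x. tr0 U x * tr0 W x)" and i2: "integrable lebesgue (\<lambda>x. tr0 V x * tr0 e x)"
        using L Wtr by (auto simp: L2_def intro!: integrable_square_mult)
      have iUf: "integrable lebesgue (\<lambda>x. (tr0 U x)\<^sup>2 * (if R \<le> norm x then 1 else 0))"
      proof (rule Bochner_Integration.integrable_bound)
        show "integrable lebesgue (\<lambda>x. (tr0 U x)\<^sup>2)" using L by (simp add: L2_def)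
        have [measurable]: "(\<lambda>x::real^'n. if R \<le> norm x then 1 else 0 :: real) \<in> borel_measurable lebesgue"
          by (rule borel_imp_lebesgue) measurable
        show "(\<lambda>x. (tr0 U x)\<^sup>2 * (if R \<le> norm x then 1 else 0)) \<in> borel_measurable lebesgue" by measurable
      qed auto
      have ie: "integrable lebesgue (\<lambda>x. (tr0 e x)\<^sup>2)" using L by (simp add: L2_def)
      have "(LINT x|lebesgue. tr0 U x * tr0 W x) - (LINT x|lebesgue. tr0 V x * tr0 e x)
          = (LINT x|lebesgue. tr0 U x * tr0 W x - tr0 V x * tr0 e x)" using i1 i2 by simp
      also have "\<dots> \<le> (LINT x|lebesgue. 1/2 * ((tr0 U x)\<^sup>2 * (if R \<le> norm x then 1 else 0)) - 1/2 * (tr0 e x)\<^sup>2)"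
      proof (rule integral_mono_AE)
        show "integrable lebesgue (\<lambda>x. tr0 U x * tr0 W x - tr0 V x * tr0 e x)" using i1 i2 by simp
        show "integrable lebesgue (\<lambda>x. 1/2 * ((tr0 U x)\<^sup>2 * (if R \<le> norm x then 1 else 0)) - 1/2 * (tr0 e x)\<^sup>2)"
          using iUf ie by (intro Bochner_Integration.integrable_diff integrable_mult_right)
        show "AE x in lebesgue. tr0 U x * tr0 W x - tr0 V x * tr0 e x
          \<le> 1/2 * ((tr0 U x)\<^sup>2 * (if R \<le> norm x then 1 else 0)) - 1/2 * (tr0 e x)\<^sup>2"
          using cut(3) tr_e
        proof eventually_elim
          fix x assume x: "tr0 W x = radial_cutoff R x * tr0 e x" "tr0 e x = tr0 V x - tr0 U x"
          let ?u = "tr0 U x" and ?e = "tr0 e x" and ?c = "radial_cutoff R x"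
          have "?u * tr0 W x - tr0 V x * ?e = ?u * (?c - 1) * ?e - ?e\<^sup>2"
          proof -
            have v: "tr0 V x = ?e + ?u" using x(2) by simp
            show ?thesis unfolding x(1) v by (simp add: power2_eq_square algebra_simps)
          qed
          also have "?u * (?c - 1) * ?e \<le> 1/2 * (?u\<^sup>2 * (if R \<le> norm x then 1 else 0)) + 1/2 * ?e\<^sup>2"
          proof (cases "R \<le> norm x")
            case True
            have "\<bar>?u * (?c - 1) * ?e\<bar> \<le> \<bar>?u\<bar> * 1 * \<bar>?e\<bar>"
              unfolding abs_mult using radial_cutoff_bounds[of R x] by (intro mult_mono) auto
            also have "\<dots> \<le> 1/2 * ?u\<^sup>2 + 1/2 * ?e\<^sup>2"
              using zero_le_power2[of "\<bar>?u\<bar> - \<bar>?e\<bar>"] unfolding power2_diff power2_abs by simp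
            finally show ?thesis using True by simp
          next
            case False
            then have "?c = 1" using R by (intro radial_cutoff_eq_1) auto
            then show ?thesis using False by simp
          qed
          finally show "?u * tr0 W x - tr0 V x * ?e \<le> 1/2 * (?u\<^sup>2 * (if R \<le> norm x then 1 else 0)) - 1/2 * ?e\<^sup>2"
            by linarith
        qed
      qed
      also have "\<dots> = 1/2 * (LINT x|lebesgue. (tr0 U x)\<^sup>2 * (if R \<le> norm x then 1 else 0)) - 1/2 * (LINT x|lebesgue. (tr0 e x)\<^sup>2)"
        using iUf ie by simp
      finally have "s * ((LINT x|lebesgue. tr0 U x * tr0 W x) - (LINT x|lebesgue. tr0 V x * tr0 e x))
        \<le> s * (1/2 * (LINT x|lebesgue. (tr0 U x)\<^sup>2 * (if R \<le> norm x then 1 else 0)) - 1/2 * (LINT x|lebesgue. (tr0 e x)\<^sup>2))"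
        using s by (rule mult_left_mono)
      then show ?thesis by (simp add: t3_def N3_def algebra_simps)
    qed (simp add: t3_def N3_def)

    \<comment> \<open>The choice of \<open>\<mu>\<close> bounds the error term by \<open>\<kappa> (N1 + N3)\<close>, and the left-hand side contains this twice.\<close>
    have "m * N1 \<le> P * t1 + \<mu> * (N1 + C\<^sup>2 * N2) + d * (t3 / 2 - N3 / 2)"
      using coer commutator form_V form_U same_rhs mult_left_mono[OF trace, of d] d by (simp add: algebra_simps)
    moreover have "\<mu> * (N1 + C\<^sup>2 * N2) \<le> \<kappa> * (N1 + N3)"
    proof -
      have "N1 + C\<^sup>2 * N2 \<le> (N1 + N3) + C\<^sup>2 * (CH * (N1 + N3))"
        using nonneg N2 by (intro add_mono mult_left_mono) auto
      also have "\<dots> = (1 + C\<^sup>2 * CH) * (N1 + N3)" by (simp add: algebra_simps)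
      finally have "\<mu> * (N1 + C\<^sup>2 * N2) \<le> \<mu> * ((1 + C\<^sup>2 * CH) * (N1 + N3))" using \<mu>(1) by (intro mult_left_mono) auto
      then show ?thesis using \<mu>(2) by (simp add: mult.assoc[symmetric])
    qed
    ultimately have "m * N1 + d / 2 * N3 \<le> P * t1 + d / 2 * t3 + \<kappa> * (N1 + N3)"
      by (simp add: algebra_simps)
    moreover have "2 * (\<kappa> * N1) \<le> m * N1" "4 * (\<kappa> * N3) \<le> d * N3"
      unfolding mult.assoc[symmetric] using \<kappa> nonneg by (auto intro: mult_right_mono)
    moreover have "P * t1 + d / 2 * t3 \<le> (P + d / 2) * (t1 + t3)"
    proof -
      have "0 \<le> P * t3" "0 \<le> d / 2 * t1" using P d nonneg by auto
      then show ?thesis unfolding distrib_left distrib_right by linarith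
    qed
    moreover have "\<kappa> * (N1 + N3) = \<kappa> * N1 + \<kappa> * N3" by (rule distrib_left)
    ultimately have "\<kappa> * (N1 + N3) \<le> (P + d / 2) * (t1 + t3)" by linarith
    then have bound: "N1 + N3 \<le> (P + d / 2) / \<kappa> * (t1 + t3)" using \<kappa>(1) by (simp add: field_simps)
    have "N1 + N2 + N3 \<le> (1 + CH) * (N1 + N3)" using N2 by (simp add: algebra_simps)
    also have "\<dots> \<le> (1 + CH) * ((P + d / 2) / \<kappa> * (t1 + t3))" using bound CH by (intro mult_left_mono) auto
    also have "\<dots> = K * (t1 + t3)" by (simp add: K_def)
    finally have final: "N1 + N2 + N3 \<le> K * (t1 + t3)" .
    have "(H1rho_norm \<alpha> (slab Y) e)\<^sup>2 = N1 + N2"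
      unfolding H1rho_norm_eq[OF open_slab eG] pe(3) N1_def[symmetric] N2_def[symmetric] using nonneg by simp
    moreover have "s * (LINT x|lebesgue. (tr0 V x - tr0 U x)\<^sup>2) = N3"
      unfolding N3_def using tr_e by (intro arg_cong2[where f="(*)"] integral_cong_AE refl) (auto elim: eventually_mono)
    moreover have "energy_tail \<alpha> s U (Y / 3) = t1 + t3"
      by (simp add: energy_tail_def t1_def t3_def R_def G_def)
    ultimately show ?thesis using final by (simp add: e_def)
  qed
  then show ?thesis using K unfolding \<alpha>_def by blast
qed

lemma energy_tail_tendsto_0:
  fixes U :: "(real^'n) \<times> real \<Rightarrow> real"
  assumes U: "U \<in> trial_space \<beta> s halfspace" and "0 \<le> s"
  shows "(energy_tail (1 - 2 * \<beta>) s U \<longlongrightarrow> 0) at_top"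
proof -
  let ?\<alpha> = "1 - 2 * \<beta>" and ?G = "weak_gradient halfspace U"
  obtain G where "has_weak_gradient_on U G halfspace" "?G = G" "set_integrable lebesgue halfspace (sobolev_density ?\<alpha> U G)"
    using U unfolding trial_space_def by (auto elim: H1rhoE)
  then have iG: "integrable lebesgue (\<lambda>z. half_weight ?\<alpha> z * (norm (?G z))\<^sup>2)"
    using half_energy_integrable by auto
  have "((\<lambda>R. LINT z|lebesgue. half_weight ?\<alpha> z * (norm (?G z))\<^sup>2 * (if R \<le> norm (fst z) \<or> R \<le> snd z then 1 else 0))
      \<longlongrightarrow> (LINT z|(lebesgue :: ((real^'n) \<times> real) measure). (0::real))) at_top"
  proof (rule integral_dominated_convergence_at_top)
    show "(\<lambda>z. half_weight ?\<alpha> z * (norm (?G z))\<^sup>2 * (if R \<le> norm (fst z) \<or> R \<le> snd z then 1 else 0)) \<in> borel_measurable lebesgue" for R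
      by (intro borel_measurable_times[OF borel_measurable_integrable[OF iG]] measurable_far)
    show "integrable lebesgue (\<lambda>z. half_weight ?\<alpha> z * (norm (?G z))\<^sup>2)" by (rule iG)
    show "AE z in lebesgue. ((\<lambda>R. half_weight ?\<alpha> z * (norm (?G z))\<^sup>2 * (if R \<le> norm (fst z) \<or> R \<le> snd z then 1 else 0)) \<longlongrightarrow> 0) at_top"
    proof (rule AE_I2, rule tendsto_eventually)
      fix z :: "(real^'n) \<times> real"
      show "\<forall>\<^sub>F R in at_top. half_weight ?\<alpha> z * (norm (?G z))\<^sup>2 * (if R \<le> norm (fst z) \<or> R \<le> snd z then 1 else 0) = 0"
        using eventually_gt_at_top[of "max (norm (fst z)) (snd z)"] by eventually_elim auto
    qed
    show "\<forall>\<^sub>F R in at_top. AE z in lebesgue. norm (half_weight ?\<alpha> z * (norm (?G z))\<^sup>2 * (if R \<le> norm (fst z) \<or> R \<le> snd z then 1 else 0))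
        \<le> half_weight ?\<alpha> z * (norm (?G z))\<^sup>2"
      by (intro always_eventually allI AE_I2) (auto simp: half_weight_def abs_mult)
  qed simp
  moreover have "((\<lambda>R. s * (LINT x|lebesgue. (tr0 U x)\<^sup>2 * (if R \<le> norm x then 1 else 0))) \<longlongrightarrow> 0) at_top"
  proof (cases "s = 0")
    case False
    then have L: "tr0 U \<in> L2" using U \<open>0 \<le> s\<close> by (simp add: trial_space_def)
    then have [measurable]: "tr0 U \<in> borel_measurable lebesgue" by (simp add: L2_def)
    have "((\<lambda>R. LINT x|lebesgue. (tr0 U x)\<^sup>2 * (if R \<le> norm x then 1 else 0))
        \<longlongrightarrow> (LINT x|(lebesgue :: (real^'n) measure). (0::real))) at_top"
    proof (rule integral_dominated_convergence_at_top)
      show "(\<lambda>x. (tr0 U x)\<^sup>2 * (if R \<le> norm x then 1 else 0)) \<in> borel_measurable lebesgue" for R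
      proof -
        have [measurable]: "(\<lambda>x::real^'n. if R \<le> norm x then 1 else 0 :: real) \<in> borel_measurable lebesgue"
          by (rule borel_imp_lebesgue) measurable
        show ?thesis by measurable
      qed
      show "integrable lebesgue (\<lambda>x. (tr0 U x)\<^sup>2)" using L by (simp add: L2_def)
      show "AE x in lebesgue. ((\<lambda>R. (tr0 U x)\<^sup>2 * (if R \<le> norm x then 1 else 0)) \<longlongrightarrow> 0) at_top"
      proof (rule AE_I2, rule tendsto_eventually)
        fix x :: "real^'n"
        show "\<forall>\<^sub>F R in at_top. (tr0 U x)\<^sup>2 * (if R \<le> norm x then 1 else 0) = 0"
          using eventually_gt_at_top[of "norm x"] by eventually_elim auto
      qed
      show "\<forall>\<^sub>F R in at_top. AE x in lebesgue. norm ((tr0 U x)\<^sup>2 * (if R \<le> norm x then 1 else 0)) \<le> (tr0 U x)\<^sup>2"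
        by (intro always_eventually allI AE_I2) auto
    qed simp
    from tendsto_mult[OF tendsto_const[of s] this] show ?thesis by simp
  qed simp
  ultimately have "((\<lambda>R. (LINT z|lebesgue. half_weight ?\<alpha> z * (norm (?G z))\<^sup>2 * (if R \<le> norm (fst z) \<or> R \<le> snd z then 1 else 0))
      + s * (LINT x|lebesgue. (tr0 U x)\<^sup>2 * (if R \<le> norm x then 1 else 0))) \<longlongrightarrow> 0 + 0) at_top"
    by (intro tendsto_add) simp_all
  then show ?thesis unfolding energy_tail_def[abs_def] by simp
qed

lemma H1rho_norm_slab_mono:
  assumes "e \<in> H1rho \<alpha> (slab Y)" "Y' \<le> Y"
  shows "H1rho_norm \<alpha> (slab Y') e \<le> H1rho_norm \<alpha> (slab Y) e"
proof -
  obtain G where G: "has_weak_gradient_on e G (slab Y)" "set_integrable lebesgue (slab Y) (sobolev_density \<alpha> e G)"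
    using assms(1) by (rule H1rhoE)
  have G': "has_weak_gradient_on e G (slab Y')" by (rule has_weak_gradient_subset[OF G(1) slab_subset[OF assms(2)]])
  have fin': "set_integrable lebesgue (slab Y') (sobolev_density \<alpha> e G)"
    by (rule set_integrable_subset[OF G(2) _ slab_subset[OF assms(2)]]) simp
  have "(LINT z:slab Y'|lebesgue. sobolev_density \<alpha> e G z) \<le> (LINT z:slab Y|lebesgue. sobolev_density \<alpha> e G z)"
    unfolding set_lebesgue_integral_def
    using G(2) fin' slab_subset[OF assms(2)] sobolev_density_nonneg[of \<alpha> e G]
    by (intro integral_mono) (auto simp: set_integrable_def split: split_indicator)
  then show ?thesis
    unfolding H1rho_norm_eq[OF open_slab G(1)] H1rho_norm_eq[OF open_slab G'] by simp
qed

text \<open>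
  A slab of fixed height behaves like \<open>\<real>\<^sup>d\<close> at infinity.  In dimension 2 and without control of the trace, the
  inequality fails there: logarithmic cutoff functions that depend on \<open>x\<close> only have arbitrarily small energy,
  although their weighted \<open>L\<^sup>2\<close> norm is unbounded.  Hence the two cases.
\<close>

lemma uniform_Hardy:
  fixes \<beta> s :: real
  assumes \<beta>: "0 < \<beta>" "\<beta> < 1" and "0 \<le> s" and dim: "s = 0 \<longrightarrow> 3 \<le> DIM('a::euclidean_space)"
  shows "\<exists>C\<ge>0. \<forall>Y>0. \<forall>(e :: 'a \<times> real \<Rightarrow> real) G. has_weak_gradient_on e G (slab Y) \<longrightarrow>
      set_integrable lebesgue (slab Y) (sobolev_density (1 - 2 * \<beta>) e G) \<longrightarrow> (s > 0 \<longrightarrow> tr0 e \<in> L2) \<longrightarrow>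
      (LINT z|lebesgue. strip_weight (1 - 2 * \<beta>) Y z * (inverse ((rho z)\<^sup>2) * (e z)\<^sup>2))
        \<le> C * ((LINT z|lebesgue. strip_weight (1 - 2 * \<beta>) Y z * (norm (G z))\<^sup>2) + s * (LINT x|lebesgue. (tr0 e x)\<^sup>2))"
proof (cases "s = 0")
  case True
  show ?thesis
    using horizontal_Hardy[OF dim[rule_format, OF True]] True by (intro exI[of _ 4]) auto
next
  case False
  then have s: "0 < s" using assms by simp
  let ?\<alpha> = "1 - 2 * \<beta>"
  have \<alpha>: "-1 < ?\<alpha>" "?\<alpha> < 1" using \<beta> by auto
  define C1 where "C1 = 2 * (1 / (1 + ?\<alpha>) + 1 / (1 - ?\<alpha>))"
  define C2 where "C2 = 8 / (1 - ?\<alpha>)\<^sup>2"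
  have C: "0 \<le> C1" "0 \<le> C2" unfolding C1_def C2_def using \<beta> by auto
  show ?thesis
  proof (intro exI[of _ "C1 / s + C2"] conjI allI impI)
    show "0 \<le> C1 / s + C2" using C s by simp
    fix Y and e :: "'a \<times> real \<Rightarrow> real" and G
    assume h: "0 < Y" "has_weak_gradient_on e G (slab Y)" "set_integrable lebesgue (slab Y) (sobolev_density ?\<alpha> e G)" "s > 0 \<longrightarrow> tr0 e \<in> L2"
    let ?N1 = "LINT z|lebesgue. strip_weight ?\<alpha> Y z * (norm (G z))\<^sup>2" and ?T = "LINT x|lebesgue. (tr0 e x)\<^sup>2"
    have "0 \<le> ?N1" "0 \<le> ?T" by (auto intro!: integral_nonneg_AE)
    then have "0 \<le> C1 / s * ?N1" "0 \<le> C2 * (s * ?T)" using C s by auto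
    moreover have "(LINT z|lebesgue. strip_weight ?\<alpha> Y z * (inverse ((rho z)\<^sup>2) * (e z)\<^sup>2)) \<le> C1 * ?T + C2 * ?N1"
      unfolding C1_def C2_def by (rule trace_Hardy_integral[OF h(2,1) \<alpha> h(3)]) (use h s in blast)
    moreover have "C1 * ?T = C1 / s * (s * ?T)" using s by simp
    ultimately show "(LINT z|lebesgue. strip_weight ?\<alpha> Y z * (inverse ((rho z)\<^sup>2) * (e z)\<^sup>2)) \<le> (C1 / s + C2) * (?N1 + s * ?T)"
      unfolding distrib_left distrib_right by linarith
  qed
qed

theorem proposition2p4:
  fixes \<alpha> \<beta> s :: real
    and \<Omega> :: "(real^'n) set"
    and \<AA> :: "real^'n \<Rightarrow> real^'n^'n"
    and f :: "real^'n \<Rightarrow> real"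
    and U :: "(real^'n) \<times> real \<Rightarrow> real"
    and UY :: "real \<Rightarrow> (real^'n) \<times> real \<Rightarrow> real"
  assumes "CARD('n) = 2 \<or> CARD('n) = 3"
    and "0 < \<beta>" "\<beta> < 1"
    and "\<alpha> = 1 - 2 * \<beta>"
    and "0 \<le> s"
    and "CARD('n) = 2 \<Longrightarrow> 0 < s"
    and "bounded_lipschitz_domain \<Omega>"
    and "smooth \<AA>"
    and "\<And>x. transpose (\<AA> x) = \<AA> x"
    and "\<exists>A0>0. \<forall>x \<eta>. (\<AA> x *v \<eta>) \<bullet> \<eta> \<ge> A0 * (norm \<eta>)\<^sup>2"
    and "\<And>x. x \<notin> closure \<Omega> \<Longrightarrow> \<AA> x = mat 1"
    and "f \<in> L2"
    and "ess_support f \<subseteq> \<Omega>"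
    and "solves_on \<beta> s \<AA> f halfspace U"
    and "\<And>Y. 0 < Y \<Longrightarrow> solves_on \<beta> s \<AA> f (slab Y) (UY Y)"
  shows "(\<forall>Yt>0. H1rho_tendsto \<alpha> (slab Yt) UY U at_top) \<and>
         (s > 0 \<longrightarrow> L2_tendsto (\<lambda>Y. tr0 (UY Y)) (tr0 U) at_top)"
proof -
  note \<beta> = assms(2,3) and \<alpha> = assms(4) and s = assms(5) and U = assms(14) and UY = assms(15)
  have bdd: "bounded \<Omega>" using assms(7) by (simp add: bounded_lipschitz_domain_def)
  have cont: "continuous_on UNIV \<AA>"
  proof -
    have "C_times 0 \<AA>" using assms(8) unfolding smooth_def by blast
    then show ?thesis by simp
  qed
  obtain M where M: "\<And>x. norm (\<AA> x) \<le> M" using coefficient_bounded[OF cont bdd assms(11)] by blast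
  obtain A0 where A0: "0 < A0" "\<And>x \<xi>. A0 * (norm \<xi>)\<^sup>2 \<le> (\<AA> x *v \<xi>) \<bullet> \<xi>" using assms(10) by blast
  obtain R0 where R0: "\<And>x. x \<in> \<Omega> \<Longrightarrow> norm x < R0"
    using bdd by (auto simp: bounded_pos_less)
  have f: "f \<in> borel_measurable lebesgue" using assms(12) by (simp add: L2_def)
  have f0: "AE x in lebesgue. R0 \<le> norm x \<longrightarrow> f x = 0"
    using AE_zero_outside_ess_support[of f]
  proof eventually_elim
    fix x assume "x \<notin> ess_support f \<longrightarrow> f x = 0"
    then show "R0 \<le> norm x \<longrightarrow> f x = 0" using R0[of x] assms(13) by (metis not_le subsetD)
  qed
  have dim: "s = 0 \<longrightarrow> 3 \<le> DIM(real^'n)" using assms(1,6) by auto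
  obtain CH where CH: "0 \<le> CH" "\<forall>Y>0. \<forall>(e :: (real^'n) \<times> real \<Rightarrow> real) G. has_weak_gradient_on e G (slab Y) \<longrightarrow>
      set_integrable lebesgue (slab Y) (sobolev_density (1 - 2 * \<beta>) e G) \<longrightarrow> (s > 0 \<longrightarrow> tr0 e \<in> L2) \<longrightarrow>
      (LINT z|lebesgue. strip_weight (1 - 2 * \<beta>) Y z * (inverse ((rho z)\<^sup>2) * (e z)\<^sup>2))
        \<le> CH * ((LINT z|lebesgue. strip_weight (1 - 2 * \<beta>) Y z * (norm (G z))\<^sup>2) + s * (LINT x|lebesgue. (tr0 e x)\<^sup>2))"
    using uniform_Hardy[OF \<beta> s dim] by (elim exE conjE)
  obtain K where K: "0 \<le> K" "\<forall>Y V. 3 \<le> Y \<and> 3 * R0 \<le> Y \<and> solves_on \<beta> s \<AA> f (slab Y) V \<longrightarrow>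
     (H1rho_norm \<alpha> (slab Y) (\<lambda>z. V z - U z))\<^sup>2 + s * (LINT x|lebesgue. (tr0 V x - tr0 U x)\<^sup>2) \<le> K * energy_tail \<alpha> s U (Y / 3)"
    using truncation_energy_estimate[OF \<beta> s cont M A0 U f f0 CH] unfolding \<alpha> by (elim exE conjE) simp
  have UH: "U \<in> H1rho \<alpha> halfspace" and Utrial: "U \<in> trial_space \<beta> s halfspace"
    using U by (auto simp: solves_on_def trial_space_def \<alpha>)
  have UYH: "UY Y \<in> H1rho \<alpha> (slab Y)" and UYtr: "s > 0 \<Longrightarrow> tr0 (UY Y) \<in> L2" if "0 < Y" for Y
    using UY[OF that] by (auto simp: solves_on_def trial_space_def \<alpha>)
  have "filterlim (\<lambda>Y::real. Y / 3) at_top at_top"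
    by (rule filterlim_at_top_mult_tendsto_pos[where f = "\<lambda>_. 1 / 3", OF tendsto_const _ filterlim_ident, simplified])
  then have "((\<lambda>Y. energy_tail \<alpha> s U (Y / 3)) \<longlongrightarrow> 0) at_top"
    using energy_tail_tendsto_0[OF Utrial s] unfolding \<alpha> by (rule filterlim_compose[rotated])
  from tendsto_mult[OF tendsto_const[of K] this]
  have tail: "((\<lambda>Y. K * energy_tail \<alpha> s U (Y / 3)) \<longlongrightarrow> 0) at_top" by simp
  have large: "\<forall>\<^sub>F Y in at_top. 3 \<le> Y \<and> 3 * R0 \<le> Y \<and> Yt \<le> Y" for Yt :: real
    using eventually_ge_at_top[of "max 3 (max (3 * R0) Yt)"] by eventually_elim auto
  have est: "(H1rho_norm \<alpha> (slab Y) (\<lambda>z. UY Y z - U z))\<^sup>2 + s * (LINT x|lebesgue. (tr0 (UY Y) x - tr0 U x)\<^sup>2) \<le> K * energy_tail \<alpha> s U (Y / 3)"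
    if "3 \<le> Y" "3 * R0 \<le> Y" for Y
    using K(2) UY[of Y] that by simp
  have H: "H1rho_tendsto \<alpha> (slab Yt) UY U at_top" if "0 < Yt" for Yt
    unfolding H1rho_tendsto_def
  proof (intro conjI)
    show "\<forall>\<^sub>F Y in at_top. UY Y \<in> H1rho \<alpha> (slab Yt)"
      using large[of Yt]
    proof eventually_elim
      fix Y assume "3 \<le> Y \<and> 3 * R0 \<le> Y \<and> Yt \<le> Y"
      then show "UY Y \<in> H1rho \<alpha> (slab Yt)" using H1rho_subset[OF UYH open_slab open_slab slab_subset] by simp
    qed
    show "U \<in> H1rho \<alpha> (slab Yt)" by (rule H1rho_subset[OF UH open_halfspace open_slab slab_subset_halfspace])
    show "((\<lambda>Y. H1rho_norm \<alpha> (slab Yt) (\<lambda>z. UY Y z - U z)) \<longlongrightarrow> 0) at_top"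
    proof (rule tendsto_sandwich)
      show "\<forall>\<^sub>F Y in at_top. 0 \<le> H1rho_norm \<alpha> (slab Yt) (\<lambda>z. UY Y z - U z)"
        unfolding H1rho_norm_def set_lebesgue_integral_def
        by (intro always_eventually allI real_sqrt_ge_zero integral_nonneg_AE) (simp add: H1rho_density_def)
      show "\<forall>\<^sub>F Y in at_top. H1rho_norm \<alpha> (slab Yt) (\<lambda>z. UY Y z - U z) \<le> sqrt (K * energy_tail \<alpha> s U (Y / 3))"
        using large[of Yt]
      proof eventually_elim
        fix Y assume Y: "3 \<le> Y \<and> 3 * R0 \<le> Y \<and> Yt \<le> Y"
        have "UY Y \<in> H1rho \<alpha> (slab Y)" "U \<in> H1rho \<alpha> (slab Y)"
          using UYH Y H1rho_subset[OF UH open_halfspace open_slab slab_subset_halfspace] by auto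
        then obtain G1 G2 where G: "has_weak_gradient_on (UY Y) G1 (slab Y)" "set_integrable lebesgue (slab Y) (sobolev_density \<alpha> (UY Y) G1)"
            "has_weak_gradient_on U G2 (slab Y)" "set_integrable lebesgue (slab Y) (sobolev_density \<alpha> U G2)"
          by (meson H1rhoE)
        have "(\<lambda>z. UY Y z - U z) \<in> H1rho \<alpha> (slab Y)"
          using H1rho_iff[OF open_slab has_weak_gradient_diff[OF G(1,3)]] sobolev_density_diff_integrable[OF open_slab G(1,3,2,4)] by simp
        then have "H1rho_norm \<alpha> (slab Yt) (\<lambda>z. UY Y z - U z) \<le> H1rho_norm \<alpha> (slab Y) (\<lambda>z. UY Y z - U z)"
          using Y by (intro H1rho_norm_slab_mono) auto
        also have "\<dots> \<le> sqrt (K * energy_tail \<alpha> s U (Y / 3))"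
        proof (rule real_le_rsqrt)
          have "0 \<le> s * (LINT x|lebesgue. (tr0 (UY Y) x - tr0 U x)\<^sup>2)" using s by (auto intro!: mult_nonneg_nonneg integral_nonneg_AE)
          then show "(H1rho_norm \<alpha> (slab Y) (\<lambda>z. UY Y z - U z))\<^sup>2 \<le> K * energy_tail \<alpha> s U (Y / 3)"
            using est[of Y] Y by simp
        qed
        finally show "H1rho_norm \<alpha> (slab Yt) (\<lambda>z. UY Y z - U z) \<le> sqrt (K * energy_tail \<alpha> s U (Y / 3))" .
      qed
      show "((\<lambda>Y. 0) \<longlongrightarrow> (0::real)) at_top" by simp
      show "((\<lambda>Y. sqrt (K * energy_tail \<alpha> s U (Y / 3))) \<longlongrightarrow> 0) at_top"
        using tendsto_real_sqrt[OF tail] by simp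
    qed
  qed
  moreover have "L2_tendsto (\<lambda>Y. tr0 (UY Y)) (tr0 U) at_top" if "s > 0"
    unfolding L2_tendsto_def
  proof (intro conjI)
    show "\<forall>\<^sub>F Y in at_top. tr0 (UY Y) \<in> L2"
      using eventually_gt_at_top[of "0::real"] by eventually_elim (rule UYtr[OF _ that])
    show "tr0 U \<in> L2" using Utrial that by (simp add: trial_space_def)
    show "((\<lambda>Y. L2_norm (\<lambda>x. tr0 (UY Y) x - tr0 U x)) \<longlongrightarrow> 0) at_top"
    proof (rule tendsto_sandwich)
      show "\<forall>\<^sub>F Y in at_top. 0 \<le> L2_norm (\<lambda>x. tr0 (UY Y) x - tr0 U x)"
        unfolding L2_norm_def by (intro always_eventually allI real_sqrt_ge_zero integral_nonneg_AE) simp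
      show "\<forall>\<^sub>F Y in at_top. L2_norm (\<lambda>x. tr0 (UY Y) x - tr0 U x) \<le> sqrt (K * energy_tail \<alpha> s U (Y / 3) / s)"
        using large[of 3]
      proof eventually_elim
        fix Y assume Y: "3 \<le> Y \<and> 3 * R0 \<le> Y \<and> 3 \<le> Y"
        have "s * (LINT x|lebesgue. (tr0 (UY Y) x - tr0 U x)\<^sup>2) \<le> K * energy_tail \<alpha> s U (Y / 3)"
          using est[of Y] Y zero_le_power2[of "H1rho_norm \<alpha> (slab Y) (\<lambda>z. UY Y z - U z)"] by linarith
        then show "L2_norm (\<lambda>x. tr0 (UY Y) x - tr0 U x) \<le> sqrt (K * energy_tail \<alpha> s U (Y / 3) / s)"
          unfolding L2_norm_def using that by (simp add: le_divide_eq mult.commute)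
      qed
      show "((\<lambda>Y. 0) \<longlongrightarrow> (0::real)) at_top" by simp
      show "((\<lambda>Y. sqrt (K * energy_tail \<alpha> s U (Y / 3) / s)) \<longlongrightarrow> 0) at_top"
        using tendsto_real_sqrt[OF tendsto_divide[OF tail tendsto_const[of s]]] that by simp
    qed
  qed
  ultimately show ?thesis by blast
qed

end
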